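(* Let $X$ be an irreducible continuous-time Markov process on a finite set $\mathcal{X}$ with kernel $p$, reversible with respect to the probability measure $\mu$, and let $\mathcal{R}\subset\mathcal{X}$ be such that the restricted processes $X_{\mathcal{R}}$ and $X_{\mathcal{X}\setminus\mathcal{R}}$ are irreducible. For all $\lambda\ge0$: (1) $\phi^*_{\mathcal{R},\lambda}\le\phi^*_{\mathcal{R}}$, $\gamma_{\mathcal{R},\lambda}\ge\gamma_{\mathcal{R}}$ and $\varepsilon^*_{\mathcal{R},\lambda}\le\varepsilon^*_{\mathcal{R}}$. (2) If $\varepsilon^*_{\mathcal{R},\lambda}<1$, then $\mathrm{Var}_{\mu_{\mathcal{R}}}(h^*_{\mathcal{R},\lambda})=\|h^*_{\mathcal{R},\lambda}-\mathbf{1}_{\mathcal{R}}\|_{\mathcal{R}}^2\le\frac{\varepsilon^*_{\mathcal{R},\lambda}}{1-\varepsilon^*_{\mathcal{R},\lambda}}$. (3) If $\varepsilon^*_{\mathcal{R},\lambda}<1/3$, then $\frac{1}{\gamma^*_{\mathcal{R},\lambda}}\le\frac{1}{\gamma_{\mathcal{R},\lambda}}\left\{\frac{1-\varepsilon^*_{\mathcal{R},\lambda}}{1-3\varepsilon^*_{\mathcal{R},\lambda}}\right\}$. (4) If $\varepsilon^*_{\mathcal{R},\lambda}<1/3$, then for all $x,y\in\mathcal{R}$ and $\delta\in(0,1)$, $$\left|\frac{\mathbb{P}_x(X\circ\ell_{\mathcal{R}}^{-1}(t)=y\mid\tau_{\mathcal{X}\setminus\mathcal{R},\lambda}>t)}{\mu^*_{\mathcal{R},\lambda}(y)}-1\right|<\delta\quad\text{as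 soon as}\quad t>T^*_{\delta,\mathcal{R},\lambda}.$$ (5) With $\zeta_{\mathcal{R}}=\min_{x\in\mathcal{R}}\mu_{\mathcal{R}}(x)$ and $\alpha_{\mathcal{R},\lambda}=\max_{x\in\mathcal{R}}e_{\mathcal{R},\lambda}(x)$, $$\ln\frac{1}{\zeta^*_{\mathcal{R},\lambda}}\le\ln\frac{4}{\zeta_{\mathcal{R}}}+\frac{\alpha_{\mathcal{R},\lambda}}{\gamma_{\mathcal{R},\lambda}}\left[\ln\frac{4\varepsilon^*_{\mathcal{R},\lambda}}{(1-\varepsilon^*_{\mathcal{R},\lambda})\zeta_{\mathcal{R}}}\right]_+,$$ where $[\cdot]_+$ is the positive part. (6) If $p(x,x)>0$ for all $x\in\mathcal{R}$, then $\ln\frac{1}{\zeta^*_{\mathcal{R},\lambda}}\le\ln\frac{1}{\min_{x\in\mathcal{R}}\mu^*_{\mathcal{R},\lambda}(x)^2}\le2\Delta_{\mathcal{R},\lambda}D_{\mathcal{R},\lambda}$, where $\Delta_{\mathcal{R},\lambda}=\max\{-\ln p_{\mathcal{R},\lambda}(x,y):x,y\in\mathcal{R},\ p_{\mathcal{R},\lambda}(x,y)>0\}$ and $D_{\mathcal{R},\lambda}=\min\{k\ge0:(p_{\mathcal{R},\lambda})^k(x,y)>0\ \forall x,y\in\mathcal{R}\}$.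
   Context: $X$ has generator $\mathcal{L}f(x)=\sum_{y\in\mathcal{X}}p(x,y)(f(y)-f(x))$, $p\ge0$, $\sum_yp(x,y)=1$, $\mu(x)p(x,y)=\mu(y)p(y,x)$; it is seen as updated according to the transition matrix $p$ at each ring of a rate-1 Poisson clock. $\mathcal{R}$ is a nonempty proper subset of $\mathcal{X}$, $\mu_{\mathcal{R}}=\mu(\cdot\mid\mathcal{R})$, $\|f\|^2_{\mathcal{R}}=\sum_{x\in\mathcal{R}}\mu_{\mathcal{R}}(x)f(x)^2$. Hard quantities: the restricted process $X_{\mathcal{R}}$ has kernel $p_{\mathcal{R}}(x,y)=p(x,y)$ ($x\ne y$ in $\mathcal{R}$), $p_{\mathcal{R}}(x,x)=p(x,x)+\sum_{y\notin\mathcal{R}}p(x,y)$ (similarly for $\mathcal{X}\setminus\mathcal{R}$), and $\gamma_{\mathcal{R}}$ is its spectral gap: the minimum over $\mathrm{Var}_{\mu_{\mathcal{R}}}(f)\neq0$ of $\frac12\sum_{x,y\in\mathcal{R}}\mu_{\mathcal{R}}(x)p_{\mathcal{R}}(x,y)(f(x)-f(y))^2/\mathrm{Var}_{\mu_{\mathcal{R}}}(f)$. $1-\phi^*_{\mathcal{R}}$ is the spectral radius of $(p(x,y))_{x,y\in\mathcal{R}}$; $\varepsilon^*_{\mathcal{R}}=\phi^*_{\mathcal{R}}/\gamma_{\mathcal{R}}$. Soft quantities: for $A\subset\mathcal{X}$, $\ell_A(t)=\int_0^t\mathbf{1}_A(X(s))ds$ and $\ell_A^{-1}(t)=\inf\{s\ge0:\ell_A(s)>t\}$.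 $\sigma_\lambda$ is exponential with mean $1/\lambda$, independent of $X$ ($\sigma_0=+\infty$). $\tau$ is the first clock ring and $\tau^+_{\mathcal{R}}$ the first time $\ge\tau$ at which $X$ is in $\mathcal{R}$. For $x,y\in\mathcal{R}$: $p^*_{\mathcal{R},\lambda}(x,y)=\mathbb{P}_x(X(\tau^+_{\mathcal{R}})=y,\ \ell_{\mathcal{X}\setminus\mathcal{R}}(\tau^+_{\mathcal{R}})\le\sigma_\lambda)$; $e_{\mathcal{R},\lambda}(x)=1-\sum_{y\in\mathcal{R}}p^*_{\mathcal{R},\lambda}(x,y)$; $p_{\mathcal{R},\lambda}(x,y)=p^*_{\mathcal{R},\lambda}(x,y)$ if $x\ne y$, $p_{\mathcal{R},\lambda}(x,x)=p^*_{\mathcal{R},\lambda}(x,x)+e_{\mathcal{R},\lambda}(x)$. $\gamma_{\mathcal{R},\lambda}$ is the spectral gap of the $\mu_{\mathcal{R}}$-reversible kernel $p_{\mathcal{R},\lambda}$ (same formula with $p_{\mathcal{R},\lambda}$ in place of $p_{\mathcal{R}}$). $1-\phi^*_{\mathcal{R},\lambda}$ is the spectral radius of $p^*_{\mathcal{R},\lambda}$, $\mu^*_{\mathcal{R},\lambda}$ the unique probability measure on $\mathcal{R}$ that is a left eigenvector for it (soft measure), and $\gamma^*_{\mathcal{R},\lambda}$ the difference between the largest and second largest eigenvalues of $p^*_{\mathcal{R},\lambda}$. $\tau_{\mathcal{X}\setminus\mathcal{R},\lambda}=\ell_{\mathcal{R}}(\ell^{-1}_{\mathcal{X}\setminus\mathcal{R}}(\sigma_\lambda))$.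 $\varepsilon^*_{\mathcal{R},\lambda}=\phi^*_{\mathcal{R},\lambda}/\gamma_{\mathcal{R},\lambda}$, $h^*_{\mathcal{R},\lambda}=\mu^*_{\mathcal{R},\lambda}/\mu_{\mathcal{R}}$, $\zeta^*_{\mathcal{R},\lambda}=\min_{x\in\mathcal{R}}\mu_{\mathcal{R}}(x)h^*_{\mathcal{R},\lambda}(x)^2$, and for $\varepsilon^*_{\mathcal{R},\lambda}<1/3$, $\delta\in(0,1)$, $$T^*_{\delta,\mathcal{R},\lambda}=\frac{1}{\gamma_{\mathcal{R},\lambda}}\left(\ln\frac{2}{\delta(1-\delta)\zeta^*_{\mathcal{R},\lambda}}\right)\left(1+\sqrt{\frac{\varepsilon^*_{\mathcal{R},\lambda}}{1-\varepsilon^*_{\mathcal{R},\lambda}}}\right)\left(\frac{1-\varepsilon^*_{\mathcal{R},\lambda}}{1-3\varepsilon^*_{\mathcal{R},\lambda}}\right).$$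
   Formalization: In (6), Δ is the maximum of −ln p*_{R,λ}(x,y) over positive entries of p* instead of p_{R,λ}, since the bound with p_{R,λ} is false; (5) is stated for ε*_{R,λ} < 1, where its logarithm is defined (at ε* = 1 the right side is +∞). *)

theory Defs
  imports
    "HOL-Probability.Probability"
    "Jordan_Normal_Form.Spectral_Radius"
begin

text \<open>
  The finite state space is a type of class \<open>finite\<close>. Kernels are real functions of two states;
  a kernel on a subset \<open>R\<close> is read only at arguments in \<open>R\<close>.
\<close>


section \<open>Kernels on a finite set\<close>

definition stochastic_kernel :: "('a::finite \<Rightarrow> 'a \<Rightarrow> real) \<Rightarrow> bool" where
  "stochastic_kernel p \<longleftrightarrow> (\<forall>x y. 0 \<le> p x y) \<and> (\<forall>x. (\<Sum>y\<in>UNIV. p x y) = 1)"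

definition probability_vector :: "'a set \<Rightarrow> ('a::finite \<Rightarrow> real) \<Rightarrow> bool" where
  "probability_vector R \<nu> \<longleftrightarrow>
     (\<forall>x. 0 \<le> \<nu> x) \<and> (\<forall>x. x \<notin> R \<longrightarrow> \<nu> x = 0) \<and> (\<Sum>x\<in>R. \<nu> x) = 1"

definition reversible :: "('a \<Rightarrow> real) \<Rightarrow> ('a \<Rightarrow> 'a \<Rightarrow> real) \<Rightarrow> bool" where
  "reversible \<mu> p \<longleftrightarrow> (\<forall>x y. \<mu> x * p x y = \<mu> y * p y x)"

definition irreducible_on :: "'a set \<Rightarrow> ('a \<Rightarrow> 'a \<Rightarrow> real) \<Rightarrow> bool" where
  "irreducible_on R K \<longleftrightarrow>
     (\<forall>x\<in>R. \<forall>y\<in>R. (x, y) \<in> {(u, v). u \<in> R \<and> v \<in> R \<and> 0 < K u v}\<^sup>*)"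

definition cond_vector :: "('a::finite \<Rightarrow> real) \<Rightarrow> 'a set \<Rightarrow> 'a \<Rightarrow> real" where
  "cond_vector \<mu> R x = (if x \<in> R then \<mu> x / (\<Sum>z\<in>R. \<mu> z) else 0)"

definition restricted_kernel :: "('a::finite \<Rightarrow> 'a \<Rightarrow> real) \<Rightarrow> 'a set \<Rightarrow> 'a \<Rightarrow> 'a \<Rightarrow> real" where
  "restricted_kernel p R x y = (if x = y then p x x + (\<Sum>z\<in>-R. p x z) else p x y)"

definition escape_prob :: "('a::finite \<Rightarrow> 'a \<Rightarrow> real) \<Rightarrow> 'a set \<Rightarrow> 'a \<Rightarrow> real" where
  "escape_prob K R x = 1 - (\<Sum>y\<in>R. K x y)"

definition completed_kernel :: "('a::finite \<Rightarrow> 'a \<Rightarrow> real) \<Rightarrow> 'a set \<Rightarrow> 'a \<Rightarrow> 'a \<Rightarrow> real" where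
  "completed_kernel K R x y = (if x = y then K x x + escape_prob K R x else K x y)"

definition norm2_on :: "'a set \<Rightarrow> ('a::finite \<Rightarrow> real) \<Rightarrow> ('a \<Rightarrow> real) \<Rightarrow> real" where
  "norm2_on R \<nu> f = (\<Sum>x\<in>R. \<nu> x * (f x)\<^sup>2)"

definition mean_on :: "'a set \<Rightarrow> ('a::finite \<Rightarrow> real) \<Rightarrow> ('a \<Rightarrow> real) \<Rightarrow> real" where
  "mean_on R \<nu> f = (\<Sum>x\<in>R. \<nu> x * f x)"

definition var_on :: "'a set \<Rightarrow> ('a::finite \<Rightarrow> real) \<Rightarrow> ('a \<Rightarrow> real) \<Rightarrow> real" where
  "var_on R \<nu> f = (\<Sum>x\<in>R. \<nu> x * (f x - mean_on R \<nu> f)\<^sup>2)"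

definition dirichlet_on ::
    "'a set \<Rightarrow> ('a::finite \<Rightarrow> real) \<Rightarrow> ('a \<Rightarrow> 'a \<Rightarrow> real) \<Rightarrow> ('a \<Rightarrow> real) \<Rightarrow> real" where
  "dirichlet_on R \<nu> K f = (1/2) * (\<Sum>x\<in>R. \<Sum>y\<in>R. \<nu> x * K x y * (f x - f y)\<^sup>2)"

text \<open>
  Spectral gaps are extended reals only because of singletons: if \<open>R\<close> has one point, no function
  has nonzero variance and the minimum over the empty set is \<open>\<infinity>\<close>.
\<close>

definition spectral_gap ::
    "'a set \<Rightarrow> ('a::finite \<Rightarrow> real) \<Rightarrow> ('a \<Rightarrow> 'a \<Rightarrow> real) \<Rightarrow> ereal" where
  "spectral_gap R \<nu> K =
     (INF f\<in>{f. var_on R \<nu> f \<noteq> 0}. ereal (dirichlet_on R \<nu> K f / var_on R \<nu> f))"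

text \<open>
  The matrix of a kernel on \<open>R\<close>, with the points of \<open>R\<close> enumerated by \<^const>\<open>from_nat_into\<close>.
\<close>

definition kernel_mat :: "'a set \<Rightarrow> ('a::finite \<Rightarrow> 'a \<Rightarrow> real) \<Rightarrow> real mat" where
  "kernel_mat R K =
     mat (card R) (card R) (\<lambda>(i, j). K (from_nat_into R i) (from_nat_into R j))"

text \<open>One minus the spectral radius.\<close>

definition escape_rate :: "'a set \<Rightarrow> ('a::finite \<Rightarrow> 'a \<Rightarrow> real) \<Rightarrow> real" where
  "escape_rate R K = 1 - spectral_radius (map_mat complex_of_real (kernel_mat R K))"

text \<open>
  Largest minus second largest eigenvalue, where eigenvalues are counted with multiplicity. Without
  a second eigenvalue (singleton \<open>R\<close>) the supremum is \<open>-\<infinity>\<close> and the difference is \<open>\<infinity>\<close>.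
\<close>

definition eigenvalue_gap :: "'a set \<Rightarrow> ('a::finite \<Rightarrow> 'a \<Rightarrow> real) \<Rightarrow> ereal" where
  "eigenvalue_gap R K =
     (let E = proots (char_poly (kernel_mat R K)); k = Max_mset E
      in ereal k - (SUP j\<in>set_mset (E - {#k#}). ereal j))"

definition quasi_stationary :: "'a set \<Rightarrow> ('a::finite \<Rightarrow> 'a \<Rightarrow> real) \<Rightarrow> 'a \<Rightarrow> real" where
  "quasi_stationary R K =
     (THE \<nu>. probability_vector R \<nu> \<and> (\<exists>k. \<forall>y\<in>R. (\<Sum>x\<in>R. \<nu> x * K x y) = k * \<nu> y))"

text \<open>The ratio is finite whenever the gap is positive.\<close>

definition eps_ratio :: "real \<Rightarrow> ereal \<Rightarrow> real" where
  "eps_ratio \<phi> \<gamma> = real_of_ereal (ereal \<phi> / \<gamma>)"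

definition mixing_bound :: "ereal \<Rightarrow> real \<Rightarrow> real \<Rightarrow> real \<Rightarrow> ereal" where
  "mixing_bound \<gamma> \<epsilon> \<zeta> \<delta> =
     (1 / \<gamma>) * ereal (ln (2 / (\<delta> * (1 - \<delta>) * \<zeta>))
        * (1 + sqrt (\<epsilon> / (1 - \<epsilon>))) * ((1 - \<epsilon>) / (1 - 3 * \<epsilon>)))"

text \<open>
  The maximum of \<open>-ln\<close> over the positive entries, and the smallest power (possibly zero) of the
  kernel all of whose entries are positive. In the final lower bound on the soft measure,
  \<open>max_neg_ln\<close> is taken for the sub-Markovian kernel \<open>p\<^sup>*\<close> of which the soft measure is a left
  eigenvector: the bound fails when the escape probability is added on the diagonal.
\<close>

definition max_neg_ln :: "'a set \<Rightarrow> ('a::finite \<Rightarrow> 'a \<Rightarrow> real) \<Rightarrow> real" where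
  "max_neg_ln R K = Max {- ln (K x y) | x y. x \<in> R \<and> y \<in> R \<and> 0 < K x y}"

definition positivity_exponent :: "'a set \<Rightarrow> ('a::finite \<Rightarrow> 'a \<Rightarrow> real) \<Rightarrow> nat" where
  "positivity_exponent R K =
     (LEAST k. \<forall>i<card R. \<forall>j<card R. 0 < (kernel_mat R K ^\<^sub>m k) $$ (i, j))"


section \<open>The process and its local times\<close>

text \<open>
  The process is updated according to \<open>p\<close> at each ring of a rate-one Poisson clock: \<open>\<xi> n\<close> is the
  time between the rings number \<open>n\<close> and \<open>n + 1\<close>, and \<open>Y n\<close> is the state after \<open>n\<close> rings.
\<close>

definition rate_one_clock :: "'w measure \<Rightarrow> (nat \<Rightarrow> 'w \<Rightarrow> real) \<Rightarrow> bool" where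
  "rate_one_clock M \<xi> \<longleftrightarrow>
     prob_space.indep_vars M (\<lambda>_. borel) \<xi> UNIV \<and>
     (\<forall>n. distributed M lborel (\<xi> n) (exponential_density 1))"

definition markov_chain_from ::
    "('a::finite \<Rightarrow> 'a \<Rightarrow> real) \<Rightarrow> 'a \<Rightarrow> 'w measure \<Rightarrow> (nat \<Rightarrow> 'w \<Rightarrow> 'a) \<Rightarrow> bool" where
  "markov_chain_from p x M Y \<longleftrightarrow>
     (\<forall>n. Y n \<in> measurable M (count_space UNIV)) \<and>
     (\<forall>n xs. \<P>(\<omega> in M. \<forall>i\<le>n. Y i \<omega> = xs i) =
        (if xs 0 = x then \<Prod>i<n. p (xs i) (xs (Suc i)) else 0))"

definition killing_law :: "real \<Rightarrow> ennreal measure" where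
  "killing_law l =
     (if l = 0 then return borel \<infinity>
      else distr (density lborel (exponential_density l)) borel ennreal)"

text \<open>
  Independence of two random variables with values in different types, which
  \<^const>\<open>prob_space.indep_var\<close> does not cover.
\<close>

definition independent_rv ::
    "'w measure \<Rightarrow> 'b measure \<Rightarrow> ('w \<Rightarrow> 'b) \<Rightarrow> 'c measure \<Rightarrow> ('w \<Rightarrow> 'c) \<Rightarrow> bool" where
  "independent_rv M N\<^sub>1 X\<^sub>1 N\<^sub>2 X\<^sub>2 \<longleftrightarrow>
     X\<^sub>1 \<in> measurable M N\<^sub>1 \<and> X\<^sub>2 \<in> measurable M N\<^sub>2 \<and>
     prob_space.indep_set M
       {X\<^sub>1 -` A \<inter> space M | A. A \<in> sets N\<^sub>1} {X\<^sub>2 -` A \<inter> space M | A. A \<in> sets N\<^sub>2}"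

text \<open>
  \<open>M\<close> plays the role of the law \<open>P\<^sub>x\<close> of the process started in \<open>x\<close>. The clock, the embedded chain
  and the killing time \<open>\<sigma>\<close>, with exponential law of rate \<open>l\<close>, are jointly independent.
\<close>

definition clock_model ::
    "('a::finite \<Rightarrow> 'a \<Rightarrow> real) \<Rightarrow> real \<Rightarrow> 'a \<Rightarrow> 'w measure \<Rightarrow>
     (nat \<Rightarrow> 'w \<Rightarrow> real) \<Rightarrow> (nat \<Rightarrow> 'w \<Rightarrow> 'a) \<Rightarrow> ('w \<Rightarrow> ennreal) \<Rightarrow> bool" where
  "clock_model p l x M \<xi> Y \<sigma> \<longleftrightarrow>
     prob_space M \<and> rate_one_clock M \<xi> \<and> markov_chain_from p x M Y \<and>
     distr M borel \<sigma> = killing_law l \<and>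
     independent_rv M
       (\<Pi>\<^sub>M n\<in>UNIV. borel) (\<lambda>\<omega> n. \<xi> n \<omega>)
       (\<Pi>\<^sub>M n\<in>UNIV. count_space UNIV) (\<lambda>\<omega> n. Y n \<omega>) \<and>
     independent_rv M
       ((\<Pi>\<^sub>M n\<in>UNIV. borel) \<Otimes>\<^sub>M (\<Pi>\<^sub>M n\<in>UNIV. count_space UNIV))
         (\<lambda>\<omega>. (\<lambda>n. \<xi> n \<omega>, \<lambda>n. Y n \<omega>))
       borel \<sigma>"

definition ring_count :: "(nat \<Rightarrow> 'w \<Rightarrow> real) \<Rightarrow> real \<Rightarrow> 'w \<Rightarrow> nat" where
  "ring_count \<xi> t \<omega> = card {n. (\<Sum>i\<le>n. \<xi> i \<omega>) \<le> t}"

definition process ::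
    "(nat \<Rightarrow> 'w \<Rightarrow> real) \<Rightarrow> (nat \<Rightarrow> 'w \<Rightarrow> 'a) \<Rightarrow> real \<Rightarrow> 'w \<Rightarrow> 'a" where
  "process \<xi> Y t \<omega> = Y (ring_count \<xi> t \<omega>) \<omega>"

text \<open>
  Random times range over \<open>[0,\<infinity>]\<close>. The process is evaluated at such times through \<^const>\<open>enn2real\<close>;
  for an irreducible chain the times concerned are almost surely finite.
\<close>

definition local_time ::
    "(nat \<Rightarrow> 'w \<Rightarrow> real) \<Rightarrow> (nat \<Rightarrow> 'w \<Rightarrow> 'a) \<Rightarrow> 'a set \<Rightarrow> ennreal \<Rightarrow> 'w \<Rightarrow> ennreal" where
  "local_time \<xi> Y A t \<omega> =
     (\<integral>\<^sup>+ s\<in>{s. 0 \<le> s \<and> ennreal s \<le> t}. indicator A (process \<xi> Y s \<omega>) \<partial>lborel)"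

definition inv_local_time ::
    "(nat \<Rightarrow> 'w \<Rightarrow> real) \<Rightarrow> (nat \<Rightarrow> 'w \<Rightarrow> 'a) \<Rightarrow> 'a set \<Rightarrow> ennreal \<Rightarrow> 'w \<Rightarrow> ennreal" where
  "inv_local_time \<xi> Y A t \<omega> = Inf {s. t < local_time \<xi> Y A s \<omega>}"

definition trace_process ::
    "(nat \<Rightarrow> 'w \<Rightarrow> real) \<Rightarrow> (nat \<Rightarrow> 'w \<Rightarrow> 'a) \<Rightarrow> 'a set \<Rightarrow> real \<Rightarrow> 'w \<Rightarrow> 'a" where
  "trace_process \<xi> Y R t \<omega> =
     process \<xi> Y (enn2real (inv_local_time \<xi> Y R (ennreal t) \<omega>)) \<omega>"

text \<open>\<open>\<xi> 0\<close> is the time of the first ring.\<close>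

definition return_time ::
    "(nat \<Rightarrow> 'w \<Rightarrow> real) \<Rightarrow> (nat \<Rightarrow> 'w \<Rightarrow> 'a) \<Rightarrow> 'a set \<Rightarrow> 'w \<Rightarrow> ennreal" where
  "return_time \<xi> Y R \<omega> = Inf {ennreal t | t. \<xi> 0 \<omega> \<le> t \<and> process \<xi> Y t \<omega> \<in> R}"

definition soft_exit_time ::
    "(nat \<Rightarrow> 'w \<Rightarrow> real) \<Rightarrow> (nat \<Rightarrow> 'w \<Rightarrow> 'a) \<Rightarrow> ('w \<Rightarrow> ennreal) \<Rightarrow> 'a set \<Rightarrow> 'w \<Rightarrow> ennreal" where
  "soft_exit_time \<xi> Y \<sigma> R \<omega> =
     local_time \<xi> Y R (inv_local_time \<xi> Y (-R) (\<sigma> \<omega>) \<omega>) \<omega>"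

definition soft_kernel ::
    "('a \<Rightarrow> 'w measure) \<Rightarrow> (nat \<Rightarrow> 'w \<Rightarrow> real) \<Rightarrow> (nat \<Rightarrow> 'w \<Rightarrow> 'a) \<Rightarrow> ('w \<Rightarrow> ennreal) \<Rightarrow>
     'a set \<Rightarrow> 'a \<Rightarrow> 'a \<Rightarrow> real" where
  "soft_kernel M \<xi> Y \<sigma> R x y =
     \<P>(\<omega> in M x. process \<xi> Y (enn2real (return_time \<xi> Y R \<omega>)) \<omega> = y \<and>
                  local_time \<xi> Y (-R) (return_time \<xi> Y R \<omega>) \<omega> \<le> \<sigma> \<omega>)"

end

theory Submission
  imports Defs
begin

text \<open>
  On the probabilistic side, a path of the embedded chain that spends \<open>k\<close> steps in \<open>R\<close> and \<open>m\<close> steps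
  outside \<open>R\<close> survives the killing with probability \<open>(1 / (1 + l)) ^ m\<close>, and its local time in \<open>R\<close>
  straddles \<open>t\<close> with probability \<open>exp (- t) * t ^ k / fact k\<close>, independently. Cutting the paths at
  their successive visits to \<open>R\<close> shows that the trace process killed at the soft exit time has the
  semigroup \<open>exp (t * (K - 1))\<close> generated by the soft kernel \<open>K\<close>; reversing the excursions outside
  \<open>R\<close> shows that \<open>K\<close> is reversible.

  The rest is linear algebra for the \<open>\<nu>\<close>-symmetric kernel \<open>K\<close>. The density \<open>h\<close> of the soft measure is
  its Perron eigenfunction. The Dirichlet form of \<open>h\<close> is at most \<open>\<phi>\<close> times its squared norm, so the
  Poincare inequality bounds its variance; Cauchy-Schwarz then transfers the gap from the complement
  of the constants to the complement of \<open>h\<close>, and an orthonormal eigenbasis gives the convergence. The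
  lower bounds on the soft measure come from comparing \<open>K\<close> with the completed kernel entrywise.
\<close>

section \<open>Eigenbases of reversible kernels\<close>

text \<open>\<open>flow_decay\<close> needs one eigenfunction and a gap on its orthogonal
  complement. It is used twice: for the soft kernel with h and k0, which gives the convergence, and
  for the completed kernel with the constants and eigenvalue 1, which gives the lower bound on h.
  The Poincare constant g concerns functions centered for \<nu>, the first use needs functions
  orthogonal to h; this change of reference, with the drop of the top eigenvalue from 1 to 1 - g
  \<epsilon>, produces the threshold 1/3.

  The events are reduced to one path functional, \<open>weighted_paths\<close>, whose weight sees
  only the number of steps that start in R. Its values are summed in [0,\<infinity>], where
  rearrangement is free; finiteness returns because the sums are probabilities. Both sides meet in
  the series of t^k / k! times the k-th kernel power: the spectral flow and the rescaled law of the
  trace process are its sum, so no matrix exponential is built.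

  On a single point the gap is \<infinity> and not a real g; this case is separated in the final
  proof.\<close>

lemma nonneg_quadratic_linear_term_zero:
  fixes a c :: real
  assumes "\<And>s. 0 \<le> 2 * s * a + s\<^sup>2 * c"
  shows "a = 0"
proof (rule ccontr)
  assume a: "a \<noteq> 0"
  show False
  proof (cases "c \<le> 0")
    case True
    have "(- a)\<^sup>2 * c \<le> 0" using True by (simp add: mult_nonneg_nonpos)
    moreover have "2 * (- a) * a < 0" using a by (cases "a < 0") (auto simp: zero_less_mult_iff mult_less_0_iff)
    ultimately show False using assms[of "- a"] by linarith
  next
    case False
    then have c: "c > 0" by simp
    have "2 * (- a / c) * a + (- a / c)\<^sup>2 * c = - (a\<^sup>2 / c)"
      using c by (simp add: field_simps power2_eq_square)
    moreover have "a\<^sup>2 / c > 0" using a c by simp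
    ultimately show False using assms[of "- a / c"] by linarith
  qed
qed

text \<open>First-order condition on the sphere: k |w|^2 - <w, T w> is nonnegative on S and vanishes
  at v, so its linear part at v vanishes in every direction of S. In the direction of the residual u
  = k v - T v this linear part is <u, u>.\<close>

lemma rayleigh_maximizer:
  fixes T :: "'v::euclidean_space \<Rightarrow> 'v"
  assumes T: "linear T" and S: "real_vector.subspace S" and inv: "\<And>v. v \<in> S \<Longrightarrow> T v \<in> S"
    and sym: "\<And>v w. v \<in> S \<Longrightarrow> w \<in> S \<Longrightarrow> inner (T v) w = inner v (T w)"
    and v: "v \<in> S" "norm v = 1"
    and mx: "\<And>w. w \<in> S \<Longrightarrow> norm w = 1 \<Longrightarrow> inner w (T w) \<le> inner v (T v)"
  shows "T v = inner v (T v) *\<^sub>R v"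
proof -
  define k where "k = inner v (T v)"
  have q: "inner w (T w) \<le> k * inner w w" if w: "w \<in> S" for w
  proof (cases "w = 0")
    case True then show ?thesis using linear_0[OF T] by simp
  next
    case False
    let ?u = "(1 / norm w) *\<^sub>R w"
    have "?u \<in> S" using S w by (simp add: real_vector.subspace_scale)
    moreover have "norm ?u = 1" using False by simp
    ultimately have "inner ?u (T ?u) \<le> k" using mx k_def by blast
    then have "inner w (T w) / (norm w)\<^sup>2 \<le> k"
      by (simp add: linear_scale[OF T] power2_eq_square)
    then show ?thesis using False
      by (simp add: divide_le_eq power2_norm_eq_inner[symmetric])
  qed
  define u where "u = k *\<^sub>R v - T v"
  have u: "u \<in> S" unfolding u_def using S v inv by (simp add: real_vector.subspace_diff real_vector.subspace_scale)
  have "inner u u = 0"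
  proof (rule nonneg_quadratic_linear_term_zero)
    fix s :: real
    have "v + s *\<^sub>R u \<in> S" using S v u by (simp add: real_vector.subspace_add real_vector.subspace_scale)
    from q[OF this] have "0 \<le> k * inner (v + s *\<^sub>R u) (v + s *\<^sub>R u) - inner (v + s *\<^sub>R u) (T (v + s *\<^sub>R u))"
      by simp
    also have "\<dots> = k * inner v v - inner v (T v) + 2 * s * (k * inner v u - inner u (T v))
        + s\<^sup>2 * (k * inner u u - inner u (T u))"
      using sym[OF v(1) u]
      by (simp add: linear_add[OF T] linear_scale[OF T] inner_add_left inner_add_right
          inner_commute power2_eq_square algebra_simps)
    also have "k * inner v v - inner v (T v) = 0" using v k_def by (simp add: norm_eq_1)
    also have "k * inner v u - inner u (T v) = inner u u"
      by (simp add: u_def inner_diff_left inner_diff_right inner_commute algebra_simps)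
    finally show "0 \<le> 2 * s * inner u u + s\<^sup>2 * (k * inner u u - inner u (T u))" by simp
  qed
  then show ?thesis using u_def k_def by simp
qed

text \<open>Induction on the dimension of S: compactness of the unit sphere gives a Rayleigh
  maximizer v, and symmetry keeps the complement of v in S invariant. Subspaces S appear in the
  statement for this induction, and because the application is to vectors supported on R.\<close>

theorem self_adjoint_orthonormal_eigenbasis:
  fixes T :: "'v::euclidean_space \<Rightarrow> 'v"
  assumes T: "linear T" and S: "real_vector.subspace S" and inv: "\<And>v. v \<in> S \<Longrightarrow> T v \<in> S"
    and sym: "\<And>v w. v \<in> S \<Longrightarrow> w \<in> S \<Longrightarrow> inner (T v) w = inner v (T w)"
  shows "\<exists>B. finite B \<and> B \<subseteq> S \<and> pairwise real_inner_class.orthogonal B \<and> (\<forall>b\<in>B. norm b = 1) \<and> real_vector.span B = S \<and>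
           (\<forall>b\<in>B. \<exists>k. T b = k *\<^sub>R b)"
  using S inv sym
proof (induction "real_vector.dim S" arbitrary: S rule: less_induct)
  case less
  show ?case
  proof (cases "S = {0}")
    case True then show ?thesis by (intro exI[of _ "{}"]) auto
  next
    case False
    define U where "U = S \<inter> sphere 0 1"
    have "compact U" unfolding U_def
      using closed_subspace[OF less.prems(1)] by (simp add: closed_Int_compact)
    moreover obtain w where w: "w \<in> S" "w \<noteq> 0" using False real_vector.subspace_0[OF less.prems(1)] by auto
    then have "(1 / norm w) *\<^sub>R w \<in> U" unfolding U_def
      using less.prems(1) by (auto simp: real_vector.subspace_scale)
    then have "U \<noteq> {}" by auto
    moreover have "continuous_on U (\<lambda>w. inner w (T w))"
      using T by (intro continuous_on_inner continuous_on_id linear_continuous_on)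
        (simp add: linear_conv_bounded_linear)
    ultimately obtain v where v: "v \<in> U" "\<And>w. w \<in> U \<Longrightarrow> inner w (T w) \<le> inner v (T v)"
      using continuous_attains_sup[of U] by metis
    then have vS: "v \<in> S" "norm v = 1" by (auto simp: U_def)
    have Tv: "T v = inner v (T v) *\<^sub>R v"
      by (rule rayleigh_maximizer[OF T less.prems vS]) (use v in \<open>auto simp: U_def\<close>)
    define k where "k = inner v (T v)"
    define S' where "S' = {w \<in> S. inner w v = 0}"
    have vv: "inner v v = 1" using vS by (simp add: norm_eq_1)
    have S': "real_vector.subspace S'" unfolding S'_def real_vector.subspace_def using less.prems(1)
      by (auto simp: real_vector.subspace_0 real_vector.subspace_add real_vector.subspace_scale inner_add_left)
    have inv': "T w \<in> S'" if "w \<in> S'" for w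
    proof -
      have w: "w \<in> S" "inner w v = 0" using that by (auto simp: S'_def)
      have "inner (T w) v = inner w (T v)" using less.prems(3)[OF w(1) vS(1)] .
      also have "\<dots> = 0" by (subst Tv) (simp add: w)
      finally show ?thesis using w less.prems(2) by (simp add: S'_def)
    qed
    have "v \<in> S - S'" using vS vv by (simp add: S'_def)
    moreover have "S' \<subseteq> S" by (auto simp: S'_def)
    ultimately have "S' \<subset> S" by blast
    then have "real_vector.dim S' < real_vector.dim S"
      using dim_psubset[of S' S] S' less.prems(1) by (metis real_vector.span_eq_iff)
    then obtain B where B: "finite B" "B \<subseteq> S'" "pairwise real_inner_class.orthogonal B" "\<forall>b\<in>B. norm b = 1"
      "real_vector.span B = S'" "\<forall>b\<in>B. \<exists>k. T b = k *\<^sub>R b"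
      using less.hyps[OF _ S' inv'] less.prems(3) by (metis (no_types, lifting) S'_def mem_Collect_eq)
    show ?thesis
    proof (intro exI[of _ "insert v B"] conjI)
      show "pairwise real_inner_class.orthogonal (insert v B)"
        using B(2,3) by (auto simp: pairwise_insert real_inner_class.orthogonal_def S'_def inner_commute)
      show "real_vector.span (insert v B) = S"
      proof
        show "real_vector.span (insert v B) \<subseteq> S" using B(2) vS less.prems(1)
          by (intro real_vector.span_minimal) (auto simp: S'_def)
        show "S \<subseteq> real_vector.span (insert v B)"
        proof
          fix w assume w: "w \<in> S"
          have "w - inner w v *\<^sub>R v \<in> S'" unfolding S'_def using w vS vv less.prems(1)
            by (auto simp: real_vector.subspace_diff real_vector.subspace_scale inner_diff_left)
          then show "w \<in> real_vector.span (insert v B)" using B(5) by (auto simp: real_vector.span_insert)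
        qed
      qed
      show "\<forall>b\<in>insert v B. \<exists>k. T b = k *\<^sub>R b" using Tv B(6) by auto
    qed (use B vS in \<open>auto simp: S'_def\<close>)
  qed
qed


section \<open>The weighted inner product and kernels as operators\<close>

definition inner_on :: "'a set \<Rightarrow> ('a \<Rightarrow> real) \<Rightarrow> ('a \<Rightarrow> real) \<Rightarrow> ('a \<Rightarrow> real) \<Rightarrow> real" where
  "inner_on R \<nu> f g = (\<Sum>x\<in>R. \<nu> x * f x * g x)"

definition kernel_op :: "'a set \<Rightarrow> ('a \<Rightarrow> 'a \<Rightarrow> real) \<Rightarrow> ('a \<Rightarrow> real) \<Rightarrow> 'a \<Rightarrow> real" where
  "kernel_op R K f x = (\<Sum>y\<in>R. K x y * f y)"

lemma inner_on_commute: "inner_on R \<nu> f g = inner_on R \<nu> g f"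
  by (simp add: inner_on_def mult_ac)

lemma inner_on_cong:
  "(\<And>x. x \<in> R \<Longrightarrow> f x = f' x) \<Longrightarrow> (\<And>x. x \<in> R \<Longrightarrow> g x = g' x) \<Longrightarrow>
    inner_on R \<nu> f g = inner_on R \<nu> f' g'"
  by (simp add: inner_on_def)

lemma kernel_op_cong: "(\<And>y. y \<in> R \<Longrightarrow> f y = g y) \<Longrightarrow> kernel_op R K f x = kernel_op R K g x"
  by (simp add: kernel_op_def)

lemma inner_on_diff_left: "inner_on R \<nu> (\<lambda>x. f x - g x) k = inner_on R \<nu> f k - inner_on R \<nu> g k"
  by (simp add: inner_on_def algebra_simps sum_subtractf)

lemma inner_on_scale_left: "inner_on R \<nu> (\<lambda>x. a * f x) k = a * inner_on R \<nu> f k"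
  by (simp add: inner_on_def sum_distrib_left mult_ac)

lemma inner_on_diff_right: "inner_on R \<nu> k (\<lambda>x. f x - g x) = inner_on R \<nu> k f - inner_on R \<nu> k g"
  by (simp add: inner_on_def algebra_simps sum_subtractf)

lemma inner_on_scale_right: "inner_on R \<nu> k (\<lambda>x. a * f x) = a * inner_on R \<nu> k f"
  by (simp add: inner_on_def sum_distrib_left mult_ac)

lemma kernel_op_diff: "kernel_op R K (\<lambda>x. f x - g x) x = kernel_op R K f x - kernel_op R K g x"
  by (simp add: kernel_op_def algebra_simps sum_subtractf)

lemma kernel_op_scale: "kernel_op R K (\<lambda>x. a * f x) x = a * kernel_op R K f x"
  by (simp add: kernel_op_def sum_distrib_left mult_ac)

lemma sum_from_nat_into:
  fixes R :: "'a::finite set" and f :: "'a \<Rightarrow> 'b::comm_monoid_add"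
  shows "(\<Sum>i<card R. f (from_nat_into R i)) = (\<Sum>x\<in>R. f x)"
  by (intro sum.reindex_bij_betw bij_betw_from_nat_into_finite) simp

lemma proots_prod_linear_factors:
  fixes xs :: "'b::idom list"
  shows "proots (\<Prod>a\<leftarrow>xs. [:- a, 1:]) = mset xs"
proof (induction xs)
  case (Cons a xs)
  have "(\<Prod>a\<leftarrow>xs. [:- a, 1:]) \<noteq> 0" by (auto simp: prod_list_zero_iff)
  then have "proots ([:- a, 1:] * (\<Prod>a\<leftarrow>xs. [:- a, 1:])) = proots [:- a, 1:] + proots (\<Prod>a\<leftarrow>xs. [:- a, 1:])"
    by (intro proots_mult) auto
  then show ?case using Cons by simp
qed simp

locale reversible_kernel =
  fixes R :: "'a::finite set" and \<nu> :: "'a \<Rightarrow> real" and K :: "'a \<Rightarrow> 'a \<Rightarrow> real"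
  assumes pos: "x \<in> R \<Longrightarrow> 0 < \<nu> x"
    and rev: "x \<in> R \<Longrightarrow> y \<in> R \<Longrightarrow> \<nu> x * K x y = \<nu> y * K y x"
begin

lemma inner_on_self_nonneg: "0 \<le> inner_on R \<nu> f f"
  unfolding inner_on_def by (intro sum_nonneg) (simp add: mult.assoc less_imp_le[OF pos])

lemma inner_on_self_eq_0: "inner_on R \<nu> f f = 0 \<longleftrightarrow> (\<forall>x\<in>R. f x = 0)"
  unfolding inner_on_def mult.assoc
  by (subst sum_nonneg_eq_0_iff) (use pos in \<open>force simp: less_imp_le[OF pos]\<close>)+

lemma kernel_op_symmetric: "inner_on R \<nu> f (kernel_op R K g) = inner_on R \<nu> (kernel_op R K f) g"
proof -
  have "inner_on R \<nu> f (kernel_op R K g) = (\<Sum>x\<in>R. \<Sum>y\<in>R. (\<nu> x * K x y) * (f x * g y))"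
    by (simp add: inner_on_def kernel_op_def sum_distrib_left mult_ac)
  also have "\<dots> = (\<Sum>x\<in>R. \<Sum>y\<in>R. (\<nu> y * K y x) * (f x * g y))"
    by (intro sum.cong refl) (simp add: rev)
  also have "\<dots> = (\<Sum>y\<in>R. \<Sum>x\<in>R. (\<nu> y * K y x) * (f x * g y))"
    by (rule sum.swap)
  also have "\<dots> = inner_on R \<nu> (kernel_op R K f) g"
    by (simp add: inner_on_def kernel_op_def sum_distrib_left sum_distrib_right mult_ac)
  finally show ?thesis .
qed

end

text \<open>The assumption \<open>complete\<close> is the resolution of the identity. Carried along
  with orthonormality, it saves dimension counts: expansions, Parseval's identity and the
  diagonalization of the matrix follow by exchanging sums.\<close>

locale eigenbasis = reversible_kernel R \<nu> K
  for R :: "'a::finite set" and \<nu> :: "'a \<Rightarrow> real" and K :: "'a \<Rightarrow> 'a \<Rightarrow> real" +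
  fixes \<psi> :: "nat \<Rightarrow> 'a \<Rightarrow> real" and ev :: "nat \<Rightarrow> real"
  assumes orthonormal: "i < card R \<Longrightarrow> j < card R \<Longrightarrow> inner_on R \<nu> (\<psi> i) (\<psi> j) = (if i = j then 1 else 0)"
    and eigen: "i < card R \<Longrightarrow> x \<in> R \<Longrightarrow> kernel_op R K (\<psi> i) x = ev i * \<psi> i x"
    and complete: "x \<in> R \<Longrightarrow> y \<in> R \<Longrightarrow> (\<Sum>i<card R. \<psi> i x * \<psi> i y) * \<nu> y = (if x = y then 1 else 0)"

text \<open>Conjugation by \<open>sqrt \<nu>\<close> turns reversibility into symmetry for the Euclidean inner product.\<close>

lemma (in reversible_kernel) ex_eigenbasis: "\<exists>\<psi> ev. eigenbasis R \<nu> K \<psi> ev"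
proof -
  define N where "N = card R"
  define c where "c x = sqrt (\<nu> x)" for x
  have c: "x \<in> R \<Longrightarrow> c x > 0" "x \<in> R \<Longrightarrow> c x * c x = \<nu> x" "x \<in> R \<Longrightarrow> c x \<noteq> 0" for x
    using pos[of x] by (auto simp: c_def)
  define A where "A x y = (if x \<in> R \<and> y \<in> R then c x * K x y / c y else 0)" for x y
  have A: "A x y = A y x" for x y
  proof (cases "x \<in> R \<and> y \<in> R")
    case True
    then have "(c x * c x) * K x y = (c y * c y) * K y x" unfolding c(2)[OF conjunct1[OF True]] c(2)[OF conjunct2[OF True]] using rev by blast
    then have "c x * K x y / c y = c y * K y x / c x"
      using c(3)[of x] c(3)[of y] True by (simp add: frac_eq_eq mult_ac)
    then show ?thesis using True by (simp add: A_def)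
  qed (auto simp: A_def)
  define T :: "(real, 'a) Finite_Cartesian_Product.vec \<Rightarrow> (real, 'a) Finite_Cartesian_Product.vec"
    where "T v = vec_lambda (\<lambda>x. \<Sum>y\<in>UNIV. A x y * vec_nth v y)" for v
  define S where "S = {v :: (real, 'a) Finite_Cartesian_Product.vec. \<forall>x. x \<notin> R \<longrightarrow> vec_nth v x = 0}"
  have "linear T"
    by (rule linearI) (simp_all add: T_def Finite_Cartesian_Product.vec_eq_iff algebra_simps sum.distrib sum_distrib_left)
  moreover have "real_vector.subspace S"
    by (simp add: S_def real_vector.subspace_def)
  moreover have "T v \<in> S" for v by (simp add: S_def T_def A_def)
  moreover have "inner (T v) w = inner v (T w)" for v w
  proof -
    have "inner (T v) w = (\<Sum>x\<in>UNIV. \<Sum>y\<in>UNIV. A x y * vec_nth v y * vec_nth w x)"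
      by (simp add: inner_vec_def T_def sum_distrib_right)
    also have "\<dots> = (\<Sum>y\<in>UNIV. \<Sum>x\<in>UNIV. A x y * vec_nth v y * vec_nth w x)"
      by (rule sum.swap)
    also have "\<dots> = inner v (T w)"
      by (simp add: inner_vec_def T_def sum_distrib_left A mult_ac)
    finally show ?thesis .
  qed
  ultimately obtain B where B: "finite B" "B \<subseteq> S" "pairwise real_inner_class.orthogonal B"
      "\<And>b. b \<in> B \<Longrightarrow> norm b = 1" "real_vector.span B = S" "\<And>b. b \<in> B \<Longrightarrow> \<exists>k. T b = k *\<^sub>R b"
    using self_adjoint_orthonormal_eigenbasis[of T S] by metis
  \<comment> \<open>Coordinate x of the expansion of the unit vector at y, which belongs to the span
    because y is in R.\<close>
  have compl: "(\<Sum>b\<in>B. vec_nth b x * vec_nth b y) = (if x = y then 1 else 0)" if "x \<in> R" "y \<in> R" for x y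
  proof -
    have "axis y 1 \<in> real_vector.span B" unfolding B(5) using that by (auto simp: S_def axis_def)
    from orthonormal_basis_expand[OF B(3) B(4) this B(1)]
    have "(\<Sum>b\<in>B. inner (axis y 1) b *\<^sub>R b) = axis y 1" .
    then have "vec_nth (\<Sum>b\<in>B. inner (axis y 1) b *\<^sub>R b) x = vec_nth (axis y 1) x" by simp
    then have "(\<Sum>b\<in>B. vec_nth b x * vec_nth b y) = vec_nth (axis y 1) x"
      by (simp add: inner_axis' mult.commute)
    then show ?thesis by (simp add: axis_def)
  qed
  have orth: "(\<Sum>x\<in>R. vec_nth a x * vec_nth b x) = (if a = b then 1 else 0)" if "a \<in> B" "b \<in> B" for a b
  proof -
    have "(\<Sum>x\<in>R. vec_nth a x * vec_nth b x) = inner a b"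
      unfolding inner_vec_def inner_real_def
      by (rule sum.mono_neutral_left) (use B(2) that in \<open>auto simp: S_def\<close>)
    also have "\<dots> = (if a = b then 1 else 0)"
      using B(3,4) that by (auto simp: pairwise_def real_inner_class.orthogonal_def norm_eq_1)
    finally show ?thesis .
  qed
  \<comment> \<open>The squares of all coordinates are summed in two ways: by basis vectors, each of
    norm 1, and by points of R, each contributing 1 by completeness.\<close>
  have "real (card B) = (\<Sum>b\<in>B. \<Sum>x\<in>R. vec_nth b x * vec_nth b x)" by (simp add: orth)
  also have "\<dots> = (\<Sum>x\<in>R. \<Sum>b\<in>B. vec_nth b x * vec_nth b x)" by (rule sum.swap)
  also have "\<dots> = real (card R)" by (simp add: compl)
  finally have "card B = card R" by simp
  then obtain g where g: "bij_betw g {..<card R} B"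
    using B(1) by (metis bij_betw_from_nat_into_finite)
  obtain lam where lam: "\<And>b. b \<in> B \<Longrightarrow> T b = lam b *\<^sub>R b" using B(6) by metis
  define \<psi> where "\<psi> i x = vec_nth (g i) x / c x" for i x
  have gB: "i < card R \<Longrightarrow> g i \<in> B" for i using g by (auto simp: bij_betw_def)
  have "eigenbasis R \<nu> K \<psi> (\<lambda>i. lam (g i))"
  proof unfold_locales
    fix i j assume ij: "i < card R" "j < card R"
    have "inner_on R \<nu> (\<psi> i) (\<psi> j) = (\<Sum>x\<in>R. vec_nth (g i) x * vec_nth (g j) x)"
      unfolding inner_on_def
      by (intro sum.cong refl) (simp add: \<psi>_def c(2)[symmetric] c(3))
    also have "\<dots> = (if i = j then 1 else 0)"
      using ij g gB by (auto simp: orth bij_betw_def inj_on_def)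
    finally show "inner_on R \<nu> (\<psi> i) (\<psi> j) = (if i = j then 1 else 0)" .
  next
    fix i x assume i: "i < card R" and x: "x \<in> R"
    have "lam (g i) * vec_nth (g i) x = vec_nth (T (g i)) x" using lam[OF gB[OF i]] by simp
    also have "\<dots> = (\<Sum>y\<in>R. A x y * vec_nth (g i) y)"
      unfolding T_def vec_lambda_beta by (rule sum.mono_neutral_right) (auto simp: A_def)
    also have "\<dots> = c x * kernel_op R K (\<psi> i) x"
      unfolding kernel_op_def sum_distrib_left
      by (intro sum.cong refl) (simp add: A_def x \<psi>_def)
    finally show "kernel_op R K (\<psi> i) x = lam (g i) * \<psi> i x"
      using c[OF x] by (simp add: \<psi>_def field_simps)
  next
    fix x y assume xy: "x \<in> R" "y \<in> R"
    have "(\<Sum>i<card R. \<psi> i x * \<psi> i y) = (\<Sum>i<card R. vec_nth (g i) x * vec_nth (g i) y) / (c x * c y)"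
      by (simp add: \<psi>_def sum_divide_distrib)
    also have "(\<Sum>i<card R. vec_nth (g i) x * vec_nth (g i) y) = (\<Sum>b\<in>B. vec_nth b x * vec_nth b y)"
      using sum.reindex_bij_betw[OF g, of "\<lambda>b. vec_nth b x * vec_nth b y"] by simp
    finally show "(\<Sum>i<card R. \<psi> i x * \<psi> i y) * \<nu> y = (if x = y then 1 else 0)"
      using xy c[of y] c[of x] by (auto simp: compl)
  qed
  then show ?thesis by blast
qed

section \<open>Spectral calculus in an eigenbasis\<close>

context eigenbasis
begin

lemma expand: "x \<in> R \<Longrightarrow> f x = (\<Sum>i<card R. inner_on R \<nu> f (\<psi> i) * \<psi> i x)"
proof -
  assume x: "x \<in> R"
  have "(\<Sum>i<card R. inner_on R \<nu> f (\<psi> i) * \<psi> i x) =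
      (\<Sum>i<card R. \<Sum>y\<in>R. f y * (\<psi> i x * \<psi> i y * \<nu> y))"
    by (simp add: inner_on_def sum_distrib_left mult_ac)
  also have "\<dots> = (\<Sum>y\<in>R. \<Sum>i<card R. f y * (\<psi> i x * \<psi> i y * \<nu> y))" by (rule sum.swap)
  also have "\<dots> = (\<Sum>y\<in>R. f y * ((\<Sum>i<card R. \<psi> i x * \<psi> i y) * \<nu> y))"
    by (simp add: sum_distrib_left sum_distrib_right)
  also have "\<dots> = (\<Sum>y\<in>R. f y * (if x = y then 1 else 0))"
    by (intro sum.cong refl) (simp only: complete[OF x])
  also have "\<dots> = f x" using x by (simp add: if_distrib[of "\<lambda>z. _ * z"] cong: if_cong)
  finally show ?thesis ..
qed

lemma parseval: "inner_on R \<nu> f g = (\<Sum>i<card R. inner_on R \<nu> f (\<psi> i) * inner_on R \<nu> g (\<psi> i))"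
proof -
  have "inner_on R \<nu> f g = (\<Sum>x\<in>R. \<nu> x * (\<Sum>i<card R. inner_on R \<nu> f (\<psi> i) * \<psi> i x) * g x)"
    unfolding inner_on_def[of R \<nu> f g] by (intro sum.cong refl) (simp flip: expand)
  also have "\<dots> = (\<Sum>x\<in>R. \<Sum>i<card R. inner_on R \<nu> f (\<psi> i) * (\<nu> x * g x * \<psi> i x))"
    by (simp add: sum_distrib_left sum_distrib_right mult_ac)
  also have "\<dots> = (\<Sum>i<card R. \<Sum>x\<in>R. inner_on R \<nu> f (\<psi> i) * (\<nu> x * g x * \<psi> i x))"
    by (rule sum.swap)
  also have "\<dots> = (\<Sum>i<card R. inner_on R \<nu> f (\<psi> i) * inner_on R \<nu> g (\<psi> i))"
    by (simp add: inner_on_def[of R \<nu> g] sum_distrib_left)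
  finally show ?thesis .
qed

lemma inner_kernel_op_basis: "i < card R \<Longrightarrow> inner_on R \<nu> (kernel_op R K f) (\<psi> i) = ev i * inner_on R \<nu> f (\<psi> i)"
  using inner_on_cong[of R f f "kernel_op R K (\<psi> i)" "\<lambda>x. ev i * \<psi> i x" \<nu>]
  by (simp add: kernel_op_symmetric[symmetric] eigen inner_on_scale_right)

lemma quadratic_form: "inner_on R \<nu> f (kernel_op R K f) = (\<Sum>i<card R. ev i * (inner_on R \<nu> f (\<psi> i))\<^sup>2)"
  by (subst parseval) (simp add: inner_kernel_op_basis power2_eq_square mult_ac)

lemma inner_power_basis: "i < card R \<Longrightarrow> inner_on R \<nu> ((kernel_op R K ^^ m) f) (\<psi> i) = ev i ^ m * inner_on R \<nu> f (\<psi> i)"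
  by (induction m) (auto simp: inner_kernel_op_basis)

lemma power_expand: "x \<in> R \<Longrightarrow> (kernel_op R K ^^ m) f x = (\<Sum>i<card R. ev i ^ m * inner_on R \<nu> f (\<psi> i) * \<psi> i x)"
  by (subst expand) (auto simp: inner_power_basis)

lemma sum_basis_squares: "x \<in> R \<Longrightarrow> (\<Sum>i<card R. (\<psi> i x)\<^sup>2) = 1 / \<nu> x"
  using complete[of x x] pos[of x] by (simp add: power2_eq_square field_simps)

text \<open>This is exp(t K) f in eigencoordinates. The factor exp(-t), which would make K - 1 the
  generator, is left out; it cancels in the conditional probabilities.\<close>

definition flow :: "real \<Rightarrow> ('a \<Rightarrow> real) \<Rightarrow> 'a \<Rightarrow> real" where
  "flow t f x = (\<Sum>i<card R. exp (t * ev i) * inner_on R \<nu> f (\<psi> i) * \<psi> i x)"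

text \<open>The exponential series is the interface to probability: the path expansion of the trace
  process produces the same series, and uniqueness of sums identifies the two.\<close>

lemma flow_sums:
  assumes "x \<in> R"
  shows "(\<lambda>m. t ^ m / fact m * (kernel_op R K ^^ m) f x) sums flow t f x"
proof -
  have "(\<lambda>m. \<Sum>i<card R. (t * ev i) ^ m /\<^sub>R fact m * inner_on R \<nu> f (\<psi> i) * \<psi> i x) sums flow t f x"
    unfolding flow_def
    by (intro sums_sum sums_mult2 exp_converges)
  moreover have "(\<Sum>i<card R. (t * ev i) ^ m /\<^sub>R fact m * inner_on R \<nu> f (\<psi> i) * \<psi> i x)
      = t ^ m / fact m * (kernel_op R K ^^ m) f x" for m
    by (simp add: power_expand[OF assms] sum_distrib_left power_mult_distrib field_simps)
  ultimately show ?thesis by simp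
qed

text \<open>The matrix is V D W with the eigenfunctions as columns of V and W their \<nu>-weighted
  transpose: V W = 1 is \<open>complete\<close>, W V = 1 is \<open>orthonormal\<close>. Similarity
  to a diagonal matrix then counts the eigenvalues with multiplicity.\<close>

lemma proots_char_poly:
  "proots (char_poly (kernel_mat R K)) = image_mset ev (mset_set {..<card R})"
proof -
  define n where "n = card R"
  define r where "r = from_nat_into R"
  have r: "i < n \<Longrightarrow> r i \<in> R" for i
    using bij_betw_from_nat_into_finite[of R] by (auto simp: n_def r_def bij_betw_def)
  have rinj: "i < n \<Longrightarrow> j < n \<Longrightarrow> r i = r j \<longleftrightarrow> i = j" for i j
    using bij_betw_from_nat_into_finite[of R] by (auto simp: n_def r_def bij_betw_def inj_on_def)
  have rsum: "(\<Sum>i<n. f (r i)) = (\<Sum>x\<in>R. f x)" for f :: "'a \<Rightarrow> real"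
    unfolding n_def r_def by (rule sum_from_nat_into)
  define A where "A = kernel_mat R K"
  define V where "V = mat n n (\<lambda>(i, j). \<psi> j (r i))"
  define W where "W = mat n n (\<lambda>(i, j). \<psi> i (r j) * \<nu> (r j))"
  define D where "D = mat n n (\<lambda>(i, j). if i = j then ev i else 0)"
  have carr: "{A, D, V, W} \<subseteq> carrier_mat n n"
    by (simp add: A_def V_def W_def D_def kernel_mat_def n_def)
  have "V * W = 1\<^sub>m n"
    by (rule eq_matI) (auto simp: V_def W_def scalar_prod_def atLeast0LessThan mult.assoc[symmetric]
        sum_distrib_right[symmetric] complete[OF r r, folded n_def] rinj)
  moreover have "W * V = 1\<^sub>m n"
  proof (rule eq_matI)
    fix i j assume "i < dim_row (1\<^sub>m n)" "j < dim_col (1\<^sub>m n)"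
    then have ij: "i < n" "j < n" by auto
    have "(W * V) $$ (i, j) = (\<Sum>k<n. (\<lambda>x. \<nu> x * \<psi> i x * \<psi> j x) (r k))"
      using ij by (simp add: V_def W_def scalar_prod_def atLeast0LessThan mult_ac)
    also have "\<dots> = 1\<^sub>m n $$ (i, j)"
      using orthonormal[of i j] ij by (subst rsum) (simp add: n_def inner_on_def)
    finally show "(W * V) $$ (i, j) = 1\<^sub>m n $$ (i, j)" .
  qed (auto simp: V_def W_def)
  moreover have "A = V * D * W"
  proof (rule eq_matI)
    fix i j assume "i < dim_row (V * D * W)" "j < dim_col (V * D * W)"
    then have ij: "i < n" "j < n" by (auto simp: V_def W_def)
    have VD: "V * D = mat n n (\<lambda>(i, k). ev k * \<psi> k (r i))"
      by (rule eq_matI) (auto simp: V_def D_def scalar_prod_def if_distrib[of "\<lambda>z. _ * z"] cong: if_cong)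
    have "(V * D * W) $$ (i, j) = (\<Sum>k<n. ev k * \<psi> k (r i) * (\<psi> k (r j) * \<nu> (r j)))"
      unfolding VD using ij by (simp add: scalar_prod_def W_def atLeast0LessThan)
    also have "\<dots> = (\<Sum>k<n. kernel_op R K (\<psi> k) (r i) * (\<psi> k (r j) * \<nu> (r j)))"
      using ij by (intro sum.cong refl) (simp add: eigen[OF _ r, folded n_def])
    also have "\<dots> = (\<Sum>k<n. \<Sum>y\<in>R. K (r i) y * (\<psi> k y * \<psi> k (r j) * \<nu> (r j)))"
      by (simp add: kernel_op_def sum_distrib_right sum_distrib_left mult_ac)
    also have "\<dots> = (\<Sum>y\<in>R. \<Sum>k<n. K (r i) y * (\<psi> k y * \<psi> k (r j) * \<nu> (r j)))" by (rule sum.swap)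
    also have "\<dots> = (\<Sum>y\<in>R. K (r i) y * ((\<Sum>k<card R. \<psi> k y * \<psi> k (r j)) * \<nu> (r j)))"
      by (simp add: sum_distrib_left sum_distrib_right n_def)
    also have "\<dots> = (\<Sum>y\<in>R. K (r i) y * (if y = r j then 1 else 0))"
      by (intro sum.cong refl) (simp only: complete[OF _ r[OF ij(2)]])
    also have "\<dots> = A $$ (i, j)"
      using ij r[OF ij(2)] by (simp add: A_def kernel_mat_def n_def r_def if_distrib[of "\<lambda>z. _ * z"] cong: if_cong)
    finally show "A $$ (i, j) = (V * D * W) $$ (i, j)" ..
  qed (use carr in auto)
  ultimately have "similar_mat A D"
    using carr by (intro similar_matI[of _ _ V W n])
  then have "char_poly A = char_poly D" by (rule char_poly_similar)
  also have "\<dots> = (\<Prod>a\<leftarrow>diag_mat D. [:- a, 1:])"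
    by (rule char_poly_upper_triangular[of _ n]) (auto simp: D_def)
  also have "diag_mat D = map ev [0..<n]" by (auto simp: diag_mat_def D_def)
  finally have "char_poly A = (\<Prod>a\<leftarrow>map ev [0..<n]. [:- a, 1:])" .
  then have "proots (char_poly A) = mset (map ev [0..<n])"
    by (simp only: proots_prod_linear_factors)
  also have "\<dots> = image_mset ev (mset_set {..<n})"
    by (simp add: atLeast0LessThan)
  finally show ?thesis by (simp add: A_def n_def)
qed

end

lemma kernel_mat_carrier: "kernel_mat R K \<in> carrier_mat (card R) (card R)"
  by (simp add: kernel_mat_def)

context eigenbasis
begin

section \<open>A gap on the orthogonal complement of one eigenfunction\<close>

context
  fixes g0 :: "'a \<Rightarrow> real" and k0 c :: real
  assumes g0: "\<And>x. x \<in> R \<Longrightarrow> kernel_op R K g0 x = k0 * g0 x"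
    and g0_pos: "0 < inner_on R \<nu> g0 g0"
    and c: "0 < c"
    and gap: "\<And>g. inner_on R \<nu> g g0 = 0 \<Longrightarrow> inner_on R \<nu> g (kernel_op R K g) \<le> (k0 - c) * inner_on R \<nu> g g"
begin

text \<open>The part of the eigenfunction orthogonal to g0 is again an eigenfunction for k0, and the
  gap forces its norm to vanish. The normalization of a is kept because a^2 is the projection
  coefficient in \<open>flow_decay\<close>.\<close>

lemma top_eigenfunction:
  assumes i: "i < card R" and ev: "ev i = k0"
  shows "\<exists>a. (\<forall>x\<in>R. \<psi> i x = a * g0 x) \<and> a\<^sup>2 * inner_on R \<nu> g0 g0 = 1"
proof -
  define a where "a = inner_on R \<nu> (\<psi> i) g0 / inner_on R \<nu> g0 g0"
  define g where "g x = \<psi> i x - a * g0 x" for x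
  have "inner_on R \<nu> g g0 = 0"
    using g0_pos unfolding g_def inner_on_diff_left inner_on_scale_left by (simp add: a_def)
  from gap[OF this] have *: "inner_on R \<nu> g (kernel_op R K g) \<le> (k0 - c) * inner_on R \<nu> g g" .
  have "kernel_op R K g x = k0 * g x" if "x \<in> R" for x
    using that i unfolding g_def kernel_op_diff kernel_op_scale
    by (simp add: eigen g0 ev algebra_simps)
  then have "inner_on R \<nu> g (kernel_op R K g) = inner_on R \<nu> g (\<lambda>x. k0 * g x)"
    by (intro inner_on_cong) auto
  then have "c * inner_on R \<nu> g g \<le> 0" using * by (simp add: inner_on_scale_right algebra_simps)
  then have "inner_on R \<nu> g g = 0"
    using c inner_on_self_nonneg[of g] by (simp add: mult_le_0_iff)
  then have eq: "\<forall>x\<in>R. \<psi> i x = a * g0 x" by (simp add: inner_on_self_eq_0 g_def)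
  have "1 = inner_on R \<nu> (\<psi> i) (\<psi> i)" using i by (simp add: orthonormal)
  also have "\<dots> = inner_on R \<nu> (\<lambda>x. a * g0 x) (\<lambda>x. a * g0 x)"
    using eq by (intro inner_on_cong) auto
  finally show ?thesis using eq
    by (auto simp: inner_on_scale_left inner_on_scale_right power2_eq_square mult.assoc)
qed

text \<open>Symmetry makes eigenfunctions for different eigenvalues orthogonal, so the gap
  hypothesis applies to the basis function itself.\<close>

lemma lower_eigenfunction:
  assumes i: "i < card R" and ev: "ev i \<noteq> k0"
  shows "inner_on R \<nu> g0 (\<psi> i) = 0" and "ev i \<le> k0 - c"
proof -
  have "ev i * inner_on R \<nu> g0 (\<psi> i) = inner_on R \<nu> (kernel_op R K g0) (\<psi> i)"
    using i by (simp add: inner_kernel_op_basis)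
  also have "\<dots> = inner_on R \<nu> (\<lambda>x. k0 * g0 x) (\<psi> i)"
    by (intro inner_on_cong) (auto simp: g0)
  finally have "(ev i - k0) * inner_on R \<nu> g0 (\<psi> i) = 0"
    by (simp add: inner_on_scale_left algebra_simps)
  then show "inner_on R \<nu> g0 (\<psi> i) = 0" using ev by simp
  then have "inner_on R \<nu> (\<psi> i) (kernel_op R K (\<psi> i)) \<le> (k0 - c) * inner_on R \<nu> (\<psi> i) (\<psi> i)"
    by (intro gap) (simp add: inner_on_commute)
  moreover have "inner_on R \<nu> (\<psi> i) (kernel_op R K (\<psi> i)) = inner_on R \<nu> (\<psi> i) (\<lambda>x. ev i * \<psi> i x)"
    using i by (intro inner_on_cong) (auto simp: eigen)
  ultimately show "ev i \<le> k0 - c" using i by (simp add: inner_on_scale_right orthonormal)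
qed

text \<open>If k0 were missing, all coefficients of g0 would vanish, against Parseval; two indices
  would give two orthonormal functions on the line of g0.\<close>

lemma ex1_top_eigenvalue: "\<exists>!i. i < card R \<and> ev i = k0"
proof (rule ex_ex1I)
  show "\<exists>i. i < card R \<and> ev i = k0"
  proof (rule ccontr)
    assume "\<not> ?thesis"
    then have "inner_on R \<nu> g0 g0 = 0"
      by (subst parseval) (auto simp: lower_eigenfunction)
    then show False using g0_pos by simp
  qed
next
  fix i j assume i: "i < card R \<and> ev i = k0" and j: "j < card R \<and> ev j = k0"
  obtain a where a: "\<forall>x\<in>R. \<psi> i x = a * g0 x" "a\<^sup>2 * inner_on R \<nu> g0 g0 = 1"
    using top_eigenfunction i by blast
  obtain b where b: "\<forall>x\<in>R. \<psi> j x = b * g0 x" "b\<^sup>2 * inner_on R \<nu> g0 g0 = 1"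
    using top_eigenfunction j by blast
  have "inner_on R \<nu> (\<psi> i) (\<psi> j) = inner_on R \<nu> (\<lambda>x. a * g0 x) (\<lambda>x. b * g0 x)"
    using a b by (intro inner_on_cong) auto
  also have "\<dots> \<noteq> 0" using a b g0_pos by (auto simp: inner_on_scale_left inner_on_scale_right)
  finally show "i = j" using i j by (auto simp: orthonormal split: if_splits)
qed

text \<open>Simplicity of k0 ensures that removing a single copy from the multiset leaves only
  values up to k0 - c. On a singleton nothing is left, and the supremum -\<infinity> makes the bound
  true for every admissible c.\<close>

lemma eigenvalue_gap_ge: "ereal c \<le> eigenvalue_gap R K"
proof -
  obtain i0 where i0: "i0 < card R" "ev i0 = k0" "\<And>i. i < card R \<Longrightarrow> ev i = k0 \<Longrightarrow> i = i0"
    using ex1_top_eigenvalue by auto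
  define E where "E = image_mset ev (mset_set {..<card R})"
  have le: "ev i \<le> k0" if "i < card R" for i
    using lower_eigenfunction(2)[OF that] c by (cases "ev i = k0") auto
  have "Max_mset E = k0"
    unfolding E_def by (rule Max_eqI) (use i0 le in auto)
  moreover have "mset_set {..<card R} = {#i0#} + mset_set ({..<card R} - {i0})"
    using i0(1) by (simp add: mset_set.remove)
  then have "E - {#k0#} = image_mset ev (mset_set ({..<card R} - {i0}))"
    unfolding E_def using i0(2) by simp
  ultimately have "eigenvalue_gap R K = ereal k0 - (SUP j\<in>ev ` ({..<card R} - {i0}). ereal j)"
    unfolding eigenvalue_gap_def proots_char_poly E_def[symmetric] Let_def by simp
  moreover have "(SUP j\<in>ev ` ({..<card R} - {i0}). ereal j) \<le> ereal (k0 - c)"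
    by (rule SUP_least) (use i0(3) lower_eigenfunction(2) in auto)
  then have "ereal k0 - ereal (k0 - c) \<le> ereal k0 - (SUP j\<in>ev ` ({..<card R} - {i0}). ereal j)"
    by (intro ereal_minus_mono) auto
  ultimately show ?thesis by simp
qed

text \<open>The index of k0 contributes exactly the projection onto g0. In all other terms the
  exponential is at most exp(t (k0 - c)), and Cauchy-Schwarz over the index separates f from the
  point x: Parseval gives the norm of f, completeness gives 1 / \<nu> x.\<close>

lemma flow_decay:
  assumes x: "x \<in> R" and t: "0 \<le> t"
  shows "\<bar>flow t f x - exp (t * k0) * (inner_on R \<nu> f g0 / inner_on R \<nu> g0 g0) * g0 x\<bar>
    \<le> exp (t * (k0 - c)) * sqrt (inner_on R \<nu> f f / \<nu> x)"
proof -
  obtain i0 where i0: "i0 < card R" "ev i0 = k0" "\<And>i. i < card R \<Longrightarrow> ev i = k0 \<Longrightarrow> i = i0"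
    using ex1_top_eigenvalue by auto
  obtain a where a: "\<forall>x\<in>R. \<psi> i0 x = a * g0 x" "a\<^sup>2 * inner_on R \<nu> g0 g0 = 1"
    using top_eigenfunction i0 by blast
  let ?T = "\<lambda>i. exp (t * ev i) * inner_on R \<nu> f (\<psi> i) * \<psi> i x"
  have "inner_on R \<nu> f (\<psi> i0) = inner_on R \<nu> f (\<lambda>x. a * g0 x)"
    using a by (intro inner_on_cong) auto
  then have "?T i0 = exp (t * k0) * (a\<^sup>2 * inner_on R \<nu> f g0) * g0 x"
    using a(1) x i0(2) by (simp add: inner_on_scale_right power2_eq_square)
  also have "a\<^sup>2 = 1 / inner_on R \<nu> g0 g0" using a(2) g0_pos by (simp add: field_simps)
  finally have "flow t f x - exp (t * k0) * (inner_on R \<nu> f g0 / inner_on R \<nu> g0 g0) * g0 x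
      = (\<Sum>i\<in>{..<card R} - {i0}. ?T i)"
    unfolding flow_def using i0(1) by (subst sum.remove[of _ i0]) auto
  also have "\<bar>\<dots>\<bar> \<le> (\<Sum>i\<in>{..<card R} - {i0}. exp (t * (k0 - c)) * (\<bar>inner_on R \<nu> f (\<psi> i)\<bar> * \<bar>\<psi> i x\<bar>))"
  proof (rule order_trans[OF sum_abs], rule sum_mono)
    fix i assume "i \<in> {..<card R} - {i0}"
    then have "ev i \<le> k0 - c" using lower_eigenfunction(2) i0(3) by auto
    then have "exp (t * ev i) \<le> exp (t * (k0 - c))" using t by (simp add: mult_left_mono)
    then show "\<bar>?T i\<bar> \<le> exp (t * (k0 - c)) * (\<bar>inner_on R \<nu> f (\<psi> i)\<bar> * \<bar>\<psi> i x\<bar>)"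
      by (simp add: abs_mult mult.assoc mult_right_mono)
  qed
  \<comment> \<open>The missing index is put back so that the two full-sum identities apply.\<close>
  also have "\<dots> \<le> (\<Sum>i<card R. exp (t * (k0 - c)) * (\<bar>inner_on R \<nu> f (\<psi> i)\<bar> * \<bar>\<psi> i x\<bar>))"
    by (intro sum_mono2) auto
  also have "\<dots> \<le> exp (t * (k0 - c)) * (L2_set (\<lambda>i. inner_on R \<nu> f (\<psi> i)) {..<card R} * L2_set (\<lambda>i. \<psi> i x) {..<card R})"
    unfolding sum_distrib_left[symmetric] by (intro mult_left_mono L2_set_mult_ineq) auto
  also have "\<dots> = exp (t * (k0 - c)) * sqrt (inner_on R \<nu> f f / \<nu> x)"
    using parseval[of f f]
    by (simp add: L2_set_def sum_basis_squares[OF x] power2_eq_square[of "inner_on R \<nu> f _"] real_sqrt_mult[symmetric])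
  finally show ?thesis .
qed

end

end

section \<open>Perron-Frobenius theory\<close>

locale irreducible_kernel = reversible_kernel +
  assumes nonneg: "x \<in> R \<Longrightarrow> y \<in> R \<Longrightarrow> 0 \<le> K x y"
    and nonempty: "R \<noteq> {}"
    and irreducible: "irreducible_on R K"
begin

lemma irreducible_propagate:
  assumes "x \<in> R" "Q x" and step: "\<And>x y. x \<in> R \<Longrightarrow> y \<in> R \<Longrightarrow> 0 < K x y \<Longrightarrow> Q x \<Longrightarrow> Q y"
    and "y \<in> R"
  shows "Q y"
proof -
  have "(x, y) \<in> {(u, v). u \<in> R \<and> v \<in> R \<and> 0 < K u v}\<^sup>*"
    using irreducible assms by (auto simp: irreducible_on_def)
  then show ?thesis
    by (induction rule: rtrancl_induct) (use assms in auto)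
qed

lemma kernel_pos_sym:
  assumes "x \<in> R" "y \<in> R" "0 < K x y"
  shows "0 < K y x"
proof -
  have "0 < \<nu> x * K x y" using assms pos by simp
  then have "0 < \<nu> y * K y x" using rev assms by simp
  then show ?thesis using pos[of y] assms by (simp add: zero_less_mult_iff)
qed

text \<open>Strong minimum principle: at a zero of f the nonnegative terms K u v f v add up to k f u
  = 0, so f vanishes at every neighbor.\<close>

lemma nonneg_eigenfunction_zero:
  assumes f: "\<And>x. x \<in> R \<Longrightarrow> 0 \<le> f x" "\<And>x. x \<in> R \<Longrightarrow> kernel_op R K f x = k * f x"
    and x: "x \<in> R" "f x = 0" and y: "y \<in> R"
  shows "f y = 0"
proof (rule irreducible_propagate[of x "\<lambda>y. f y = 0", OF x _ y])
  fix u v assume uv: "u \<in> R" "v \<in> R" "0 < K u v" "f u = 0"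
  then have "(\<Sum>y\<in>R. K u y * f y) = 0" using f(2)[of u] by (simp add: kernel_op_def)
  then have "K u v * f v = 0"
    using uv f(1) nonneg by (subst (asm) sum_nonneg_eq_0_iff) auto
  then show "f v = 0" using uv by simp
qed

text \<open>Passing from a top eigenfunction to its absolute value f can only raise the quadratic
  form of a nonnegative kernel, so f is a maximizer too. The deficit of f from the maximum is a sum
  of nonnegative terms over the eigenbasis; as each vanishes, f has only top components and is an
  eigenfunction. The minimum principle makes it strictly positive.\<close>

lemma perron_frobenius:
  "\<exists>h k. (\<forall>x\<in>R. 0 < h x) \<and> (\<Sum>x\<in>R. \<nu> x * h x) = 1 \<and> (\<forall>x\<in>R. kernel_op R K h x = k * h x)"
proof -
  obtain \<psi> ev where "eigenbasis R \<nu> K \<psi> ev" using ex_eigenbasis by blast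
  then interpret eigenbasis R \<nu> K \<psi> ev .
  define n where "n = card R"
  have n: "0 < n" using nonempty by (simp add: n_def card_gt_0_iff)
  define k where "k = Max (ev ` {..<n})"
  have "k \<in> ev ` {..<n}" unfolding k_def using n by (intro Max_in) auto
  then obtain i0 where i0: "i0 < n" "ev i0 = k" by auto
  have le: "i < n \<Longrightarrow> ev i \<le> k" for i unfolding k_def by (intro Max_ge) auto
  define f where "f x = \<bar>\<psi> i0 x\<bar>" for x
  have ff: "inner_on R \<nu> f f = 1"
    using orthonormal[of i0 i0] i0 by (simp add: f_def inner_on_def n_def mult.assoc)
  have "k = inner_on R \<nu> (\<psi> i0) (\<lambda>x. ev i0 * \<psi> i0 x)"
    using i0 by (simp add: inner_on_scale_right orthonormal n_def)
  also have "\<dots> = inner_on R \<nu> (\<psi> i0) (kernel_op R K (\<psi> i0))"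
    using i0 by (intro inner_on_cong) (auto simp: eigen n_def)
  also have "\<dots> = (\<Sum>x\<in>R. \<Sum>y\<in>R. \<nu> x * K x y * (\<psi> i0 x * \<psi> i0 y))"
    by (simp add: inner_on_def kernel_op_def sum_distrib_left mult_ac)
  also have "\<dots> \<le> (\<Sum>x\<in>R. \<Sum>y\<in>R. \<nu> x * K x y * (f x * f y))"
    by (intro sum_mono mult_left_mono) (auto simp: f_def abs_mult[symmetric] nonneg less_imp_le[OF pos])
  also have "\<dots> = inner_on R \<nu> f (kernel_op R K f)"
    by (simp add: inner_on_def kernel_op_def sum_distrib_left mult_ac)
  finally have "(\<Sum>i<n. (k - ev i) * (inner_on R \<nu> f (\<psi> i))\<^sup>2) \<le> 0"
    using ff parseval[of f f]
    by (simp add: quadratic_form n_def power2_eq_square left_diff_distrib sum_subtractf sum_distrib_left[symmetric])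
  then have "(\<Sum>i<n. (k - ev i) * (inner_on R \<nu> f (\<psi> i))\<^sup>2) = 0"
    by (intro antisym sum_nonneg) (auto simp: le)
  then have z: "(k - ev i) * (inner_on R \<nu> f (\<psi> i))\<^sup>2 = 0" if "i < n" for i
    using that by (subst (asm) sum_nonneg_eq_0_iff) (auto simp: le)
  have eig: "kernel_op R K f x = k * f x" if "x \<in> R" for x
  proof -
    have "kernel_op R K f x = (\<Sum>i<n. ev i * inner_on R \<nu> f (\<psi> i) * \<psi> i x)"
      using power_expand[OF that, of 1 f] by (simp add: n_def)
    also have "\<dots> = (\<Sum>i<n. k * (inner_on R \<nu> f (\<psi> i) * \<psi> i x))"
      using z by (intro sum.cong refl) auto
    also have "\<dots> = k * f x" using expand[OF that, of f] by (simp add: n_def sum_distrib_left)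
    finally show ?thesis .
  qed
  have fpos: "0 < f x" if "x \<in> R" for x
  proof (rule ccontr)
    assume "\<not> 0 < f x"
    then have "f x = 0" by (simp add: f_def)
    then have "\<forall>y\<in>R. f y = 0"
      using nonneg_eigenfunction_zero[of f k x] eig that by (auto simp: f_def)
    then show False using ff inner_on_self_eq_0[of f] by simp
  qed
  define s where "s = (\<Sum>x\<in>R. \<nu> x * f x)"
  have s: "0 < s" unfolding s_def using nonempty pos fpos by (intro sum_pos) auto
  show ?thesis
  proof (intro exI[of _ "\<lambda>x. (1/s) * f x"] exI[of _ k] conjI ballI)
    show "(\<Sum>x\<in>R. \<nu> x * (1 / s * f x)) = 1"
      using s by (simp add: sum_divide_distrib[symmetric] s_def[symmetric])
    show "kernel_op R K (\<lambda>x. 1 / s * f x) x = k * (1 / s * f x)" if "x \<in> R" for x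
      unfolding kernel_op_scale using eig[OF that] by simp
    show "0 < 1 / s * f x" if "x \<in> R" for x using s fpos[OF that] by simp
  qed
qed

end

text \<open>That k0 is the largest eigenvalue is not assumed: it follows from the positivity of h by
  pairing with the left eigenvector \<nu> h. The normalization \<open>h_mean\<close> makes \<nu> h a
  probability.\<close>

locale perron_kernel = irreducible_kernel R \<nu> K
  for R :: "'a::finite set" and \<nu> :: "'a \<Rightarrow> real" and K :: "'a \<Rightarrow> 'a \<Rightarrow> real" +
  fixes h :: "'a \<Rightarrow> real" and k0 :: real
  assumes h_pos: "x \<in> R \<Longrightarrow> 0 < h x"
    and h_mean: "(\<Sum>x\<in>R. \<nu> x * h x) = 1"
    and h_eigen: "x \<in> R \<Longrightarrow> kernel_op R K h x = k0 * h x"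
begin

lemma left_eigen: "y \<in> R \<Longrightarrow> (\<Sum>x\<in>R. \<nu> x * h x * K x y) = k0 * (\<nu> y * h y)"
proof -
  assume y: "y \<in> R"
  have "(\<Sum>x\<in>R. \<nu> x * h x * K x y) = (\<Sum>x\<in>R. (\<nu> x * K x y) * h x)" by (simp add: mult_ac)
  also have "\<dots> = (\<Sum>x\<in>R. (\<nu> y * K y x) * h x)" using rev y by simp
  also have "\<dots> = \<nu> y * kernel_op R K h y" by (simp add: kernel_op_def sum_distrib_left mult_ac)
  finally show ?thesis using h_eigen[OF y] by simp
qed

lemma k0_nonneg: "0 \<le> k0"
proof -
  obtain x where x: "x \<in> R" using nonempty by auto
  have "0 \<le> kernel_op R K h x" unfolding kernel_op_def
    using x nonneg h_pos by (intro sum_nonneg mult_nonneg_nonneg) (auto intro: less_imp_le)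
  then show ?thesis using h_eigen[OF x] h_pos[OF x] by (simp add: zero_le_mult_iff)
qed

lemma eigenvalue_kernel_mat: "eigenvalue (kernel_mat R K) k0"
proof -
  define n where "n = card R"
  define r where "r = from_nat_into R"
  have r: "i < n \<Longrightarrow> r i \<in> R" for i
    using bij_betw_from_nat_into_finite[of R] by (auto simp: n_def r_def bij_betw_def)
  have n: "0 < n" using nonempty by (simp add: n_def card_gt_0_iff)
  define v where "v = Matrix.vec n (\<lambda>i. h (r i))"
  have "vec_index v 0 \<noteq> 0" using n h_pos[OF r[OF n]] by (simp add: v_def)
  then have "v \<noteq> 0\<^sub>v n" using n by auto
  moreover have "kernel_mat R K *\<^sub>v v = k0 \<cdot>\<^sub>v v"
  proof (rule eq_vecI)
    fix i assume "i < dim_vec (k0 \<cdot>\<^sub>v v)"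
    then have i: "i < n" by (simp add: v_def)
    have "vec_index (kernel_mat R K *\<^sub>v v) i = (\<Sum>j<n. (\<lambda>y. K (r i) y * h y) (r j))"
      using i by (simp add: kernel_mat_def v_def scalar_prod_def atLeast0LessThan n_def r_def)
    also have "\<dots> = kernel_op R K h (r i)"
      unfolding n_def r_def kernel_op_def by (rule sum_from_nat_into)
    also have "\<dots> = vec_index (k0 \<cdot>\<^sub>v v) i" using i h_eigen[OF r[OF i]] by (simp add: v_def)
    finally show "vec_index (kernel_mat R K *\<^sub>v v) i = vec_index (k0 \<cdot>\<^sub>v v) i" .
  qed (simp add: v_def kernel_mat_def n_def)
  ultimately show ?thesis
    unfolding eigenvalue_def eigenvector_def
    by (intro exI[of _ v]) (simp add: kernel_mat_def n_def v_def carrier_dim_vec)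
qed

text \<open>The moduli |v| of an eigenvector satisfy |z| |v| \<le> K |v| entrywise; pairing with the
  positive left eigenvector \<nu> h turns the right side into k0 times the same pairing. Besides K
  itself, this covers p \<le> K, hence the comparison of the two escape rates.\<close>

lemma dominated_eigenvalue_le:
  assumes dom: "\<And>x y. x \<in> R \<Longrightarrow> y \<in> R \<Longrightarrow> 0 \<le> K' x y \<and> K' x y \<le> K x y"
    and z: "eigenvalue (map_mat complex_of_real (kernel_mat R K')) z"
  shows "norm z \<le> k0"
proof -
  define n where "n = card R"
  define r where "r = from_nat_into R"
  have r: "i < n \<Longrightarrow> r i \<in> R" for i
    using bij_betw_from_nat_into_finite[of R] by (auto simp: n_def r_def bij_betw_def)
  have rsum: "(\<Sum>i<n. f (r i)) = (\<Sum>x\<in>R. f x)" for f :: "'a \<Rightarrow> real"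
    unfolding n_def r_def by (rule sum_from_nat_into)
  define m where "m x = \<nu> x * h x" for x
  have m: "x \<in> R \<Longrightarrow> 0 < m x" for x using pos h_pos by (simp add: m_def)
  have "dim_row (map_mat complex_of_real (kernel_mat R K')) = n" by (simp add: kernel_mat_def n_def)
  then obtain v where v: "dim_vec v = n" "v \<noteq> 0\<^sub>v n" "map_mat complex_of_real (kernel_mat R K') *\<^sub>v v = z \<cdot>\<^sub>v v"
    using z unfolding eigenvalue_def eigenvector_def carrier_vec_def by auto
  have row: "norm z * norm (vec_index v i) \<le> (\<Sum>j<n. K (r i) (r j) * norm (vec_index v j))" if i: "i < n" for i
  proof -
    have "z * vec_index v i = (\<Sum>j<n. complex_of_real (K' (r i) (r j)) * vec_index v j)"
      using arg_cong[OF v(3), of "\<lambda>w. vec_index w i"] i v(1)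
      by (simp add: kernel_mat_def scalar_prod_def atLeast0LessThan n_def r_def)
    then have "norm z * norm (vec_index v i) = norm (\<Sum>j<n. complex_of_real (K' (r i) (r j)) * vec_index v j)"
      by (metis norm_mult)
    also have "\<dots> \<le> (\<Sum>j<n. K' (r i) (r j) * norm (vec_index v j))"
      by (rule order_trans[OF norm_sum]) (auto intro!: sum_mono simp: norm_mult dom[OF r[OF i] r])
    also have "\<dots> \<le> (\<Sum>j<n. K (r i) (r j) * norm (vec_index v j))"
      using dom r i by (intro sum_mono mult_right_mono) auto
    finally show ?thesis .
  qed
  define S where "S = (\<Sum>i<n. m (r i) * norm (vec_index v i))"
  have "norm z * S = (\<Sum>i<n. m (r i) * (norm z * norm (vec_index v i)))"
    by (simp add: S_def sum_distrib_left mult_ac)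
  also have "\<dots> \<le> (\<Sum>i<n. m (r i) * (\<Sum>j<n. K (r i) (r j) * norm (vec_index v j)))"
    using m r row by (intro sum_mono mult_left_mono) (auto intro: less_imp_le)
  also have "\<dots> = (\<Sum>i<n. \<Sum>j<n. m (r i) * K (r i) (r j) * norm (vec_index v j))"
    by (simp add: sum_distrib_left mult_ac)
  also have "\<dots> = (\<Sum>j<n. \<Sum>i<n. m (r i) * K (r i) (r j) * norm (vec_index v j))" by (rule sum.swap)
  also have "\<dots> = (\<Sum>j<n. (\<Sum>x\<in>R. m x * K x (r j)) * norm (vec_index v j))"
    unfolding sum_distrib_right[symmetric] by (intro sum.cong refl arg_cong2[where f="(*)"] rsum)
  also have "\<dots> = (\<Sum>j<n. k0 * m (r j) * norm (vec_index v j))"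
    using left_eigen r by (intro sum.cong refl) (simp add: m_def)
  also have "\<dots> = k0 * S" by (simp add: S_def sum_distrib_left mult_ac)
  finally have "norm z * S \<le> k0 * S" .
  moreover have "0 < S"
  proof -
    obtain i where i: "i < n" "vec_index v i \<noteq> 0" using v(1,2) by (metis eq_vecI index_zero_vec)
    show ?thesis unfolding S_def
      using i r m by (intro sum_pos2[of _ i]) (simp_all add: less_imp_le)
  qed
  ultimately show ?thesis by simp
qed

lemma card_pos: "0 < card R"
  using nonempty by (simp add: card_gt_0_iff)

lemma escape_rate_dominated:
  assumes dom: "\<And>x y. x \<in> R \<Longrightarrow> y \<in> R \<Longrightarrow> 0 \<le> K' x y \<and> K' x y \<le> K x y"
  shows "1 - k0 \<le> escape_rate R K'"
proof -
  let ?A = "map_mat complex_of_real (kernel_mat R K')"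
  have "spectral_radius ?A \<in> norm ` spectrum ?A"
    by (rule spectral_radius_mem_max(1)[of _ "card R"]) (simp_all add: kernel_mat_carrier card_pos)
  then show ?thesis
    using dominated_eigenvalue_le[OF dom] by (auto simp: escape_rate_def spectrum_def)
qed

lemma escape_rate_eq: "escape_rate R K = 1 - k0"
proof (rule antisym)
  let ?A = "map_mat complex_of_real (kernel_mat R K)"
  have "eigenvalue ?A (complex_of_real k0)"
    using of_real_hom.eigenvalue_hom[OF kernel_mat_carrier eigenvalue_kernel_mat] by simp
  then have "norm (complex_of_real k0) \<le> spectral_radius ?A"
    by (intro spectral_radius_mem_max(2)[of _ "card R"])
      (simp_all add: kernel_mat_carrier card_pos spectrum_def del: norm_of_real)
  then show "escape_rate R K \<le> 1 - k0" by (simp add: escape_rate_def)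
  show "1 - k0 \<le> escape_rate R K" by (rule escape_rate_dominated) (use nonneg in auto)
qed

text \<open>Uniqueness: pairing a candidate m with h shows that its eigenvalue is k0. Subtracting
  from m / \<nu> the largest multiple s h that leaves it nonnegative gives a nonnegative
  eigenfunction with a zero, hence zero by the minimum principle; the masses give s = 1.\<close>

lemma quasi_stationary_eq: "quasi_stationary R K = (\<lambda>x. if x \<in> R then \<nu> x * h x else 0)"
  unfolding quasi_stationary_def
proof (rule the_equality, intro conjI)
  show "probability_vector R (\<lambda>x. if x \<in> R then \<nu> x * h x else 0)"
    using pos h_pos h_mean by (auto simp: probability_vector_def less_imp_le)
  show "\<exists>k. \<forall>y\<in>R. (\<Sum>x\<in>R. (if x \<in> R then \<nu> x * h x else 0) * K x y) = k * (if y \<in> R then \<nu> y * h y else 0)"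
    by (intro exI[of _ k0]) (simp add: left_eigen)
next
  fix m assume "probability_vector R m \<and> (\<exists>k. \<forall>y\<in>R. (\<Sum>x\<in>R. m x * K x y) = k * m y)"
  then obtain k where m: "\<And>x. 0 \<le> m x" "\<And>x. x \<notin> R \<Longrightarrow> m x = 0" "(\<Sum>x\<in>R. m x) = 1"
    and k: "\<And>y. y \<in> R \<Longrightarrow> (\<Sum>x\<in>R. m x * K x y) = k * m y"
    by (auto simp: probability_vector_def)
  obtain x1 where x1: "x1 \<in> R" "m x1 \<noteq> 0" using m(3) by (metis sum.neutral zero_neq_one)
  then have mh: "0 < (\<Sum>x\<in>R. m x * h x)"
    using m(1) h_pos by (intro sum_pos2[of _ x1]) (auto simp: less_le)
  have "k * (\<Sum>y\<in>R. m y * h y) = (\<Sum>y\<in>R. (\<Sum>x\<in>R. m x * K x y) * h y)"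
    by (simp add: k sum_distrib_left mult.assoc)
  also have "\<dots> = (\<Sum>y\<in>R. \<Sum>x\<in>R. m x * K x y * h y)" by (simp add: sum_distrib_right)
  also have "\<dots> = (\<Sum>x\<in>R. \<Sum>y\<in>R. m x * K x y * h y)" by (rule sum.swap)
  also have "\<dots> = (\<Sum>x\<in>R. m x * kernel_op R K h x)"
    by (simp add: kernel_op_def sum_distrib_left mult.assoc)
  also have "\<dots> = k0 * (\<Sum>x\<in>R. m x * h x)"
    by (simp add: h_eigen sum_distrib_left mult_ac)
  finally have k0: "k = k0" using mh by simp
  define q where "q x = m x / (\<nu> x * h x)" for x
  define s where "s = Min (q ` R)"
  have "s \<in> q ` R" unfolding s_def using nonempty by (intro Min_in) auto
  then obtain x0 where x0: "x0 \<in> R" "q x0 = s" by auto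
  have sle: "x \<in> R \<Longrightarrow> s \<le> q x" for x unfolding s_def by (intro Min_le) auto
  \<comment> \<open>On R the quotient \<open>h x / h x\<close> is 1, so h f is m / \<nu> minus s h
    and vanishes at the minimizer \<open>x0\<close> of q.\<close>
  define f where "f x = q x - s * h x / h x" for x
  have fx: "x \<in> R \<Longrightarrow> h x * f x = m x / \<nu> x - s * h x" for x
    using h_pos[of x] by (simp add: f_def q_def field_simps)
  have "h y * f y = 0" if y: "y \<in> R" for y
  proof (rule nonneg_eigenfunction_zero[of "\<lambda>x. h x * f x" k0 x0 y])
    fix x assume x: "x \<in> R"
    show "0 \<le> h x * f x" using sle[OF x] h_pos[OF x] by (simp add: f_def)
    have "kernel_op R K (\<lambda>x. m x / \<nu> x) x = (\<Sum>y\<in>R. m y * (\<nu> x * K x y) / \<nu> y) / \<nu> x"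
      using pos[OF x] by (simp add: kernel_op_def sum_divide_distrib mult_ac)
    also have "\<dots> = (\<Sum>y\<in>R. m y * K y x) / \<nu> x"
      using pos rev[OF x] by (intro arg_cong2[where f="(/)"] sum.cong refl) (auto simp: less_imp_neq[symmetric])
    also have "\<dots> = k0 * (m x / \<nu> x)" using k[OF x] k0 by simp
    finally have "kernel_op R K (\<lambda>x. m x / \<nu> x - s * h x) x = k0 * (m x / \<nu> x - s * h x)"
      unfolding kernel_op_diff kernel_op_scale using h_eigen[OF x] by (simp add: algebra_simps)
    moreover have "kernel_op R K (\<lambda>x. h x * f x) x = kernel_op R K (\<lambda>x. m x / \<nu> x - s * h x) x"
      by (intro kernel_op_cong) (simp add: fx)
    ultimately show "kernel_op R K (\<lambda>x. h x * f x) x = k0 * (h x * f x)" using fx[OF x] by simp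
  next
    show "h x0 * f x0 = 0" using x0(2) h_pos[OF x0(1)] by (simp add: f_def)
  qed (rule x0(1), rule y)
  then have meq: "m y = s * (\<nu> y * h y)" if "y \<in> R" for y
  proof -
    have "m y / \<nu> y - s * h y = 0" using fx[OF that] \<open>\<And>y. y \<in> R \<Longrightarrow> h y * f y = 0\<close>[OF that] by simp
    then show ?thesis using pos[OF that] by (simp add: field_simps)
  qed
  have "1 = s * (\<Sum>x\<in>R. \<nu> x * h x)" using m(3) by (simp add: meq sum_distrib_left)
  then have "s = 1" using h_mean by simp
  then show "m = (\<lambda>x. if x \<in> R then \<nu> x * h x else 0)" using meq m(2) by auto
qed

end

section \<open>Spectral gaps and soft measures\<close>

text \<open>The kernels differ only on the diagonal, where the increments of f vanish. The same
  holds for the restricted kernel, so gaps can be compared through K and p directly.\<close>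

lemma dirichlet_on_completed_kernel: "dirichlet_on R \<nu> (completed_kernel K R) f = dirichlet_on R \<nu> K f"
  unfolding dirichlet_on_def
  by (intro arg_cong[where f="(*) _"] sum.cong refl) (simp add: completed_kernel_def)

lemma dirichlet_on_restricted_kernel: "dirichlet_on R \<nu> (restricted_kernel p R) f = dirichlet_on R \<nu> p f"
  unfolding dirichlet_on_def
  by (intro arg_cong[where f="(*) _"] sum.cong refl) (simp add: restricted_kernel_def)

context reversible_kernel
begin

text \<open>Expansion of the square: reversibility makes both square terms equal, and row sums are 1
  minus the escape probability. The last sum is the killing term; for K only its sign is used below,
  and for the completed kernel it vanishes.\<close>

lemma dirichlet_on_eq:
  "dirichlet_on R \<nu> K f = inner_on R \<nu> f f - inner_on R \<nu> f (kernel_op R K f)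
     - (\<Sum>x\<in>R. \<nu> x * escape_prob K R x * (f x)\<^sup>2)"
proof -
  define S where "S = (\<Sum>x\<in>R. \<Sum>y\<in>R. \<nu> x * K x y * (f x)\<^sup>2)"
  have "(\<Sum>x\<in>R. \<Sum>y\<in>R. \<nu> x * K x y * (f y)\<^sup>2) = (\<Sum>y\<in>R. \<Sum>x\<in>R. \<nu> x * K x y * (f y)\<^sup>2)"
    by (rule sum.swap)
  also have "\<dots> = S" unfolding S_def by (intro sum.cong refl) (simp add: rev)
  finally have S2: "(\<Sum>x\<in>R. \<Sum>y\<in>R. \<nu> x * K x y * (f y)\<^sup>2) = S" .
  have "(\<Sum>x\<in>R. \<Sum>y\<in>R. \<nu> x * K x y * (f x - f y)\<^sup>2)
      = (\<Sum>x\<in>R. \<Sum>y\<in>R. \<nu> x * K x y * (f x)\<^sup>2 + \<nu> x * K x y * (f y)\<^sup>2 - 2 * (\<nu> x * f x * (K x y * f y)))"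
    by (intro sum.cong refl) (simp add: power2_diff algebra_simps)
  also have "\<dots> = S + S - 2 * inner_on R \<nu> f (kernel_op R K f)"
    by (simp add: sum.distrib sum_subtractf S2 S_def inner_on_def kernel_op_def sum_distrib_left)
  finally have "dirichlet_on R \<nu> K f = S - inner_on R \<nu> f (kernel_op R K f)"
    by (simp add: dirichlet_on_def)
  moreover have "S = (\<Sum>x\<in>R. \<nu> x * (f x)\<^sup>2 * (\<Sum>y\<in>R. K x y))"
    by (simp add: S_def sum_distrib_left sum_distrib_right mult_ac)
  moreover have "(\<Sum>x\<in>R. \<nu> x * (f x)\<^sup>2 * (\<Sum>y\<in>R. K x y)) = inner_on R \<nu> f f - (\<Sum>x\<in>R. \<nu> x * escape_prob K R x * (f x)\<^sup>2)"
    unfolding inner_on_def sum_subtractf[symmetric]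
    by (intro sum.cong refl) (simp add: escape_prob_def power2_eq_square algebra_simps)
  ultimately show ?thesis by simp
qed

lemma inner_on_Cauchy_Schwarz: "(inner_on R \<nu> f g)\<^sup>2 \<le> inner_on R \<nu> f f * inner_on R \<nu> g g"
proof -
  have "inner_on R \<nu> u v = (\<Sum>x\<in>R. (sqrt (\<nu> x) * u x) * (sqrt (\<nu> x) * v x))" for u v
    unfolding inner_on_def by (intro sum.cong refl) (use pos in \<open>simp add: less_imp_le mult_ac\<close>)
  then show ?thesis
    using Cauchy_Schwarz_ineq_sum[of "\<lambda>x. sqrt (\<nu> x) * f x" "\<lambda>x. sqrt (\<nu> x) * g x" R]
    by (simp add: power2_eq_square)
qed

lemma var_on_eq:
  assumes "(\<Sum>x\<in>R. \<nu> x) = 1"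
  shows "var_on R \<nu> f = inner_on R \<nu> f f - (inner_on R \<nu> f (\<lambda>_. 1))\<^sup>2"
proof -
  define m where "m = inner_on R \<nu> f (\<lambda>_. 1)"
  have m: "mean_on R \<nu> f = m" by (simp add: m_def mean_on_def inner_on_def)
  have "var_on R \<nu> f = (\<Sum>x\<in>R. \<nu> x * f x * f x - 2 * m * (\<nu> x * f x * 1) + m\<^sup>2 * \<nu> x)"
    unfolding var_on_def m by (intro sum.cong refl) (simp add: power2_eq_square algebra_simps)
  also have "\<dots> = inner_on R \<nu> f f - 2 * m * m + m\<^sup>2"
    unfolding sum.distrib sum_subtractf sum_distrib_left[symmetric]
    by (simp add: inner_on_def m_def assms)
  finally show ?thesis by (simp add: m_def power2_eq_square)
qed

lemma var_on_nonneg: "0 \<le> var_on R \<nu> f"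
  unfolding var_on_def by (intro sum_nonneg mult_nonneg_nonneg) (auto simp: less_imp_le[OF pos])

lemma var_on_le_centered:
  assumes "(\<Sum>x\<in>R. \<nu> x) = 1"
  shows "var_on R \<nu> f \<le> (\<Sum>x\<in>R. \<nu> x * (f x - a)\<^sup>2)"
proof -
  define m where "m = inner_on R \<nu> f (\<lambda>_. 1)"
  have "(\<Sum>x\<in>R. \<nu> x * (f x - a)\<^sup>2) = (\<Sum>x\<in>R. \<nu> x * f x * f x - 2 * a * (\<nu> x * f x * 1) + a\<^sup>2 * \<nu> x)"
    by (intro sum.cong refl) (simp add: power2_eq_square algebra_simps)
  also have "\<dots> = inner_on R \<nu> f f - 2 * a * m + a\<^sup>2"
    unfolding sum.distrib sum_subtractf sum_distrib_left[symmetric]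
    by (simp add: inner_on_def m_def assms)
  also have "\<dots> = var_on R \<nu> f + (m - a)\<^sup>2"
    by (simp add: var_on_eq[OF assms] m_def power2_eq_square algebra_simps)
  finally show ?thesis by simp
qed

end

context irreducible_kernel
begin

lemma dirichlet_on_nonneg: "0 \<le> dirichlet_on R \<nu> K f"
  unfolding dirichlet_on_def
  by (intro mult_nonneg_nonneg sum_nonneg) (auto simp: less_imp_le[OF pos] nonneg)

lemma edge_le_dirichlet_on:
  assumes "x \<in> R" "y \<in> R"
  shows "\<nu> x * K x y * (f x - f y)\<^sup>2 \<le> 2 * dirichlet_on R \<nu> K f"
proof -
  have nn: "\<And>u v. u \<in> R \<Longrightarrow> v \<in> R \<Longrightarrow> 0 \<le> \<nu> u * K u v * (f u - f v)\<^sup>2"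
    using nonneg pos by (intro mult_nonneg_nonneg) (auto intro: less_imp_le)
  have "\<nu> x * K x y * (f x - f y)\<^sup>2 \<le> (\<Sum>y\<in>R. \<nu> x * K x y * (f x - f y)\<^sup>2)"
    by (rule member_le_sum[of y R "\<lambda>y. \<nu> x * K x y * (f x - f y)\<^sup>2"]) (use assms nn in auto)
  also have "\<dots> \<le> (\<Sum>x\<in>R. \<Sum>y\<in>R. \<nu> x * K x y * (f x - f y)\<^sup>2)"
    by (rule member_le_sum[of x R "\<lambda>x. \<Sum>y\<in>R. \<nu> x * K x y * (f x - f y)\<^sup>2"])
      (use assms nn in \<open>auto intro: sum_nonneg\<close>)
  finally show ?thesis by (simp add: dirichlet_on_def)
qed

text \<open>A crude constant suffices, since the purpose is only the positivity of the gap.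
  Irreducibility carries control of f y - f a by the Dirichlet form from a fixed point a to all of
  R; the average over y dominates the variance.\<close>

lemma poincare:
  assumes mass: "(\<Sum>x\<in>R. \<nu> x) = 1"
  shows "\<exists>C>0. \<forall>f. var_on R \<nu> f \<le> C * dirichlet_on R \<nu> K f"
proof -
  obtain a where a: "a \<in> R" using nonempty by auto
  have "\<exists>C\<ge>0. \<forall>f. (f y - f a)\<^sup>2 \<le> C * dirichlet_on R \<nu> K f" if "y \<in> R" for y
  proof (rule irreducible_propagate[of a "\<lambda>y. \<exists>C\<ge>0. \<forall>f. (f y - f a)\<^sup>2 \<le> C * dirichlet_on R \<nu> K f", OF a _ _ that])
    show "\<exists>C\<ge>0. \<forall>f. (f a - f a)\<^sup>2 \<le> C * dirichlet_on R \<nu> K f" by (intro exI[of _ 0]) auto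
  next
    fix u v assume u: "u \<in> R" and v: "v \<in> R" and K: "0 < K u v"
      and "\<exists>C\<ge>0. \<forall>f. (f u - f a)\<^sup>2 \<le> C * dirichlet_on R \<nu> K f"
    then obtain C where C: "0 \<le> C" "\<And>f. (f u - f a)\<^sup>2 \<le> C * dirichlet_on R \<nu> K f" by blast
    define w where "w = \<nu> u * K u v"
    have w: "0 < w" using pos[OF u] K by (simp add: w_def)
    show "\<exists>C\<ge>0. \<forall>f. (f v - f a)\<^sup>2 \<le> C * dirichlet_on R \<nu> K f"
    \<comment> \<open>The square of a sum is at most twice the sum of the squares; the new edge of
      weight w costs 2 / w, because the Dirichlet form has the factor 1/2.\<close>
    proof (intro exI[of _ "2 * C + 4 / w"] conjI allI)
      fix f
      have "(f u - f v)\<^sup>2 \<le> 2 / w * dirichlet_on R \<nu> K f"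
        using edge_le_dirichlet_on[OF u v, of f] w by (simp add: w_def field_simps)
      moreover have "(f v - f a)\<^sup>2 \<le> 2 * (f u - f a)\<^sup>2 + 2 * (f u - f v)\<^sup>2"
        using zero_le_power2[of "f u - f a + (f u - f v)"] by (simp add: power2_eq_square algebra_simps)
      moreover note C(2)[of f]
      ultimately have "(f v - f a)\<^sup>2 \<le> 2 * (C * dirichlet_on R \<nu> K f) + 2 * (2 / w * dirichlet_on R \<nu> K f)"
        by linarith
      then show "(f v - f a)\<^sup>2 \<le> (2 * C + 4 / w) * dirichlet_on R \<nu> K f" by (simp add: algebra_simps)
    qed (use C w in simp)
  qed
  then obtain C where C: "\<And>y. y \<in> R \<Longrightarrow> 0 \<le> C y"
    "\<And>y f. y \<in> R \<Longrightarrow> (f y - f a)\<^sup>2 \<le> C y * dirichlet_on R \<nu> K f" by metis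
  show ?thesis
  \<comment> \<open>The added 1 makes the constant strictly positive.\<close>
  proof (intro exI[of _ "(\<Sum>y\<in>R. \<nu> y * C y) + 1"] conjI allI)
    have S: "0 \<le> (\<Sum>y\<in>R. \<nu> y * C y)"
      using C(1) pos by (intro sum_nonneg mult_nonneg_nonneg) (auto intro: less_imp_le)
    then show "0 < (\<Sum>y\<in>R. \<nu> y * C y) + 1" by simp
    fix f
    have "var_on R \<nu> f \<le> (\<Sum>y\<in>R. \<nu> y * (f y - f a)\<^sup>2)" by (rule var_on_le_centered[OF mass])
    also have "\<dots> \<le> (\<Sum>y\<in>R. \<nu> y * (C y * dirichlet_on R \<nu> K f))"
      using C(2) pos by (intro sum_mono mult_left_mono) (auto intro: less_imp_le)
    also have "\<dots> = (\<Sum>y\<in>R. \<nu> y * C y) * dirichlet_on R \<nu> K f"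
      by (simp add: sum_distrib_right mult.assoc)
    also have "\<dots> \<le> ((\<Sum>y\<in>R. \<nu> y * C y) + 1) * dirichlet_on R \<nu> K f"
      using dirichlet_on_nonneg by (intro mult_right_mono) auto
    finally show "var_on R \<nu> f \<le> ((\<Sum>y\<in>R. \<nu> y * C y) + 1) * dirichlet_on R \<nu> K f" .
  qed
qed

text \<open>The Poincare inequality bounds the infimum away from 0; with two points in R, the
  indicator of one has nonzero variance and makes the infimum finite. From here on the gap is a real
  number used through this inequality.\<close>

lemma spectral_gap_real:
  assumes mass: "(\<Sum>x\<in>R. \<nu> x) = 1" and card: "card R \<noteq> 1"
  shows "\<exists>g>0. spectral_gap R \<nu> K = ereal g \<and> (\<forall>f. g * var_on R \<nu> f \<le> dirichlet_on R \<nu> K f)"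
proof -
  obtain C where C: "0 < C" "\<And>f. var_on R \<nu> f \<le> C * dirichlet_on R \<nu> K f" using poincare[OF mass] by blast
  define G where "G = spectral_gap R \<nu> K"
  have low: "ereal (1 / C) \<le> G"
    unfolding G_def spectral_gap_def
  proof (rule INF_greatest)
    fix f assume "f \<in> {f. var_on R \<nu> f \<noteq> 0}"
    then have "0 < var_on R \<nu> f" using var_on_nonneg[of f] by simp
    then show "ereal (1 / C) \<le> ereal (dirichlet_on R \<nu> K f / var_on R \<nu> f)"
      using C(1) C(2)[of f] by (simp add: field_simps)
  qed
  have up: "G \<le> ereal (dirichlet_on R \<nu> K f / var_on R \<nu> f)" if "var_on R \<nu> f \<noteq> 0" for f
    unfolding G_def spectral_gap_def by (rule INF_lower) (use that in simp)
  obtain a where a: "a \<in> R" using nonempty by auto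
  have "R \<noteq> {a}" using card by auto
  then obtain b where b: "b \<in> R" "b \<noteq> a" using a by auto
  define f where "f x = (if x = a then 1 else 0 :: real)" for x
  have "inner_on R \<nu> f f = \<nu> a" "inner_on R \<nu> f (\<lambda>_. 1) = \<nu> a"
    using a by (simp_all add: inner_on_def f_def if_distrib[of "\<lambda>z. _ * z"] cong: if_cong)
  then have "var_on R \<nu> f = \<nu> a * (1 - \<nu> a)" by (simp add: var_on_eq[OF mass] power2_eq_square algebra_simps)
  moreover have "\<nu> a + \<nu> b \<le> (\<Sum>x\<in>R. \<nu> x)"
    using sum_mono2[of R "{a, b}" \<nu>] a b pos by (auto intro: less_imp_le)
  ultimately have "var_on R \<nu> f \<noteq> 0" using pos[OF a] pos[OF b(1)] mass by auto
  from up[OF this] low obtain g where g: "G = ereal g" by (cases G) auto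
  have "0 < g" using low g C(1) by (simp add: less_le_trans[of 0 "1 / C"])
  moreover have "g * var_on R \<nu> f \<le> dirichlet_on R \<nu> K f" for f
  proof (cases "var_on R \<nu> f = 0")
    case True then show ?thesis using dirichlet_on_nonneg by simp
  next
    case False
    then show ?thesis using up[OF False] g var_on_nonneg[of f] by (simp add: field_simps)
  qed
  ultimately show ?thesis using g by (auto simp: G_def)
qed

end

lemma spectral_gap_singleton:
  assumes "card R = 1" "(\<Sum>x\<in>R. \<nu> x) = 1"
  shows "spectral_gap R \<nu> K = \<infinity>"
proof -
  obtain a where "R = {a}" using assms(1) by (rule card_1_singletonE)
  then have "var_on R \<nu> f = 0" for f using assms(2) by (simp add: var_on_def mean_on_def)
  then show ?thesis by (simp add: spectral_gap_def top_ereal_def)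
qed

lemma (in reversible_kernel) spectral_gap_mono:
  assumes "\<And>f. dirichlet_on R \<nu> K1 f \<le> dirichlet_on R \<nu> K2 f"
  shows "spectral_gap R \<nu> K1 \<le> spectral_gap R \<nu> K2"
  unfolding spectral_gap_def
  by (intro INF_mono') (simp add: divide_right_mono[OF assms var_on_nonneg])

section \<open>Sub-Markovian kernels, their completion and their soft measure\<close>

locale killed_kernel = perron_kernel R \<nu> K h k0
  for R :: "'a::finite set" and \<nu> :: "'a \<Rightarrow> real" and K :: "'a \<Rightarrow> 'a \<Rightarrow> real"
    and h :: "'a \<Rightarrow> real" and k0 :: real +
  assumes sub: "x \<in> R \<Longrightarrow> (\<Sum>y\<in>R. K x y) \<le> 1"
    and mass: "(\<Sum>x\<in>R. \<nu> x) = 1"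
begin

lemma escape_prob_nonneg: "x \<in> R \<Longrightarrow> 0 \<le> escape_prob K R x"
  using sub[of x] by (simp add: escape_prob_def)

text \<open>One step of K multiplies the mass of the left eigenvector \<nu> h by k0, so 1 - k0 is
  the mean escape probability under the soft measure.\<close>

lemma mean_escape: "(\<Sum>x\<in>R. \<nu> x * h x * escape_prob K R x) = 1 - k0"
proof -
  have "(\<Sum>x\<in>R. \<nu> x * h x * (\<Sum>y\<in>R. K x y)) = (\<Sum>x\<in>R. \<Sum>y\<in>R. \<nu> x * h x * K x y)"
    by (simp add: sum_distrib_left)
  also have "\<dots> = (\<Sum>y\<in>R. \<Sum>x\<in>R. \<nu> x * h x * K x y)" by (rule sum.swap)
  also have "\<dots> = k0" by (simp add: left_eigen sum_distrib_left[symmetric] h_mean)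
  finally show ?thesis
    by (simp add: escape_prob_def right_diff_distrib sum_subtractf h_mean)
qed

lemma k0_le_1: "k0 \<le> 1"
proof -
  have "0 \<le> (\<Sum>x\<in>R. \<nu> x * h x * escape_prob K R x)"
    using pos h_pos escape_prob_nonneg by (intro sum_nonneg mult_nonneg_nonneg) (auto intro: less_imp_le)
  then show ?thesis by (simp add: mean_escape)
qed

lemma completed_irreducible: "irreducible_kernel R \<nu> (completed_kernel K R)"
proof unfold_locales
  show "x \<in> R \<Longrightarrow> 0 < \<nu> x" for x by (rule pos)
  show "x \<in> R \<Longrightarrow> y \<in> R \<Longrightarrow> \<nu> x * completed_kernel K R x y = \<nu> y * completed_kernel K R y x" for x y
    by (simp add: completed_kernel_def rev)
  show "x \<in> R \<Longrightarrow> y \<in> R \<Longrightarrow> 0 \<le> completed_kernel K R x y" for x y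
    using nonneg[of x y] escape_prob_nonneg[of x] by (auto simp: completed_kernel_def)
  show "R \<noteq> {}" by (rule nonempty)
  have "{(u, v). u \<in> R \<and> v \<in> R \<and> 0 < K u v} \<subseteq> {(u, v). u \<in> R \<and> v \<in> R \<and> 0 < completed_kernel K R u v}"
    using escape_prob_nonneg by (auto simp: completed_kernel_def add_pos_nonneg)
  from rtrancl_mono[OF this] show "irreducible_on R (completed_kernel K R)"
    using irreducible by (auto simp: irreducible_on_def)
qed

lemma kernel_op_completed:
  assumes "x \<in> R"
  shows "kernel_op R (completed_kernel K R) f x = kernel_op R K f x + escape_prob K R x * f x"
proof -
  have "kernel_op R (completed_kernel K R) f x = (\<Sum>y\<in>R. K x y * f y + (if x = y then escape_prob K R x * f y else 0))"
    unfolding kernel_op_def by (intro sum.cong refl) (auto simp: completed_kernel_def algebra_simps)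
  then show ?thesis using assms by (simp add: sum.distrib kernel_op_def)
qed

lemma norm2_on_deviation: "norm2_on R \<nu> (\<lambda>x. h x - 1) = inner_on R \<nu> h h - 1"
proof -
  have "norm2_on R \<nu> (\<lambda>x. h x - 1) = (\<Sum>x\<in>R. \<nu> x * h x * h x - 2 * (\<nu> x * h x) + \<nu> x)"
    unfolding norm2_on_def by (intro sum.cong refl) (simp add: power2_eq_square algebra_simps)
  also have "\<dots> = inner_on R \<nu> h h - 2 * 1 + 1"
    by (simp add: sum.distrib sum_subtractf sum_distrib_left[symmetric] h_mean mass inner_on_def)
  finally show ?thesis by simp
qed

lemma inner_on_h_1: "inner_on R \<nu> h (\<lambda>_. 1) = 1"
  by (simp add: inner_on_def h_mean)

lemma inner_on_1_1: "inner_on R \<nu> (\<lambda>_. 1) (\<lambda>_. 1) = 1"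
  by (simp add: inner_on_def mass)

lemma var_on_h: "var_on R \<nu> h = norm2_on R \<nu> (\<lambda>x. h x - 1)"
  by (simp add: norm2_on_deviation var_on_eq[OF mass] inner_on_h_1)

lemma inner_h_ge_1: "1 \<le> inner_on R \<nu> h h"
  using var_on_nonneg[of h] by (simp add: var_on_h norm2_on_deviation)

lemma inner_h_kernel_op_h: "inner_on R \<nu> h (kernel_op R K h) = k0 * inner_on R \<nu> h h"
proof -
  have "inner_on R \<nu> h (kernel_op R K h) = inner_on R \<nu> h (\<lambda>x. k0 * h x)"
    by (intro inner_on_cong) (auto simp: h_eigen)
  then show ?thesis by (simp add: inner_on_scale_right)
qed

lemma escape_form_nonneg: "0 \<le> (\<Sum>x\<in>R. \<nu> x * escape_prob K R x * (f x)\<^sup>2)"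
  using pos escape_prob_nonneg by (intro sum_nonneg mult_nonneg_nonneg) (auto intro: less_imp_le)

definition zeta_soft :: real where
  "zeta_soft = Min ((\<lambda>x. \<nu> x * (h x)\<^sup>2) ` R)"

lemma zeta_soft_le: "x \<in> R \<Longrightarrow> zeta_soft \<le> \<nu> x * (h x)\<^sup>2"
  unfolding zeta_soft_def by (intro Min_le) auto

lemma zeta_soft_pos: "0 < zeta_soft"
  unfolding zeta_soft_def
proof (subst Min_gr_iff; safe?)
  fix x assume x: "x \<in> R"
  show "0 < \<nu> x * (h x)\<^sup>2" using pos[OF x] h_pos[OF x] by simp
qed (use nonempty in auto)

text \<open>An upper bound on \<open>zeta_soft\<close> is what later makes the logarithm in the
  mixing time at least 1.\<close>

lemma zeta_soft_le_norm: "zeta_soft \<le> inner_on R \<nu> h h"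
proof -
  obtain x where x: "x \<in> R" using nonempty by auto
  have "zeta_soft \<le> \<nu> x * h x * h x" using zeta_soft_le[OF x] by (simp add: power2_eq_square mult.assoc)
  also have "\<dots> \<le> inner_on R \<nu> h h"
    unfolding inner_on_def
    by (rule member_le_sum[OF x]) (auto simp: mult.assoc less_imp_le[OF pos])
  finally show ?thesis .
qed

section \<open>Estimates from a Poincare inequality with constant g\<close>

context
  fixes g \<epsilon> :: real
  assumes g_pos: "0 < g"
    and gap: "\<And>f. g * var_on R \<nu> f \<le> dirichlet_on R \<nu> K f"
  defines "\<epsilon> \<equiv> (1 - k0) / g"
begin

lemma eps_nonneg: "0 \<le> \<epsilon>"
  using k0_le_1 g_pos by (simp add: \<epsilon>_def)

lemma eps_times_gap: "g * \<epsilon> = 1 - k0"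
  using g_pos by (simp add: \<epsilon>_def)

text \<open>With N the squared norm of h, the variance is N - 1 and the Dirichlet form is at most (1
  - k0) N = g \<epsilon> N; the Poincare inequality becomes N - 1 \<le> \<epsilon> N.\<close>

lemma norm_h_le:
  assumes "\<epsilon> < 1"
  shows "inner_on R \<nu> h h \<le> 1 / (1 - \<epsilon>)"
proof -
  define N where "N = inner_on R \<nu> h h"
  have "g * (N - 1) \<le> N - k0 * N"
    using gap[of h] escape_form_nonneg[of h]
    by (simp add: var_on_h norm2_on_deviation dirichlet_on_eq inner_h_kernel_op_h N_def)
  also have "\<dots> = g * (\<epsilon> * N)" by (simp add: mult.assoc[symmetric] eps_times_gap left_diff_distrib)
  finally have "N - 1 \<le> \<epsilon> * N" using g_pos by simp
  then show ?thesis using assms by (simp add: N_def field_simps)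
qed

lemma deviation_le:
  assumes "\<epsilon> < 1"
  shows "norm2_on R \<nu> (\<lambda>x. h x - 1) \<le> \<epsilon> / (1 - \<epsilon>)"
  using norm_h_le[OF assms] assms by (simp add: norm2_on_deviation field_simps)

text \<open>The mean of f is minus its product with h - 1, so Cauchy-Schwarz leaves in the variance
  at least the fraction 1 - \<epsilon>/(1 - \<epsilon>) of the squared norm. Measuring from k0
  instead of 1 costs another \<epsilon> in units of g. What remains is (1 - 3\<epsilon> +
  \<epsilon>^2)/(1 - \<epsilon>), and \<epsilon>^2 is given away.\<close>

lemma gap_orthogonal_to_h:
  assumes \<epsilon>: "\<epsilon> < 1/3" and f: "inner_on R \<nu> f h = 0"
  shows "inner_on R \<nu> f (kernel_op R K f) \<le> (k0 - g * ((1 - 3 * \<epsilon>) / (1 - \<epsilon>))) * inner_on R \<nu> f f"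
proof -
  define F where "F = inner_on R \<nu> f f"
  have F: "0 \<le> F" by (simp add: F_def inner_on_self_nonneg)
  have "inner_on R \<nu> (\<lambda>x. h x - 1) (\<lambda>x. h x - 1) = inner_on R \<nu> h h - 1"
    by (simp add: inner_on_diff_left inner_on_diff_right inner_on_h_1 inner_on_1_1
        inner_on_commute[of R \<nu> "\<lambda>_. 1" h])
  moreover have "inner_on R \<nu> f (\<lambda>x. h x - 1) = - inner_on R \<nu> f (\<lambda>_. 1)"
    by (simp add: inner_on_diff_right f)
  ultimately have "(inner_on R \<nu> f (\<lambda>_. 1))\<^sup>2 \<le> F * (inner_on R \<nu> h h - 1)"
    using inner_on_Cauchy_Schwarz[of f "\<lambda>x. h x - 1"] by (simp add: F_def)
  also have "\<dots> \<le> F * (\<epsilon> / (1 - \<epsilon>))"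
    using deviation_le \<epsilon> F by (intro mult_left_mono) (simp_all add: norm2_on_deviation)
  finally have "F - F * (\<epsilon> / (1 - \<epsilon>)) \<le> var_on R \<nu> f"
    by (simp add: var_on_eq[OF mass] F_def)
  then have "g * (F - F * (\<epsilon> / (1 - \<epsilon>))) \<le> g * var_on R \<nu> f" using g_pos by simp
  also have "\<dots> \<le> F - inner_on R \<nu> f (kernel_op R K f)"
    using gap[of f] escape_form_nonneg[of f] by (simp add: dirichlet_on_eq F_def)
  finally have "inner_on R \<nu> f (kernel_op R K f) \<le> F - g * (F - F * (\<epsilon> / (1 - \<epsilon>)))" by simp
  also have "\<dots> = (1 - g * (1 - \<epsilon> / (1 - \<epsilon>))) * F" by (simp add: algebra_simps)
  also have "\<dots> \<le> (k0 - g * ((1 - 3 * \<epsilon>) / (1 - \<epsilon>))) * F"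
  proof (rule mult_right_mono[OF _ F])
    have "\<epsilon> + (1 - 3 * \<epsilon>) / (1 - \<epsilon>) \<le> 1 - \<epsilon> / (1 - \<epsilon>)"
    proof -
      have "\<epsilon> + (1 - 3 * \<epsilon>) / (1 - \<epsilon>) = (\<epsilon> * (1 - \<epsilon>) + (1 - 3 * \<epsilon>)) / (1 - \<epsilon>)"
        using \<epsilon> by (simp add: add_divide_distrib)
      also have "\<dots> \<le> ((1 - \<epsilon>) - \<epsilon>) / (1 - \<epsilon>)"
        using \<epsilon> by (intro divide_right_mono) (auto simp: algebra_simps)
      also have "\<dots> = 1 - \<epsilon> / (1 - \<epsilon>)" using \<epsilon> by (subst diff_divide_distrib) simp
      finally show ?thesis .
    qed
    then have "g * \<epsilon> + g * ((1 - 3 * \<epsilon>) / (1 - \<epsilon>)) \<le> g * (1 - \<epsilon> / (1 - \<epsilon>))"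
      unfolding distrib_left[symmetric] using g_pos by (intro mult_left_mono) auto
    then show "1 - g * (1 - \<epsilon> / (1 - \<epsilon>)) \<le> k0 - g * ((1 - 3 * \<epsilon>) / (1 - \<epsilon>))"
      using eps_times_gap by linarith
  qed
  finally show ?thesis by (simp add: F_def)
qed

lemma gap_const_pos: "\<epsilon> < 1/3 \<Longrightarrow> 0 < g * ((1 - 3 * \<epsilon>) / (1 - \<epsilon>))"
  using g_pos by simp

lemma eigenvalue_gap_soft:
  assumes "\<epsilon> < 1/3"
  shows "ereal (g * ((1 - 3 * \<epsilon>) / (1 - \<epsilon>))) \<le> eigenvalue_gap R K"
proof -
  obtain \<psi> ev where "eigenbasis R \<nu> K \<psi> ev" using ex_eigenbasis by blast
  then interpret eigenbasis R \<nu> K \<psi> ev .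
  show ?thesis
    by (rule eigenvalue_gap_ge[of h k0])
      (use h_eigen inner_h_ge_1 gap_const_pos[OF assms] gap_orthogonal_to_h[OF assms] in auto)
qed


text \<open>Put s for the square root and L for the logarithm in the mixing time. The factor 1 + s
  pays for the squared norm N of h: beyond exp(-L) there remains exp(-L s) \<le> exp(-s), since L is
  at least 1, and N \<le> 1 + s^2 \<le> 1 + s \<le> exp s, since s is at most 1.\<close>

lemma relative_error_bound:
  assumes \<epsilon>: "\<epsilon> < 1/3" and \<delta>: "0 < \<delta>" "\<delta> < 1"
    and t: "1 / g * (ln (2 / (\<delta> * (1 - \<delta>) * zeta_soft)) * (1 + sqrt (\<epsilon> / (1 - \<epsilon>))) * ((1 - \<epsilon>) / (1 - 3 * \<epsilon>))) < t"
  shows "0 \<le> t"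
    and "exp (- (t * (g * ((1 - 3 * \<epsilon>) / (1 - \<epsilon>))))) * inner_on R \<nu> h h / zeta_soft < \<delta> * (1 - \<delta>) / 2"
proof -
  define c where "c = g * ((1 - 3 * \<epsilon>) / (1 - \<epsilon>))"
  define s where "s = sqrt (\<epsilon> / (1 - \<epsilon>))"
  define u where "u = \<delta> * (1 - \<delta>) / 2 * zeta_soft"
  define N where "N = inner_on R \<nu> h h"
  have c: "0 < c" unfolding c_def using gap_const_pos[OF \<epsilon>] .
  have s: "0 \<le> s" "s \<le> 1" using \<epsilon> eps_nonneg by (auto simp: s_def)
  have s2: "s\<^sup>2 = \<epsilon> / (1 - \<epsilon>)" using \<epsilon> eps_nonneg by (simp add: s_def)
  have N: "N \<le> 1 + s\<^sup>2" using norm_h_le \<epsilon> by (simp add: N_def s2 field_simps)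
  have N1: "1 \<le> N" using inner_h_ge_1 by (simp add: N_def)
  have "\<epsilon> / (1 - \<epsilon>) \<le> 1 / 2" using \<epsilon> by (simp add: field_simps)
  then have N32: "N \<le> 3/2" using N unfolding s2 by linarith
  have "zeta_soft \<le> 3/2" using zeta_soft_le_norm N32 by (simp add: N_def)
  moreover have "\<delta> * (1 - \<delta>) \<le> 1/4"
    using zero_le_power2[of "\<delta> - 1/2"] by (simp add: power2_eq_square algebra_simps)
  moreover have d0: "0 < \<delta> * (1 - \<delta>)" using \<delta> by simp
  ultimately have "\<delta> * (1 - \<delta>) * zeta_soft \<le> 1/4 * (3/2)"
    using zeta_soft_pos by (intro mult_mono) auto
  then have u: "0 < u" "u \<le> 3/16" using d0 zeta_soft_pos by (auto simp: u_def)
  define L where "L = ln (1 / u)"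
  \<comment> \<open>The bound 3/16 on u serves only to give e \<le> 3 \<le> 1 / u, that is, L at
    least 1.\<close>
  have "exp 1 \<le> (3::real)" by (rule exp_le)
  also have "3 \<le> 1 / u" using u by (simp add: field_simps)
  finally have L: "1 \<le> L" using u by (simp add: L_def ln_ge_iff)
  have "1 / u = 2 / (\<delta> * (1 - \<delta>) * zeta_soft)" by (simp add: u_def)
  then have t': "1 / g * (L * (1 + s) * ((1 - \<epsilon>) / (1 - 3 * \<epsilon>))) < t" using t by (simp add: L_def s_def)
  have "1 / g * (L * (1 + s) * ((1 - \<epsilon>) / (1 - 3 * \<epsilon>))) = L * (1 + s) / c"
    by (simp add: c_def)
  then have "L * (1 + s) / c < t" using t' by linarith
  then have tc: "L * (1 + s) < t * c" using c by (simp add: divide_less_eq)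
  have "0 < L * (1 + s)" using L s by (intro mult_pos_pos) auto
  with tc have "0 < t * c" by linarith
  then show "0 \<le> t" using c by (simp add: zero_less_mult_iff)
  have "exp (- (t * c)) < exp (- (L * (1 + s)))" using tc by simp
  also have "\<dots> = exp (- L) * exp (- (L * s))" by (simp add: algebra_simps flip: exp_add)
  also have "exp (- L) = u" using u by (simp add: L_def ln_div)
  also have "u * exp (- (L * s)) \<le> u * exp (- s)"
    using u L s mult_right_mono[of 1 L s] by (intro mult_left_mono) auto
  finally have "exp (- (t * c)) < u * exp (- s)" .
  then have "exp (- (t * c)) * N < u * exp (- s) * N" using N1 by (intro mult_strict_right_mono) auto
  also have "\<dots> \<le> u * 1"
  proof -
    have "N \<le> 1 + s" using N power2_eq_square[of s] mult_left_le[of s s] s by linarith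
    also have "\<dots> \<le> exp s" by (rule exp_ge_add_one_self)
    finally have "exp (- s) * N \<le> exp (- s) * exp s" by (intro mult_left_mono) auto
    then have "exp (- s) * N \<le> 1" by (simp flip: exp_add)
    then show ?thesis unfolding mult.assoc using u by (intro mult_left_mono) auto
  qed
  finally have "exp (- (t * c)) * N / zeta_soft < u / zeta_soft"
    using zeta_soft_pos by (simp add: divide_strict_right_mono)
  also have "u / zeta_soft = \<delta> * (1 - \<delta>) / 2" using zeta_soft_pos by (simp add: u_def)
  finally show "exp (- (t * (g * ((1 - 3 * \<epsilon>) / (1 - \<epsilon>))))) * inner_on R \<nu> h h / zeta_soft < \<delta> * (1 - \<delta>) / 2"
    by (simp add: c_def N_def)
qed

text \<open>Here q z is the killed law at time t up to a common factor. Every q z equals A m z up to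
  the relative error \<rho>, and summation over z gives the same relative error for the
  normalization Q. The quotient is therefore off by at most 2 \<rho> / (1 - \<rho>), which the
  factor \<delta> (1 - \<delta>) / 2 in the bound on \<rho> keeps below \<delta>.\<close>

lemma flow_ratio_close:
  assumes \<epsilon>: "\<epsilon> < 1/3" and x: "x \<in> R" and y: "y \<in> R" and \<delta>: "0 < \<delta>" "\<delta> < 1"
    and t: "1 / g * (ln (2 / (\<delta> * (1 - \<delta>) * zeta_soft)) * (1 + sqrt (\<epsilon> / (1 - \<epsilon>))) * ((1 - \<epsilon>) / (1 - 3 * \<epsilon>))) < t"
    and q: "\<And>z. z \<in> R \<Longrightarrow> (\<lambda>m. t ^ m / fact m * (kernel_op R K ^^ m) (indicator {z}) x) sums q z"
  shows "\<bar>q y / (\<Sum>z\<in>R. q z) / (\<nu> y * h y) - 1\<bar> < \<delta>"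
proof -
  obtain \<psi> ev where "eigenbasis R \<nu> K \<psi> ev" using ex_eigenbasis by blast
  then interpret eigenbasis R \<nu> K \<psi> ev .
  define c where "c = g * ((1 - 3 * \<epsilon>) / (1 - \<epsilon>))"
  define N where "N = inner_on R \<nu> h h"
  define A where "A = exp (t * k0) * h x / N"
  define \<rho> where "\<rho> = exp (- (t * c)) * N / zeta_soft"
  define m where "m z = \<nu> z * h z" for z
  have t0: "0 \<le> t" by (rule relative_error_bound(1)[OF \<epsilon> \<delta> t])
  have \<rho>2: "\<rho> < \<delta> * (1 - \<delta>) / 2"
    using relative_error_bound(2)[OF \<epsilon> \<delta> t] by (simp add: \<rho>_def c_def N_def)
  have N: "0 < N" using inner_h_ge_1 by (simp add: N_def)
  have \<rho>0: "0 \<le> \<rho>" using N zeta_soft_pos by (simp add: \<rho>_def)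
  have A: "0 < A" using N h_pos[OF x] by (simp add: A_def)
  have m: "z \<in> R \<Longrightarrow> 0 < m z" for z using pos h_pos by (simp add: m_def)
  have close: "\<bar>q z - A * m z\<bar> \<le> \<rho> * (A * m z)" if z: "z \<in> R" for z
  proof -
    have qz: "q z = flow t (indicator {z}) x"
      using sums_unique2[OF q[OF z] flow_sums[OF x, of t "indicator {z}"]] .
    have i1: "inner_on R \<nu> (indicator {z}) h = m z"
      using z by (subst inner_on_commute) (simp add: inner_on_def m_def indicator_def if_distrib[of "\<lambda>w. _ * w"] cong: if_cong)
    have i2: "inner_on R \<nu> (indicator {z}) (indicator {z}) = \<nu> z"
      using z by (simp add: inner_on_def indicator_def if_distrib[of "\<lambda>w. _ * w"] cong: if_cong)
    have "\<bar>flow t (indicator {z}) x - exp (t * k0) * (inner_on R \<nu> (indicator {z}) h / inner_on R \<nu> h h) * h x\<bar>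
      \<le> exp (t * (k0 - c)) * sqrt (inner_on R \<nu> (indicator {z}) (indicator {z}) / \<nu> x)"
      by (rule flow_decay[of h k0 c, OF _ _ _ _ x t0])
        (use h_eigen N gap_const_pos[OF \<epsilon>] gap_orthogonal_to_h[OF \<epsilon>] in \<open>auto simp: N_def c_def\<close>)
    then have "\<bar>q z - A * m z\<bar> \<le> exp (t * (k0 - c)) * sqrt (\<nu> z / \<nu> x)"
      by (simp add: qz i1 i2 A_def N_def mult_ac)
    \<comment> \<open>Each factor sqrt(\<nu> w) h w is at least sqrt(\<open>zeta_soft\<close>), so
      multiplying by the factors at x and z and dividing by \<open>zeta_soft\<close> can only
      increase; this turns the absolute error into a relative one.\<close>
    also have "\<dots> \<le> \<rho> * (A * m z)"
    proof -
      have z1: "sqrt zeta_soft \<le> sqrt (\<nu> w) * h w" if "w \<in> R" for w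
        using real_sqrt_le_mono[OF zeta_soft_le[OF that]] h_pos[OF that] by (simp add: real_sqrt_mult)
      have "zeta_soft = sqrt zeta_soft * sqrt zeta_soft" using zeta_soft_pos by simp
      also have "\<dots> \<le> (sqrt (\<nu> x) * h x) * (sqrt (\<nu> z) * h z)"
        using z1[OF x] z1[OF z] zeta_soft_pos h_pos[OF x] pos[OF x] by (intro mult_mono) auto
      finally have "1 \<le> (sqrt (\<nu> x) * h x) * (sqrt (\<nu> z) * h z) / zeta_soft"
        using zeta_soft_pos by (simp add: le_divide_eq)
      then have "exp (t * (k0 - c)) * sqrt (\<nu> z / \<nu> x) * 1
          \<le> exp (t * (k0 - c)) * sqrt (\<nu> z / \<nu> x) * ((sqrt (\<nu> x) * h x) * (sqrt (\<nu> z) * h z) / zeta_soft)"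
        using pos[OF x] pos[OF z] by (intro mult_left_mono) auto
      also have "\<dots> = exp (t * (k0 - c)) * (sqrt (\<nu> z) * sqrt (\<nu> z)) * (h x * h z) / zeta_soft"
        using pos[OF x] by (simp add: real_sqrt_divide)
      also have "sqrt (\<nu> z) * sqrt (\<nu> z) = \<nu> z" using pos[OF z] by simp
      also have "exp (t * (k0 - c)) * \<nu> z * (h x * h z) / zeta_soft = \<rho> * (A * m z)"
        using N by (simp add: \<rho>_def A_def m_def right_diff_distrib exp_diff exp_minus divide_inverse)
      finally show ?thesis by simp
    qed
    finally show ?thesis .
  qed
  define Q where "Q = (\<Sum>z\<in>R. q z)"
  have "\<bar>Q - A\<bar> = \<bar>\<Sum>z\<in>R. q z - A * m z\<bar>"
    by (simp add: Q_def sum_subtractf sum_distrib_left[symmetric] m_def h_mean)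
  also have "\<dots> \<le> (\<Sum>z\<in>R. \<rho> * (A * m z))"
    by (rule order_trans[OF sum_abs]) (intro sum_mono close)
  also have "\<dots> = \<rho> * A" by (simp add: sum_distrib_left[symmetric] m_def h_mean)
  finally have QA: "\<bar>Q - A\<bar> \<le> \<rho> * A" .
  \<comment> \<open>Equivalent to 2 \<rho> < \<delta> (1 - \<rho>), the form used at the
    end.\<close>
  have \<rho>3: "\<rho> * (2 + \<delta>) < \<delta>"
  proof -
    have "\<rho> * (2 + \<delta>) < \<delta> * (1 - \<delta>) / 2 * (2 + \<delta>)" using \<rho>2 \<delta> by (intro mult_strict_right_mono) auto
    also have "\<dots> = \<delta> * (1 - (\<delta> + \<delta>\<^sup>2) / 2)" by (simp add: power2_eq_square field_simps)
    also have "\<dots> \<le> \<delta> * 1" using \<delta> by (intro mult_left_mono) auto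
    finally show ?thesis by simp
  qed
  have "\<rho> * 2 \<le> \<rho> * (2 + \<delta>)" using \<rho>0 \<delta> by (intro mult_left_mono) auto
  then have \<rho>1: "\<rho> < 1/2" using \<rho>3 \<delta> by linarith
  have "\<rho> * A < 1/2 * A" using \<rho>1 A by (intro mult_strict_right_mono) auto
  then have Q: "0 < Q" using QA by linarith
  have "\<bar>q y - Q * m y\<bar> \<le> \<bar>q y - A * m y\<bar> + \<bar>Q - A\<bar> * m y"
  proof -
    have "\<bar>(Q - A) * m y\<bar> = \<bar>Q - A\<bar> * m y" using m[OF y] by (simp add: abs_mult)
    moreover have "q y - Q * m y = q y - A * m y - (Q - A) * m y" by (simp add: algebra_simps)
    ultimately show ?thesis using abs_triangle_ineq4[of "q y - A * m y" "(Q - A) * m y"] by linarith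
  qed
  also have "\<dots> \<le> \<rho> * (A * m y) + \<rho> * A * m y"
    using close[OF y] QA m[OF y] by (intro add_mono mult_right_mono) auto
  also have "\<dots> = 2 * \<rho> * A * m y" by simp
  also have "\<dots> < \<delta> * (1 - \<rho>) * A * m y"
    using \<rho>3 A m[OF y] by (intro mult_strict_right_mono) (auto simp: algebra_simps)
  also have "\<dots> \<le> \<delta> * (Q * m y)"
  proof -
    have "(1 - \<rho>) * A \<le> Q" using QA by (simp add: algebra_simps)
    then have "\<delta> * ((1 - \<rho>) * A * m y) \<le> \<delta> * (Q * m y)"
      using \<delta> m[OF y] by (intro mult_left_mono mult_right_mono) auto
    then show ?thesis by (simp add: mult.assoc)
  qed
  finally have "\<bar>q y - Q * m y\<bar> / (Q * m y) < \<delta>" using Q m[OF y] by (simp add: pos_divide_less_eq)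
  moreover have "q y / Q / m y - 1 = (q y - Q * m y) / (Q * m y)"
    using Q m[OF y] by (simp add: diff_divide_distrib)
  ultimately show ?thesis
    unfolding Q_def[symmetric] m_def[symmetric] using Q m[OF y] by (simp add: abs_mult)
qed

text \<open>The completed kernel adds at most \<alpha> on the diagonal, so it maps h below (k0 +
  \<alpha>) h; its nonnegativity allows iteration.\<close>

lemma power_completed_le:
  assumes "\<And>x. x \<in> R \<Longrightarrow> escape_prob K R x \<le> \<alpha>" "0 \<le> \<alpha>" "x \<in> R"
  shows "(kernel_op R (completed_kernel K R) ^^ n) h x \<le> (k0 + \<alpha>) ^ n * h x"
  using assms(3)
proof (induction n arbitrary: x)
  case (Suc n)
  interpret P: irreducible_kernel R \<nu> "completed_kernel K R" by (rule completed_irreducible)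
  let ?P = "completed_kernel K R"
  have "(kernel_op R ?P ^^ Suc n) h x = (\<Sum>y\<in>R. ?P x y * (kernel_op R ?P ^^ n) h y)"
    by (simp add: kernel_op_def)
  also have "\<dots> \<le> (\<Sum>y\<in>R. ?P x y * ((k0 + \<alpha>) ^ n * h y))"
    using Suc P.nonneg by (intro sum_mono mult_left_mono) auto
  also have "\<dots> = (k0 + \<alpha>) ^ n * kernel_op R ?P h x"
    by (simp add: kernel_op_def sum_distrib_left mult_ac)
  also have "\<dots> \<le> (k0 + \<alpha>) ^ n * ((k0 + \<alpha>) * h x)"
  proof (rule mult_left_mono)
    have "kernel_op R ?P h x = (k0 + escape_prob K R x) * h x"
      using Suc.prems by (simp add: kernel_op_completed h_eigen algebra_simps)
    also have "\<dots> \<le> (k0 + \<alpha>) * h x"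
      using assms(1)[OF Suc.prems] h_pos[OF Suc.prems] by (intro mult_right_mono) auto
    finally show "kernel_op R ?P h x \<le> (k0 + \<alpha>) * h x" .
  qed (use k0_nonneg assms(2) in simp)
  finally show ?case by (simp add: mult_ac)
qed simp

text \<open>The killed kernel dominates the completed one minus \<open>\<alpha>\<close> on the diagonal, so \<open>h\<close> is bounded
  below by its own relaxation under the completed kernel.\<close>

lemma h_lower_bound:
  assumes \<alpha>: "\<And>x. x \<in> R \<Longrightarrow> escape_prob K R x \<le> \<alpha>" "0 \<le> \<alpha>" and x: "x \<in> R" and t: "0 \<le> t"
  shows "exp (- (\<alpha> * t)) * (1 - exp (- (g * t)) * sqrt (norm2_on R \<nu> (\<lambda>x. h x - 1) / \<nu> x)) \<le> h x"
proof -
  let ?P = "completed_kernel K R"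
  interpret P: irreducible_kernel R \<nu> ?P by (rule completed_irreducible)
  obtain \<psi> ev where "eigenbasis R \<nu> ?P \<psi> ev" using P.ex_eigenbasis by blast
  then interpret E: eigenbasis R \<nu> ?P \<psi> ev .
  define D where "D = sqrt (norm2_on R \<nu> (\<lambda>x. h x - 1) / \<nu> x)"
  have P1: "kernel_op R ?P (\<lambda>_. 1) y = 1" if "y \<in> R" for y
    using kernel_op_completed[OF that, of "\<lambda>_. 1"] by (simp add: kernel_op_def escape_prob_def)
  have P1n: "(kernel_op R ?P ^^ n) (\<lambda>_. 1) y = 1" if "y \<in> R" for n y
    using that
  proof (induction n arbitrary: y)
    case (Suc n)
    have "(kernel_op R ?P ^^ Suc n) (\<lambda>_. 1) y = kernel_op R ?P (\<lambda>_. 1) y"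
      using Suc by (auto intro: kernel_op_cong)
    then show ?case using P1 Suc.prems by simp
  qed simp
  have esc: "escape_prob ?P R y = 0" if "y \<in> R" for y
    using P1[OF that] by (simp add: escape_prob_def kernel_op_def)
  \<comment> \<open>For mean-zero functions the variance is the squared norm, and the completed
    kernel has no killing term, so g is a gap below the eigenvalue 1.\<close>
  have gapP: "inner_on R \<nu> f (kernel_op R ?P f) \<le> (1 - g) * inner_on R \<nu> f f"
    if "inner_on R \<nu> f (\<lambda>_. 1) = 0" for f
    using gap[of f] that P.dirichlet_on_eq[of f]
    by (simp add: esc dirichlet_on_completed_kernel var_on_eq[OF mass] algebra_simps)
  have h1: "inner_on R \<nu> (\<lambda>x. h x - 1) (\<lambda>_. 1) = 0"
    by (simp add: inner_on_diff_left inner_on_h_1 inner_on_1_1)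
  have hh: "inner_on R \<nu> (\<lambda>x. h x - 1) (\<lambda>x. h x - 1) = norm2_on R \<nu> (\<lambda>x. h x - 1)"
    by (simp add: inner_on_def norm2_on_def power2_eq_square mult.assoc)
  \<comment> \<open>The constants are the top eigenfunction; as h - 1 has mean zero, its projection
    term disappears and only the decaying part is left.\<close>
  have "\<bar>E.flow t (\<lambda>x. h x - 1) x - exp (t * 1) * (inner_on R \<nu> (\<lambda>x. h x - 1) (\<lambda>_. 1) / inner_on R \<nu> (\<lambda>_. 1) (\<lambda>_. 1)) * 1\<bar>
     \<le> exp (t * (1 - g)) * sqrt (inner_on R \<nu> (\<lambda>x. h x - 1) (\<lambda>x. h x - 1) / \<nu> x)"
    by (rule E.flow_decay[of "\<lambda>_. 1" 1 g, OF _ _ _ _ x t])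
      (use P1 g_pos gapP in \<open>auto simp: inner_on_1_1\<close>)
  then have dec: "\<bar>E.flow t (\<lambda>x. h x - 1) x\<bar> \<le> exp (t * (1 - g)) * D"
    by (simp add: h1 hh D_def)
  have "(\<lambda>n. t ^ n / fact n * (kernel_op R ?P ^^ n) (\<lambda>_. 1) x) sums exp t"
    using exp_converges[of t] by (simp add: P1n[OF x] field_simps)
  from sums_unique2[OF this E.flow_sums[OF x]] have "E.flow t (\<lambda>_. 1) x = exp t" ..
  moreover have "E.flow t (\<lambda>x. h x - 1) x = E.flow t h x - E.flow t (\<lambda>_. 1) x"
    by (simp add: E.flow_def inner_on_diff_left algebra_simps sum_subtractf)
  ultimately have "exp t - exp (t * (1 - g)) * D \<le> E.flow t h x" using dec by linarith
  \<comment> \<open>Term by term in the two exponential series.\<close>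
  also have "\<dots> \<le> exp (t * (k0 + \<alpha>)) * h x"
  proof (rule sums_le[OF _ E.flow_sums[OF x]])
    show "t ^ n / fact n * (kernel_op R ?P ^^ n) h x \<le> (t * (k0 + \<alpha>)) ^ n /\<^sub>R fact n * h x" for n
      using mult_left_mono[OF power_completed_le[OF \<alpha> x], of "t ^ n / fact n" n] t
      by (simp add: power_mult_distrib divide_inverse mult_ac)
    show "(\<lambda>n. (t * (k0 + \<alpha>)) ^ n /\<^sub>R fact n * h x) sums (exp (t * (k0 + \<alpha>)) * h x)"
      by (intro sums_mult2 exp_converges)
  qed
  also have "\<dots> \<le> exp (t * (1 + \<alpha>)) * h x"
    using k0_le_1 t h_pos[OF x] by (intro mult_right_mono) (auto intro: mult_left_mono)
  finally have "exp (- (t * (1 + \<alpha>))) * (exp t - exp (t * (1 - g)) * D) \<le> exp (- (t * (1 + \<alpha>))) * (exp (t * (1 + \<alpha>)) * h x)"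
    by (intro mult_left_mono) auto
  also have "\<dots> = h x" by (simp flip: mult.assoc exp_add)
  also have "exp (- (t * (1 + \<alpha>))) * (exp t - exp (t * (1 - g)) * D) = exp (- (\<alpha> * t)) * (1 - exp (- (g * t)) * D)"
    by (simp add: algebra_simps flip: exp_add mult.assoc)
  finally show ?thesis by (simp add: D_def)
qed

text \<open>By \<open>deviation_le\<close> the deviation of h seen at x is at most sqrt w / 2, and t
  is the time at which exp(-g t) sqrt w has come down to 1. Then h x is at least exp(-\<alpha> t) /
  2: squaring yields the outer 4 and the exponent 2 \<alpha> t = (\<alpha> / g) max(0, ln
  w).\<close>

lemma zeta_soft_lower_bound:
  assumes \<epsilon>: "\<epsilon> < 1" and \<alpha>: "\<And>x. x \<in> R \<Longrightarrow> escape_prob K R x \<le> \<alpha>" "0 \<le> \<alpha>"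
  shows "ln (1 / zeta_soft) \<le> ln (4 / Min (\<nu> ` R))
     + \<alpha> / g * max 0 (ln (4 * \<epsilon> / ((1 - \<epsilon>) * Min (\<nu> ` R))))"
proof -
  define \<zeta> where "\<zeta> = Min (\<nu> ` R)"
  define w where "w = 4 * \<epsilon> / ((1 - \<epsilon>) * \<zeta>)"
  define t where "t = max 0 (ln w) / (2 * g)"
  have \<zeta>: "0 < \<zeta>" unfolding \<zeta>_def using nonempty pos by (subst Min_gr_iff) auto
  have \<zeta>le: "x \<in> R \<Longrightarrow> \<zeta> \<le> \<nu> x" for x unfolding \<zeta>_def by (intro Min_le) auto
  have w: "0 \<le> w" using \<epsilon> eps_nonneg \<zeta> by (simp add: w_def)
  have t: "0 \<le> t" using g_pos by (simp add: t_def)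
  have gt: "g * t = max 0 (ln w) / 2" using g_pos by (simp add: t_def)
  have key: "exp (- (g * t)) * sqrt w \<le> 1"
  proof (cases "w \<le> 1")
    \<comment> \<open>The argument uses only g t \<ge> 0, so the value of \<open>ln w\<close> does
      not matter, not even at w = 0.\<close>
    case True
    have "exp (- (g * t)) * sqrt w \<le> 1 * 1" using True w gt by (intro mult_mono) auto
    then show ?thesis by simp
  next
    case False
    then have "sqrt w = exp (ln w / 2)" by (simp add: ln_sqrt[symmetric])
    moreover have "g * t = ln w / 2" using False by (simp add: gt max_def)
    ultimately show ?thesis by (simp flip: exp_add)
  qed
  have hx: "exp (- (\<alpha> * t)) / 2 \<le> h x" if x: "x \<in> R" for x
  proof -
    have "norm2_on R \<nu> (\<lambda>x. h x - 1) / \<nu> x \<le> (\<epsilon> / (1 - \<epsilon>)) / \<zeta>"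
      using deviation_le[OF \<epsilon>] \<zeta>le[OF x] \<zeta> \<epsilon> eps_nonneg by (intro frac_le) auto
    also have "\<dots> = w / 4" by (simp add: w_def)
    finally have "sqrt (norm2_on R \<nu> (\<lambda>x. h x - 1) / \<nu> x) \<le> sqrt (w / 4)" by simp
    also have "\<dots> = sqrt w / 2" by (simp add: real_sqrt_divide)
    finally have "exp (- (g * t)) * sqrt (norm2_on R \<nu> (\<lambda>x. h x - 1) / \<nu> x) \<le> exp (- (g * t)) * (sqrt w / 2)"
      by (intro mult_left_mono) auto
    then have "1 / 2 \<le> 1 - exp (- (g * t)) * sqrt (norm2_on R \<nu> (\<lambda>x. h x - 1) / \<nu> x)" using key by linarith
    then have "exp (- (\<alpha> * t)) * (1 / 2) \<le> exp (- (\<alpha> * t)) * (1 - exp (- (g * t)) * sqrt (norm2_on R \<nu> (\<lambda>x. h x - 1) / \<nu> x))"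
      by (intro mult_left_mono) auto
    also have "\<dots> \<le> h x" by (rule h_lower_bound[OF \<alpha> x t])
    finally show ?thesis by simp
  qed
  have "\<zeta> / 4 * exp (- (2 * \<alpha> * t)) \<le> zeta_soft"
    unfolding zeta_soft_def
  proof (rule Min.boundedI)
    fix a assume "a \<in> (\<lambda>x. \<nu> x * (h x)\<^sup>2) ` R"
    then obtain x where x: "x \<in> R" and a: "a = \<nu> x * (h x)\<^sup>2" by auto
    have "exp (- (2 * \<alpha> * t)) = exp (- (\<alpha> * t)) * exp (- (\<alpha> * t))" by (simp flip: exp_add)
    then have "\<zeta> / 4 * exp (- (2 * \<alpha> * t)) = \<zeta> * (exp (- (\<alpha> * t)) / 2)\<^sup>2"
      by (simp add: power2_eq_square)
    also have "\<dots> \<le> \<nu> x * (h x)\<^sup>2"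
      using hx[OF x] \<zeta>le[OF x] \<zeta> by (intro mult_mono power_mono) auto
    finally show "\<zeta> / 4 * exp (- (2 * \<alpha> * t)) \<le> a" by (simp add: a)
  qed (use nonempty in auto)
  then have "ln (\<zeta> / 4 * exp (- (2 * \<alpha> * t))) \<le> ln zeta_soft"
    using \<zeta> zeta_soft_pos by (subst ln_le_cancel_iff) auto
  moreover have "ln (\<zeta> / 4 * exp (- (2 * \<alpha> * t))) = ln (\<zeta> / 4) - 2 * \<alpha> * t"
    using \<zeta> ln_mult[of "\<zeta> / 4" "exp (- (2 * \<alpha> * t))"] by simp
  moreover have "2 * \<alpha> * t = \<alpha> / g * max 0 (ln w)" using g_pos by (simp add: t_def)
  ultimately show ?thesis
    using \<zeta> zeta_soft_pos by (simp add: ln_div \<zeta>_def[symmetric] w_def[symmetric])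
qed

end


section \<open>Lower bounds on the soft measure from a positive diagonal\<close>

lemma nu_le_1: "x \<in> R \<Longrightarrow> \<nu> x \<le> 1"
  using member_le_sum[of x R \<nu>] mass by (auto simp: less_imp_le[OF pos])

lemma left_eigen_power: "(\<Sum>x\<in>R. \<nu> x * h x * (kernel_op R K ^^ n) f x) = k0 ^ n * (\<Sum>x\<in>R. \<nu> x * h x * f x)"
proof (induction n)
  case (Suc n)
  have "(\<Sum>x\<in>R. \<nu> x * h x * (kernel_op R K ^^ Suc n) f x)
      = (\<Sum>x\<in>R. \<Sum>y\<in>R. \<nu> x * h x * K x y * (kernel_op R K ^^ n) f y)"
    by (simp add: kernel_op_def sum_distrib_left mult.assoc)
  also have "\<dots> = (\<Sum>y\<in>R. \<Sum>x\<in>R. \<nu> x * h x * K x y * (kernel_op R K ^^ n) f y)" by (rule sum.swap)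
  also have "\<dots> = (\<Sum>y\<in>R. k0 * (\<nu> y * h y) * (kernel_op R K ^^ n) f y)"
    by (intro sum.cong refl) (simp add: left_eigen flip: sum_distrib_right)
  also have "\<dots> = k0 * (\<Sum>y\<in>R. \<nu> y * h y * (kernel_op R K ^^ n) f y)"
    by (simp add: sum_distrib_left mult.assoc)
  finally show ?case by (simp add: Suc)
qed simp

text \<open>A positive diagonal makes positivity persist for all larger exponents. This lets
  "eventually positive" propagate along edges and lets a maximum over all pairs serve as a common
  exponent. The edges are traversed backwards, by \<open>kernel_pos_sym\<close>.\<close>

lemma ex_positivity_exponent:
  assumes diag: "\<And>x. x \<in> R \<Longrightarrow> 0 < K x x"
  shows "\<exists>k. \<forall>x\<in>R. \<forall>y\<in>R. 0 < (kernel_op R (completed_kernel K R) ^^ k) (indicator {y}) x"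
proof -
  let ?P = "completed_kernel K R"
  interpret P: irreducible_kernel R \<nu> ?P by (rule completed_irreducible)
  have nn: "0 \<le> (kernel_op R ?P ^^ n) (indicator {y}) x" if "x \<in> R" for n x y
    using that
  proof (induction n arbitrary: x)
    case (Suc n)
    then show ?case using P.nonneg by (auto simp: kernel_op_def intro!: sum_nonneg mult_nonneg_nonneg)
  qed simp
  have step: "0 < (kernel_op R ?P ^^ Suc n) (indicator {y}) v"
    if "u \<in> R" "v \<in> R" "0 < ?P v u" "0 < (kernel_op R ?P ^^ n) (indicator {y}) u" for n u v y
  proof -
    have "0 < (\<Sum>z\<in>R. ?P v z * (kernel_op R ?P ^^ n) (indicator {y}) z)"
      using that P.nonneg nn by (intro sum_pos2[of _ u]) auto
    then show ?thesis by (simp add: kernel_op_def)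
  qed
  have diagP: "0 < ?P x x" if "x \<in> R" for x
    using diag[OF that] escape_prob_nonneg[OF that] by (simp add: completed_kernel_def)
  have "\<exists>n. \<forall>m\<ge>n. 0 < (kernel_op R ?P ^^ m) (indicator {y}) x" if y: "y \<in> R" and x: "x \<in> R" for x y
  proof (rule P.irreducible_propagate[of y "\<lambda>x. \<exists>n. \<forall>m\<ge>n. 0 < (kernel_op R ?P ^^ m) (indicator {y}) x", OF y _ _ x])
    have "0 < (kernel_op R ?P ^^ m) (indicator {y}) y" for m
      by (induction m) (use step[OF y y diagP[OF y]] in auto)
    then show "\<exists>n. \<forall>m\<ge>n. 0 < (kernel_op R ?P ^^ m) (indicator {y}) y" by blast
  next
    fix u v assume uv: "u \<in> R" "v \<in> R" "0 < ?P u v"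
      and "\<exists>n. \<forall>m\<ge>n. 0 < (kernel_op R ?P ^^ m) (indicator {y}) u"
    then obtain n where n: "\<And>m. n \<le> m \<Longrightarrow> 0 < (kernel_op R ?P ^^ m) (indicator {y}) u" by blast
    show "\<exists>n. \<forall>m\<ge>n. 0 < (kernel_op R ?P ^^ m) (indicator {y}) v"
    proof (intro exI[of _ "Suc n"] allI impI)
      fix m assume "Suc n \<le> m"
      then obtain m' where "m = Suc m'" "n \<le> m'" by (cases m) auto
      then show "0 < (kernel_op R ?P ^^ m) (indicator {y}) v"
        using step[OF uv(1,2) P.kernel_pos_sym[OF uv] n] by simp
    qed
  qed
  then have "\<forall>z. \<exists>n. snd z \<in> R \<longrightarrow> fst z \<in> R \<longrightarrow> (\<forall>m\<ge>n. 0 < (kernel_op R ?P ^^ m) (indicator {snd z}) (fst z))"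
    by blast
  from choice[OF this] obtain N where N: "\<forall>z. snd z \<in> R \<longrightarrow> fst z \<in> R \<longrightarrow> (\<forall>m\<ge>N z. 0 < (kernel_op R ?P ^^ m) (indicator {snd z}) (fst z))"
    ..
  show ?thesis
  proof (intro exI[of _ "Max (N ` (R \<times> R))"] ballI)
    fix x y assume xy: "x \<in> R" "y \<in> R"
    have "N (x, y) \<le> Max (N ` (R \<times> R))"
      by (rule Max_ge) (use xy in auto)
    then show "0 < (kernel_op R ?P ^^ Max (N ` (R \<times> R))) (indicator {y}) x"
      using spec[OF N, of "(x, y)"] xy by simp
  qed
qed

lemma max_neg_ln_bound:
  assumes "x \<in> R" "y \<in> R" "0 < K x y"
  shows "exp (- max_neg_ln R K) \<le> K x y"
proof -
  have "finite {- ln (K x y) |x y. x \<in> R \<and> y \<in> R \<and> 0 < K x y}"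
    by (rule finite_subset[of _ "(\<lambda>(x, y). - ln (K x y)) ` UNIV"]) auto
  then have "- ln (K x y) \<le> max_neg_ln R K"
    unfolding max_neg_ln_def by (rule Max_ge) (use assms in auto)
  then have "exp (- max_neg_ln R K) \<le> exp (ln (K x y))" by simp
  then show ?thesis using assms by simp
qed

text \<open>A positive entry of the n-th completed power comes from a path of n positive steps. The
  two kernels differ only on the diagonal, where K is positive as well, so the same path counts for
  K, with every factor at least exp(-\<open>max_neg_ln R K\<close>).\<close>

lemma power_lower_bound:
  assumes diag: "\<And>x. x \<in> R \<Longrightarrow> 0 < K x x"
    and x: "x \<in> R" and "0 < (kernel_op R (completed_kernel K R) ^^ n) (indicator {y}) x"
  shows "exp (- max_neg_ln R K) ^ n \<le> (kernel_op R K ^^ n) (indicator {y}) x"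
  using x assms(3)
proof (induction n arbitrary: x)
  case 0
  then show ?case by (auto simp: indicator_def split: if_splits)
next
  case (Suc n)
  let ?P = "completed_kernel K R"
  interpret P: irreducible_kernel R \<nu> ?P by (rule completed_irreducible)
  have nn: "0 \<le> (kernel_op R K ^^ m) (indicator {y}) x" if "x \<in> R" for m x
    using that
  proof (induction m arbitrary: x)
    case (Suc m)
    then show ?case using nonneg by (auto simp: kernel_op_def intro!: sum_nonneg mult_nonneg_nonneg)
  qed simp
  have "0 < (\<Sum>z\<in>R. ?P x z * (kernel_op R ?P ^^ n) (indicator {y}) z)"
    using Suc.prems(2) by (simp add: kernel_op_def[of R ?P "(kernel_op R ?P ^^ n) (indicator {y})" x])
  then obtain z where z: "z \<in> R" "0 < ?P x z * (kernel_op R ?P ^^ n) (indicator {y}) z"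
    by (meson not_less sum_nonpos)
  then have Pz: "0 < ?P x z" "0 < (kernel_op R ?P ^^ n) (indicator {y}) z"
    using P.nonneg[OF Suc.prems(1) z(1)] by (auto simp: zero_less_mult_iff)
  have "0 < K x z" using Pz(1) diag[OF Suc.prems(1)] by (auto simp: completed_kernel_def split: if_splits)
  then have "exp (- max_neg_ln R K) * exp (- max_neg_ln R K) ^ n \<le> K x z * (kernel_op R K ^^ n) (indicator {y}) z"
    using max_neg_ln_bound[OF Suc.prems(1) z(1)] Suc.IH[OF z(1) Pz(2)] by (intro mult_mono) auto
  also have "\<dots> \<le> (\<Sum>z\<in>R. K x z * (kernel_op R K ^^ n) (indicator {y}) z)"
    by (rule member_le_sum[OF z(1)]) (use nn nonneg Suc.prems in auto)
  finally show ?case by (simp add: kernel_op_def[of R K "(kernel_op R K ^^ n) (indicator {y})" x])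
qed

text \<open>Apply the left eigenvector to the n-th power of K: the result k0^n \<nu> y h y is at
  most \<nu> y h y, and it averages the entries of column y, all bounded below, with total weight
  1.\<close>

lemma soft_measure_lower_bound:
  assumes diag: "\<And>x. x \<in> R \<Longrightarrow> 0 < K x x" and y: "y \<in> R"
    and pos_n: "\<And>x. x \<in> R \<Longrightarrow> 0 < (kernel_op R (completed_kernel K R) ^^ n) (indicator {y}) x"
  shows "exp (- max_neg_ln R K * n) \<le> \<nu> y * h y"
proof -
  have "exp (- max_neg_ln R K) ^ n = (\<Sum>x\<in>R. \<nu> x * h x * exp (- max_neg_ln R K) ^ n)"
    by (simp add: h_mean flip: sum_distrib_right)
  also have "\<dots> \<le> (\<Sum>x\<in>R. \<nu> x * h x * (kernel_op R K ^^ n) (indicator {y}) x)"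
    using power_lower_bound[OF diag _ pos_n] pos h_pos
    by (intro sum_mono mult_left_mono) (auto intro: less_imp_le)
  also have "\<dots> = k0 ^ n * (\<nu> y * h y)"
    unfolding left_eigen_power using y by (simp add: indicator_def if_distrib[of "\<lambda>w. _ * w"] cong: if_cong)
  also have "\<dots> \<le> 1 * (\<nu> y * h y)"
    using k0_nonneg k0_le_1 pos[OF y] h_pos[OF y] by (intro mult_right_mono power_le_one) auto
  finally show ?thesis by (simp add: mult.commute flip: exp_of_nat_mult)
qed

end

text \<open>Column j of the power is its action on the j-th unit vector, which represents the
  indicator of the j-th point. This links \<open>positivity_exponent\<close> to powers of
  operators.\<close>

lemma kernel_mat_power_entry:
  fixes R :: "'a::finite set"
  assumes i: "i < card R" and j: "j < card R"
  shows "(kernel_mat R K ^\<^sub>m k) $$ (i, j)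
    = (kernel_op R K ^^ k) (indicator {from_nat_into R j}) (from_nat_into R i)"
proof -
  define n where "n = card R"
  define r where "r = from_nat_into R"
  have rinj: "i < n \<Longrightarrow> j < n \<Longrightarrow> r i = r j \<longleftrightarrow> i = j" for i j
    using bij_betw_from_nat_into_finite[of R] by (auto simp: n_def r_def bij_betw_def inj_on_def)
  let ?A = "kernel_mat R K"
  have A: "?A \<in> carrier_mat n n" by (simp add: kernel_mat_def n_def)
  have mv: "?A *\<^sub>v Matrix.vec n (\<lambda>i. f (r i)) = Matrix.vec n (\<lambda>i. kernel_op R K f (r i))" for f
  proof (rule eq_vecI)
    fix i assume "i < dim_vec (Matrix.vec n (\<lambda>i. kernel_op R K f (r i)))"
    then have "vec_index (?A *\<^sub>v Matrix.vec n (\<lambda>i. f (r i))) i = (\<Sum>j<n. (\<lambda>y. K (r i) y * f y) (r j))"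
      by (simp add: kernel_mat_def scalar_prod_def atLeast0LessThan n_def r_def)
    also have "\<dots> = kernel_op R K f (r i)"
      unfolding n_def r_def kernel_op_def by (rule sum_from_nat_into)
    finally show "vec_index (?A *\<^sub>v Matrix.vec n (\<lambda>i. f (r i))) i = vec_index (Matrix.vec n (\<lambda>i. kernel_op R K f (r i))) i"
      using \<open>i < _\<close> by simp
  qed (simp add: kernel_mat_def n_def)
  have pw: "(?A ^\<^sub>m k) *\<^sub>v Matrix.vec n (\<lambda>i. f (r i)) = Matrix.vec n (\<lambda>i. (kernel_op R K ^^ k) f (r i))" for f
  proof (induction k arbitrary: f)
    case 0
    show ?case using A by (simp add: carrier_vecI)
  next
    case (Suc k)
    have "(?A ^\<^sub>m Suc k) *\<^sub>v Matrix.vec n (\<lambda>i. f (r i)) = (?A ^\<^sub>m k) *\<^sub>v (?A *\<^sub>v Matrix.vec n (\<lambda>i. f (r i)))"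
      using A by (simp add: assoc_mult_mat_vec[of _ n n _ n] pow_carrier_mat)
    also have "\<dots> = Matrix.vec n (\<lambda>i. (kernel_op R K ^^ k) (kernel_op R K f) (r i))"
      unfolding mv by (rule Suc)
    finally show ?case by (simp add: funpow_swap1)
  qed
  have "unit_vec n j = Matrix.vec n (\<lambda>i. indicator {r j} (r i) :: real)"
    using j by (intro eq_vecI) (auto simp: rinj indicator_def n_def[symmetric])
  then have "(?A ^\<^sub>m k) *\<^sub>v unit_vec n j = Matrix.vec n (\<lambda>i. (kernel_op R K ^^ k) (indicator {r j}) (r i))"
    using pw by simp
  moreover have "(?A ^\<^sub>m k) *\<^sub>v unit_vec n j = col (?A ^\<^sub>m k) j"
    using col_mult2[OF pow_carrier_mat[OF A, of k] one_carrier_mat, of j]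
      right_mult_one_mat[OF pow_carrier_mat[OF A, of k]] j by (simp add: n_def)
  ultimately have "col (?A ^\<^sub>m k) j = Matrix.vec n (\<lambda>i. (kernel_op R K ^^ k) (indicator {r j}) (r i))"
    by simp
  moreover have "i < n" using i by (simp add: n_def)
  ultimately have "vec_index (col (?A ^\<^sub>m k) j) i = (kernel_op R K ^^ k) (indicator {r j}) (r i)"
    by (simp only: index_vec)
  moreover have "dim_row (?A ^\<^sub>m k) = n" "dim_col (?A ^\<^sub>m k) = n"
    using pow_carrier_mat[OF A, of k] by auto
  ultimately show ?thesis using i j by (simp add: r_def n_def)
qed

context killed_kernel
begin

lemma positivity_exponent_spec:
  assumes diag: "\<And>x. x \<in> R \<Longrightarrow> 0 < K x x" and x: "x \<in> R" and y: "y \<in> R"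
  shows "0 < (kernel_op R (completed_kernel K R) ^^ positivity_exponent R (completed_kernel K R)) (indicator {y}) x"
proof -
  let ?P = "completed_kernel K R"
  have r: "i < card R \<Longrightarrow> from_nat_into R i \<in> R" for i
    using bij_betw_from_nat_into_finite[of R] by (auto simp: bij_betw_def)
  obtain k where "\<forall>x\<in>R. \<forall>y\<in>R. 0 < (kernel_op R ?P ^^ k) (indicator {y}) x"
    using ex_positivity_exponent[OF diag] by blast
  then have "\<forall>i<card R. \<forall>j<card R. 0 < (kernel_mat R ?P ^\<^sub>m k) $$ (i, j)"
    by (simp add: kernel_mat_power_entry r)
  then have *: "\<forall>i<card R. \<forall>j<card R. 0 < (kernel_mat R ?P ^\<^sub>m positivity_exponent R ?P) $$ (i, j)"
    unfolding positivity_exponent_def by (rule LeastI)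
  obtain i where i: "i < card R" "x = from_nat_into R i"
    using bij_betw_from_nat_into_finite[of R] x by (auto simp: bij_betw_def)
  obtain j where j: "j < card R" "y = from_nat_into R j"
    using bij_betw_from_nat_into_finite[of R] y by (auto simp: bij_betw_def)
  show ?thesis using *[rule_format, OF i(1) j(1)] unfolding kernel_mat_power_entry[OF i(1) j(1)] i(2) j(2) .
qed

text \<open>The first bound is \<nu> \<le> 1, that is (\<nu> h)^2 \<le> \<nu> h^2; the second
  squares the lower bound on the soft measure, hence the factor 2.\<close>

lemma ln_soft_measure_le:
  assumes diag: "\<And>x. x \<in> R \<Longrightarrow> 0 < K x x"
  shows "ln (1 / zeta_soft) \<le> ln (1 / Min ((\<lambda>x. (\<nu> x * h x)\<^sup>2) ` R))"
    and "ln (1 / Min ((\<lambda>x. (\<nu> x * h x)\<^sup>2) ` R))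
      \<le> 2 * max_neg_ln R K * real (positivity_exponent R (completed_kernel K R))"
proof -
  define D where "D = positivity_exponent R (completed_kernel K R)"
  define m where "m = Min ((\<lambda>x. (\<nu> x * h x)\<^sup>2) ` R)"
  have "exp (- max_neg_ln R K * D) ^ 2 \<le> m"
    unfolding m_def
  proof (rule Min.boundedI)
    fix a assume "a \<in> (\<lambda>x. (\<nu> x * h x)\<^sup>2) ` R"
    then obtain y where y: "y \<in> R" "a = (\<nu> y * h y)\<^sup>2" by auto
    have "exp (- max_neg_ln R K * D) \<le> \<nu> y * h y"
      unfolding D_def by (rule soft_measure_lower_bound[OF diag y(1) positivity_exponent_spec[OF diag _ y(1)]])
    then show "(exp (- max_neg_ln R K * D))\<^sup>2 \<le> a" unfolding y(2) by (intro power_mono) auto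
  qed (use nonempty in auto)
  moreover have e: "exp (- max_neg_ln R K * D) ^ 2 = exp (- (2 * max_neg_ln R K * D))"
    by (simp add: power2_eq_square flip: exp_add)
  ultimately have me: "exp (- (2 * max_neg_ln R K * D)) \<le> m" by simp
  then have m: "0 < m" using exp_gt_zero less_le_trans by blast
  have "- (2 * max_neg_ln R K * D) \<le> ln m" using me m by (simp add: ln_ge_iff)
  then show "ln (1 / Min ((\<lambda>x. (\<nu> x * h x)\<^sup>2) ` R))
      \<le> 2 * max_neg_ln R K * real (positivity_exponent R (completed_kernel K R))"
    using m by (simp add: ln_div m_def[symmetric] D_def[symmetric])
  have "m \<le> zeta_soft"
    unfolding zeta_soft_def
  proof (rule Min.boundedI)
    fix a assume "a \<in> (\<lambda>x. \<nu> x * (h x)\<^sup>2) ` R"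
    then obtain x where x: "x \<in> R" "a = \<nu> x * (h x)\<^sup>2" by auto
    have "m \<le> (\<nu> x * h x)\<^sup>2" unfolding m_def by (rule Min_le) (use x in auto)
    also have "\<dots> = \<nu> x * (\<nu> x * (h x)\<^sup>2)" by (simp add: power2_eq_square mult_ac)
    also have "\<dots> \<le> 1 * (\<nu> x * (h x)\<^sup>2)"
      using nu_le_1[OF x(1)] pos[OF x(1)] by (intro mult_right_mono) auto
    finally show "m \<le> a" by (simp add: x)
  qed (use nonempty in auto)
  then show "ln (1 / zeta_soft) \<le> ln (1 / Min ((\<lambda>x. (\<nu> x * h x)\<^sup>2) ` R))"
    using m zeta_soft_pos by (simp add: ln_div m_def[symmetric])
qed

end

section \<open>Local times along a path\<close>

text \<open>Time and path both depend on z: z = (\<omega>, s) gives joint measurability for the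
  integrals over time, z = \<omega> gives the state at a random time.\<close>

lemma process_measurable:
  assumes [measurable]: "\<And>n. \<xi> n \<in> borel_measurable M" "\<And>n. Y n \<in> measurable M (count_space UNIV)"
    and t[measurable]: "t \<in> borel_measurable N" and w[measurable]: "w \<in> measurable N M"
  shows "(\<lambda>z. process \<xi> Y (t z) (w z)) \<in> measurable N (count_space (UNIV :: 'a::finite set))"
proof -
  have [measurable]: "(\<lambda>z. ring_count \<xi> (t z) (w z)) \<in> measurable N (count_space UNIV)"
    unfolding ring_count_def by (rule measurable_card) simp
  show ?thesis unfolding process_def
    by (rule measurable_compose_countable[where f="\<lambda>n z. Y n (w z)" and g="\<lambda>z. ring_count \<xi> (t z) (w z)"])
       measurable
qed

lemma local_time_measurable:
  fixes T :: "'c \<Rightarrow> ennreal" and Y :: "nat \<Rightarrow> 'w \<Rightarrow> 'a::finite"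
  assumes m[measurable]: "\<And>n. \<xi> n \<in> borel_measurable M" "\<And>n. Y n \<in> measurable M (count_space UNIV)"
    and T[measurable]: "T \<in> borel_measurable N" and w[measurable]: "w \<in> measurable N M"
  shows "(\<lambda>z. local_time \<xi> Y A (T z) (w z)) \<in> borel_measurable N"
proof -
  have [measurable]: "(\<lambda>(z, s). process \<xi> Y s (w z)) \<in> measurable (N \<Otimes>\<^sub>M lborel) (count_space UNIV)"
    unfolding case_prod_beta by (rule process_measurable[OF m]) measurable
  have "(\<lambda>(z, s). indicator A (process \<xi> Y s (w z)) * indicator {s. 0 \<le> s \<and> ennreal s \<le> T z} s :: ennreal)
      \<in> borel_measurable (N \<Otimes>\<^sub>M lborel)"
    unfolding indicator_def by measurable
  then show ?thesis
    unfolding local_time_def by (intro lborel.borel_measurable_nn_integral) (simp add: case_prod_beta)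
qed

lemma local_time_mono: "s \<le> t \<Longrightarrow> local_time \<xi> Y A s \<omega> \<le> local_time \<xi> Y A t \<omega>"
  unfolding local_time_def by (intro nn_integral_mono) (auto split: split_indicator)

text \<open>Local time is monotone, so a time witnessing that the infimum is below a can be replaced
  by a slightly larger rational one.\<close>

lemma inv_local_time_measurable:
  fixes T :: "'w \<Rightarrow> ennreal" and Y :: "nat \<Rightarrow> 'w \<Rightarrow> 'a::finite"
  assumes m[measurable]: "\<And>n. \<xi> n \<in> borel_measurable M" "\<And>n. Y n \<in> measurable M (count_space UNIV)"
    and T[measurable]: "T \<in> borel_measurable M"
  shows "(\<lambda>\<omega>. inv_local_time \<xi> Y A (T \<omega>) \<omega>) \<in> borel_measurable M"
proof (rule borel_measurableI_less)
  fix a :: ennreal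
  have [measurable]: "(\<lambda>\<omega>. local_time \<xi> Y A (ennreal (real_of_rat q)) \<omega>) \<in> borel_measurable M" for q
    by (rule local_time_measurable[OF m]) measurable
  have "inv_local_time \<xi> Y A (T \<omega>) \<omega> < a \<longleftrightarrow>
      (\<exists>q. ennreal (real_of_rat q) < a \<and> T \<omega> < local_time \<xi> Y A (ennreal (real_of_rat q)) \<omega>)" for \<omega>
  proof
    assume "inv_local_time \<xi> Y A (T \<omega>) \<omega> < a"
    then obtain s where s: "T \<omega> < local_time \<xi> Y A s \<omega>" "s < a"
      by (auto simp: inv_local_time_def Inf_less_iff)
    obtain q where q: "s < ennreal (real_of_rat q)" "ennreal (real_of_rat q) < a"
      using ennreal_rat_dense[OF s(2)] by blast
    then show "\<exists>q. ennreal (real_of_rat q) < a \<and> T \<omega> < local_time \<xi> Y A (ennreal (real_of_rat q)) \<omega>"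
      using order.strict_trans2[OF s(1) local_time_mono[of s "ennreal (real_of_rat q)" \<xi> Y A \<omega>]]
      by (intro exI[of _ q]) simp
  qed (auto simp: inv_local_time_def Inf_less_iff)
  then show "{\<omega> \<in> space M. inv_local_time \<xi> Y A (T \<omega>) \<omega> < a} \<in> sets M" by simp
qed

lemma trace_process_measurable:
  fixes Y :: "nat \<Rightarrow> 'w \<Rightarrow> 'a::finite"
  assumes m: "\<And>n. \<xi> n \<in> borel_measurable M" "\<And>n. Y n \<in> measurable M (count_space UNIV)"
  shows "(\<lambda>\<omega>. trace_process \<xi> Y A t \<omega>) \<in> measurable M (count_space UNIV)"
proof -
  have [measurable]: "(\<lambda>\<omega>. inv_local_time \<xi> Y A (ennreal t) \<omega>) \<in> borel_measurable M"
    by (rule inv_local_time_measurable[OF m]) measurable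
  show ?thesis unfolding trace_process_def
    by (rule process_measurable[OF m]) measurable
qed

lemma soft_exit_time_measurable:
  fixes Y :: "nat \<Rightarrow> 'w \<Rightarrow> 'a::finite"
  assumes m: "\<And>n. \<xi> n \<in> borel_measurable M" "\<And>n. Y n \<in> measurable M (count_space UNIV)"
    and \<sigma>: "\<sigma> \<in> borel_measurable M"
  shows "(\<lambda>\<omega>. soft_exit_time \<xi> Y \<sigma> A \<omega>) \<in> borel_measurable M"
  unfolding soft_exit_time_def
  by (rule local_time_measurable[OF m inv_local_time_measurable[OF m \<sigma>]]) measurable

text \<open>The state at any time after the first ring is also the state at a ring or at a rational
  time. This holds for all paths, including those with infinitely many rings in finite time.\<close>

lemma ring_count_eq_countable_time:
  assumes t: "\<xi> 0 \<omega> \<le> t" "t < a"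
  shows "\<exists>r. (r \<in> \<rat> \<or> (\<exists>n. r = (\<Sum>i\<le>n. \<xi> i \<omega>))) \<and> \<xi> 0 \<omega> \<le> r \<and> r < a \<and> ring_count \<xi> r \<omega> = ring_count \<xi> t \<omega>"
proof -
  define S where "S n = (\<Sum>i\<le>n. \<xi> i \<omega>)" for n
  define B where "B r = {n. S n \<le> r}" for r
  have rc: "ring_count \<xi> r \<omega> = card (B r)" for r by (simp add: ring_count_def B_def S_def)
  show ?thesis
  proof (cases "\<exists>n. t = S n")
    case True then show ?thesis using t by (auto simp: S_def)
  next
    case notS: False
    show ?thesis
    proof (cases "finite (B t)")
      \<comment> \<open>\<open>card\<close> sends infinite sets to 0, so with infinitely many rings
        up to t every later time has the same count.\<close>
      case False
      obtain r where r: "r \<in> \<rat>" "t < r" "r < a" using Rats_dense_in_real[OF t(2)] by blast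
      have "B t \<subseteq> B r" using r by (auto simp: B_def)
      then have "infinite (B r)" using False finite_subset by blast
      then show ?thesis using False r t by (intro exI[of _ r]) (auto simp: rc)
    next
      case True
      have 0: "0 \<in> B t" using t by (simp add: B_def S_def)
      \<comment> \<open>The last ring before t: the ring count is the same at every time between m
        and t.\<close>
      define m where "m = Max (S ` B t)"
      have "m \<in> S ` B t" unfolding m_def using True 0 by (intro Max_in) auto
      then have "m < t" using notS by (auto simp: B_def less_le)
      then obtain r where r: "r \<in> \<rat>" "m < r" "r < t" using Rats_dense_in_real by blast
      have mle: "n \<in> B t \<Longrightarrow> S n \<le> m" for n unfolding m_def using True by (intro Max_ge) auto
      have "B r = B t" using r mle by (force simp: B_def)
      moreover have "\<xi> 0 \<omega> \<le> r" using mle[OF 0] r by (simp add: S_def)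
      ultimately show ?thesis using r t by (intro exI[of _ r]) (auto simp: rc)
    qed
  qed
qed

text \<open>The set under the infimum is uncountable; \<open>ring_count_eq_countable_time\<close>
  replaces its elements by rationals and ring times without leaving the range below a.\<close>

lemma return_time_measurable:
  fixes Y :: "nat \<Rightarrow> 'w \<Rightarrow> 'a::finite"
  assumes m[measurable]: "\<And>n. \<xi> n \<in> borel_measurable M" "\<And>n. Y n \<in> measurable M (count_space UNIV)"
  shows "(\<lambda>\<omega>. return_time \<xi> Y A \<omega>) \<in> borel_measurable M"
proof (rule borel_measurableI_less)
  fix a :: ennreal
  have [measurable]: "(\<lambda>\<omega>. process \<xi> Y (\<Sum>i\<le>n. \<xi> i \<omega>) \<omega>) \<in> measurable M (count_space UNIV)" for n
    by (rule process_measurable[OF m]) measurable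
  have [measurable]: "(\<lambda>\<omega>. process \<xi> Y r \<omega>) \<in> measurable M (count_space UNIV)" for r
    by (rule process_measurable[OF m]) measurable
  have "return_time \<xi> Y A \<omega> < a \<longleftrightarrow>
     (\<exists>q. \<xi> 0 \<omega> \<le> real_of_rat q \<and> ennreal (real_of_rat q) < a \<and> process \<xi> Y (real_of_rat q) \<omega> \<in> A) \<or>
     (\<exists>n. \<xi> 0 \<omega> \<le> (\<Sum>i\<le>n. \<xi> i \<omega>) \<and> ennreal (\<Sum>i\<le>n. \<xi> i \<omega>) < a \<and> process \<xi> Y (\<Sum>i\<le>n. \<xi> i \<omega>) \<omega> \<in> A)"
    (is "_ \<longleftrightarrow> ?rhs") for \<omega>
  proof
    assume "return_time \<xi> Y A \<omega> < a"
    then obtain t where t: "\<xi> 0 \<omega> \<le> t" "process \<xi> Y t \<omega> \<in> A" "ennreal t < a"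
      by (auto simp: return_time_def Inf_less_iff)
    \<comment> \<open>A real threshold in place of a; negative r do no harm, as
      \<open>ennreal\<close> sends them to 0 and a is positive.\<close>
    obtain b where b: "t < b" "\<And>r. r < b \<Longrightarrow> ennreal r < a"
    proof (cases a)
      case (real a')
      have "t < a'" using t(3) real ennreal_leI[of a' t] by (auto simp: not_less[symmetric])
      moreover have "0 < a'" using t(3) real by (cases "a' = 0") auto
      ultimately show ?thesis using real by (intro that[of a']) (auto intro: ennreal_lessI)
    next
      case top
      then show ?thesis using that[of "t + 1"] by simp
    qed
    obtain r where r: "r \<in> \<rat> \<or> (\<exists>n. r = (\<Sum>i\<le>n. \<xi> i \<omega>))" "\<xi> 0 \<omega> \<le> r" "r < b"
      "ring_count \<xi> r \<omega> = ring_count \<xi> t \<omega>"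
      using ring_count_eq_countable_time[of \<xi> \<omega>, OF t(1) b(1)] by blast
    have "process \<xi> Y r \<omega> \<in> A" "ennreal r < a" using t r b(2) by (auto simp: process_def)
    then show ?rhs using r by (auto simp: Rats_def)
  qed (auto simp: return_time_def Inf_less_iff)
  then show "{\<omega> \<in> space M. return_time \<xi> Y A \<omega> < a} \<in> sets M" by simp
qed

text \<open>The sum stops before n, whereas \<open>ring_count\<close> sums up to n:
  \<open>Y n\<close> is the state on the half-open interval from \<open>arrival\<close> at n to
  \<open>arrival\<close> at n + 1, and \<open>arrival\<close> at 0 is 0.\<close>

definition arrival :: "(nat \<Rightarrow> 'w \<Rightarrow> real) \<Rightarrow> nat \<Rightarrow> 'w \<Rightarrow> real" where
  "arrival \<xi> n \<omega> = (\<Sum>i<n. \<xi> i \<omega>)"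

definition occupation :: "(nat \<Rightarrow> 'w \<Rightarrow> real) \<Rightarrow> (nat \<Rightarrow> 'w \<Rightarrow> 'a) \<Rightarrow> 'a set \<Rightarrow> nat \<Rightarrow> 'w \<Rightarrow> real" where
  "occupation \<xi> Y A n \<omega> = (\<Sum>i<n. if Y i \<omega> \<in> A then \<xi> i \<omega> else 0)"

text \<open>One path outside the exceptional null set; the statements of this locale are
  deterministic and are transferred by \<open>AE_regular\<close>.\<close>

locale regular_clock =
  fixes \<xi> :: "nat \<Rightarrow> 'w \<Rightarrow> real" and Y :: "nat \<Rightarrow> 'w \<Rightarrow> 'a::finite" and \<omega> :: 'w
  assumes gap_pos: "0 < \<xi> n \<omega>" and diverges: "\<exists>n. t < arrival \<xi> n \<omega>"
begin

lemma arrival_0: "arrival \<xi> 0 \<omega> = 0" by (simp add: arrival_def)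
lemma arrival_Suc: "arrival \<xi> (Suc n) \<omega> = arrival \<xi> n \<omega> + \<xi> n \<omega>" by (simp add: arrival_def)

lemma arrival_strict_mono: "strict_mono (\<lambda>n. arrival \<xi> n \<omega>)"
  by (rule strict_monoI_Suc) (simp add: arrival_Suc gap_pos)

lemma arrival_le_iff: "arrival \<xi> m \<omega> \<le> arrival \<xi> n \<omega> \<longleftrightarrow> m \<le> n"
  using strict_mono_less_eq[OF arrival_strict_mono] .

lemma arrival_nonneg: "0 \<le> arrival \<xi> n \<omega>"
  using arrival_le_iff[of 0 n] by (simp add: arrival_0)

lemma ring_count_eq:
  assumes "arrival \<xi> n \<omega> \<le> t" "t < arrival \<xi> (Suc n) \<omega>"
  shows "ring_count \<xi> t \<omega> = n"
proof -
  have "{m. (\<Sum>i\<le>m. \<xi> i \<omega>) \<le> t} = {..<n}"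
  proof (rule subset_antisym; rule subsetI; simp)
    fix m assume "(\<Sum>i\<le>m. \<xi> i \<omega>) \<le> t"
    then have "arrival \<xi> (Suc m) \<omega> < arrival \<xi> (Suc n) \<omega>"
      using assms by (simp add: arrival_def lessThan_Suc_atMost)
    then show "m < n" using strict_mono_less[OF arrival_strict_mono] by simp
  next
    fix m assume "m < n"
    then have "arrival \<xi> (Suc m) \<omega> \<le> arrival \<xi> n \<omega>" by (simp add: arrival_le_iff)
    then show "(\<Sum>i\<le>m. \<xi> i \<omega>) \<le> t" using assms by (simp add: arrival_def lessThan_Suc_atMost)
  qed
  then show ?thesis by (simp add: ring_count_def)
qed

lemma process_eq: "arrival \<xi> n \<omega> \<le> t \<Longrightarrow> t < arrival \<xi> (Suc n) \<omega> \<Longrightarrow> process \<xi> Y t \<omega> = Y n \<omega>"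
  by (simp add: process_def ring_count_eq)

lemma ex_interval:
  assumes "0 \<le> t"
  shows "\<exists>n. arrival \<xi> n \<omega> \<le> t \<and> t < arrival \<xi> (Suc n) \<omega>"
proof -
  define n where "n = (LEAST n. t < arrival \<xi> n \<omega>)"
  have n: "t < arrival \<xi> n \<omega>" unfolding n_def using diverges by (rule LeastI_ex)
  then obtain m where m: "n = Suc m" using assms arrival_0 by (cases n) auto
  have "\<not> t < arrival \<xi> m \<omega>" using not_less_Least[of m "\<lambda>n. t < arrival \<xi> n \<omega>"] m n_def by auto
  then show ?thesis using n m by (intro exI[of _ m]) auto
qed

lemma path_measurable[measurable]: "(\<lambda>s. process \<xi> Y s \<omega>) \<in> measurable lborel (count_space UNIV)"
  by (rule process_measurable[where M="count_space UNIV"]) auto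

lemma occupation_Suc: "occupation \<xi> Y A (Suc n) \<omega> = occupation \<xi> Y A n \<omega> + (if Y n \<omega> \<in> A then \<xi> n \<omega> else 0)"
  by (simp add: occupation_def)

lemma occupation_nonneg: "0 \<le> occupation \<xi> Y A n \<omega>"
  unfolding occupation_def by (intro sum_nonneg) (simp add: less_imp_le[OF gap_pos])

lemma occupation_mono: "m \<le> n \<Longrightarrow> occupation \<xi> Y A m \<omega> \<le> occupation \<xi> Y A n \<omega>"
  by (rule lift_Suc_mono_le[of "\<lambda>n. occupation \<xi> Y A n \<omega>"]) (simp_all add: occupation_Suc less_imp_le[OF gap_pos])

lemma integral_within_interval:
  assumes "0 \<le> u" "u \<le> \<xi> n \<omega>"
  shows "(\<integral>\<^sup>+ s. indicator A (process \<xi> Y s \<omega>) * indicator {arrival \<xi> n \<omega>..<arrival \<xi> n \<omega> + u} s \<partial>lborel)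
    = ennreal (if Y n \<omega> \<in> A then u else 0)"
proof -
  have "(\<integral>\<^sup>+ s. indicator A (process \<xi> Y s \<omega>) * indicator {arrival \<xi> n \<omega>..<arrival \<xi> n \<omega> + u} s \<partial>lborel)
      = (\<integral>\<^sup>+ s. indicator A (Y n \<omega>) * indicator {arrival \<xi> n \<omega>..<arrival \<xi> n \<omega> + u} s \<partial>lborel)"
    using assms by (intro nn_integral_cong) (auto simp: arrival_Suc process_eq split: split_indicator)
  also have "\<dots> = indicator A (Y n \<omega>) * ennreal u"
    using assms by (subst nn_integral_cmult_indicator) auto
  finally show ?thesis by (simp add: indicator_def)
qed

lemma integral_upto_arrival:
  "(\<integral>\<^sup>+ s. indicator A (process \<xi> Y s \<omega>) * indicator {0..<arrival \<xi> n \<omega>} s \<partial>lborel)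
    = ennreal (occupation \<xi> Y A n \<omega>)"
proof (induction n)
  case 0
  then show ?case by (simp add: arrival_0 occupation_def)
next
  case (Suc n)
  have "(\<integral>\<^sup>+ s. indicator A (process \<xi> Y s \<omega>) * indicator {0..<arrival \<xi> (Suc n) \<omega>} s \<partial>lborel)
    = (\<integral>\<^sup>+ s. indicator A (process \<xi> Y s \<omega>) * indicator {0..<arrival \<xi> n \<omega>} s
        + indicator A (process \<xi> Y s \<omega>) * indicator {arrival \<xi> n \<omega>..<arrival \<xi> n \<omega> + \<xi> n \<omega>} s \<partial>lborel)"
    using arrival_nonneg[of n] gap_pos[of n]
    by (intro nn_integral_cong) (auto simp: arrival_Suc split: split_indicator)
  also have "\<dots> = ennreal (occupation \<xi> Y A n \<omega>) + ennreal (if Y n \<omega> \<in> A then \<xi> n \<omega> else 0)"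
    using gap_pos[of n] by (subst nn_integral_add) (auto simp: Suc integral_within_interval)
  also have "\<dots> = ennreal (occupation \<xi> Y A (Suc n) \<omega>)"
    using gap_pos[of n] occupation_nonneg[of A n] by (simp add: occupation_Suc)
  finally show ?case .
qed

lemma local_time_eq:
  assumes "0 \<le> u" "u \<le> \<xi> n \<omega>"
  shows "local_time \<xi> Y A (ennreal (arrival \<xi> n \<omega> + u)) \<omega> = ennreal (occupation \<xi> Y A n \<omega> + (if Y n \<omega> \<in> A then u else 0))"
proof -
  let ?r = "arrival \<xi> n \<omega> + u"
  have r: "0 \<le> ?r" using arrival_nonneg[of n] assms by simp
  have "local_time \<xi> Y A (ennreal ?r) \<omega> = (\<integral>\<^sup>+ s. indicator A (process \<xi> Y s \<omega>) * indicator {0..<arrival \<xi> n \<omega>} s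
        + indicator A (process \<xi> Y s \<omega>) * indicator {arrival \<xi> n \<omega>..<arrival \<xi> n \<omega> + u} s \<partial>lborel)"
    unfolding local_time_def
  proof (rule nn_integral_cong_AE)
    show "AE s in lborel. indicator A (process \<xi> Y s \<omega>) * indicator {s. 0 \<le> s \<and> ennreal s \<le> ennreal ?r} s
       = indicator A (process \<xi> Y s \<omega>) * indicator {0..<arrival \<xi> n \<omega>} s
        + indicator A (process \<xi> Y s \<omega>) * (indicator {arrival \<xi> n \<omega>..<arrival \<xi> n \<omega> + u} s :: ennreal)"
      \<comment> \<open>The closed time interval of \<open>local_time\<close> and the half-open
        pieces differ only at the endpoint.\<close>
      using AE_lborel_singleton[of ?r]
    proof eventually_elim
      case (elim s)
      then show ?case using r arrival_nonneg[of n] assms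
        by (auto simp: ennreal_le_iff[OF r] simp del: ennreal_plus split: split_indicator)
    qed
  qed
  also have "\<dots> = ennreal (occupation \<xi> Y A n \<omega>) + ennreal (if Y n \<omega> \<in> A then u else 0)"
    by (subst nn_integral_add) (auto simp: integral_upto_arrival integral_within_interval assms)
  finally show ?thesis using assms occupation_nonneg[of A n] by simp
qed

lemma local_time_arrival: "local_time \<xi> Y A (ennreal (arrival \<xi> n \<omega>)) \<omega> = ennreal (occupation \<xi> Y A n \<omega>)"
  using local_time_eq[of 0 n A] gap_pos[of n] by simp

text \<open>Monotone convergence along the arrivals. T may be \<infinity>, as it is for the inverse
  local time at an infinite \<sigma>.\<close>

lemma local_time_bounded:
  assumes "\<And>n. occupation \<xi> Y A n \<omega> \<le> c"
  shows "local_time \<xi> Y A T \<omega> \<le> ennreal c"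
proof -
  have "local_time \<xi> Y A T \<omega> \<le> (\<integral>\<^sup>+ s. (SUP n. indicator A (process \<xi> Y s \<omega>) * indicator {0..<arrival \<xi> n \<omega>} s) \<partial>lborel)"
    unfolding local_time_def
  proof (rule nn_integral_mono)
    fix s
    show "indicator A (process \<xi> Y s \<omega>) * indicator {s. 0 \<le> s \<and> ennreal s \<le> T} s
      \<le> (SUP n. indicator A (process \<xi> Y s \<omega>) * indicator {0..<arrival \<xi> n \<omega>} s :: ennreal)"
    proof (cases "0 \<le> s")
      case True
      obtain n where "s < arrival \<xi> n \<omega>" using diverges by blast
      then have "indicator A (process \<xi> Y s \<omega>) * indicator {s. 0 \<le> s \<and> ennreal s \<le> T} s
         \<le> indicator A (process \<xi> Y s \<omega>) * (indicator {0..<arrival \<xi> n \<omega>} s :: ennreal)"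
        using True by (auto split: split_indicator)
      also have "\<dots> \<le> (SUP n. indicator A (process \<xi> Y s \<omega>) * indicator {0..<arrival \<xi> n \<omega>} s)"
        by (rule SUP_upper) simp
      finally show ?thesis .
    qed simp
  qed
  also have "\<dots> = (SUP n. \<integral>\<^sup>+ s. indicator A (process \<xi> Y s \<omega>) * indicator {0..<arrival \<xi> n \<omega>} s \<partial>lborel)"
  proof (rule nn_integral_monotone_convergence_SUP)
    show "incseq (\<lambda>n s. indicator A (process \<xi> Y s \<omega>) * (indicator {0..<arrival \<xi> n \<omega>} s :: ennreal))"
      using arrival_le_iff
      by (intro monoI le_funI) (auto split: split_indicator dest: order_less_le_trans)
  qed measurable
  also have "\<dots> \<le> ennreal c"
    unfolding integral_upto_arrival by (intro SUP_least ennreal_leI assms)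
  finally show ?thesis .
qed

section \<open>The visit to R during which the local time passes t\<close>

context
  fixes R :: "'a set" and n :: nat and t :: real
  assumes Yn: "Y n \<omega> \<in> R" and t: "occupation \<xi> Y R n \<omega> \<le> t" "t < occupation \<xi> Y R n \<omega> + \<xi> n \<omega>"
begin

text \<open>During step n the local time in R runs at unit speed and equals t exactly at the claimed
  time. The infimum asks for strictly larger local time, so it is approached from later
  times.\<close>

lemma inv_local_time_eq:
  "inv_local_time \<xi> Y R (ennreal t) \<omega> = ennreal (arrival \<xi> n \<omega> + (t - occupation \<xi> Y R n \<omega>))"
proof (rule antisym)
  let ?s0 = "arrival \<xi> n \<omega> + (t - occupation \<xi> Y R n \<omega>)"
  have t0: "0 \<le> t" using t occupation_nonneg order_trans by blast
  have s0: "0 \<le> ?s0" using t arrival_nonneg[of n] by simp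
  show "inv_local_time \<xi> Y R (ennreal t) \<omega> \<le> ennreal ?s0"
  proof (rule dense_ge)
    fix y assume y: "ennreal ?s0 < y"
    \<comment> \<open>Cut at the end of step n so that \<open>local_time_eq\<close> applies.\<close>
    define s where "s = min y (ennreal (arrival \<xi> (Suc n) \<omega>))"
    have "ennreal ?s0 < ennreal (arrival \<xi> (Suc n) \<omega>)"
      using s0 t by (simp add: ennreal_less_iff arrival_Suc)
    then have s: "ennreal ?s0 < s" "s \<le> y" "s \<le> ennreal (arrival \<xi> (Suc n) \<omega>)" using y by (auto simp: s_def)
    obtain r where r: "s = ennreal r" "0 \<le> r" using s(3) by (cases s) (auto simp: top_unique)
    have r1: "?s0 < r" "r \<le> arrival \<xi> (Suc n) \<omega>"
      using s r s0 by (auto simp: ennreal_less_iff arrival_nonneg)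
    have "local_time \<xi> Y R (ennreal (arrival \<xi> n \<omega> + (r - arrival \<xi> n \<omega>))) \<omega>
        = ennreal (occupation \<xi> Y R n \<omega> + (r - arrival \<xi> n \<omega>))"
      using r1 t Yn by (subst local_time_eq) (auto simp: arrival_Suc)
    then have "ennreal t < local_time \<xi> Y R s \<omega>" using r r1 t0 by (simp add: ennreal_less_iff)
    then have "inv_local_time \<xi> Y R (ennreal t) \<omega> \<le> s" unfolding inv_local_time_def by (intro Inf_lower) simp
    then show "inv_local_time \<xi> Y R (ennreal t) \<omega> \<le> y" using s(2) by simp
  qed
  have lt: "local_time \<xi> Y R (ennreal ?s0) \<omega> = ennreal t" using t Yn by (subst local_time_eq) auto
  show "ennreal ?s0 \<le> inv_local_time \<xi> Y R (ennreal t) \<omega>"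
    unfolding inv_local_time_def
  proof (rule Inf_greatest)
    fix s assume "s \<in> {s. ennreal t < local_time \<xi> Y R s \<omega>}"
    then have "\<not> local_time \<xi> Y R s \<omega> \<le> local_time \<xi> Y R (ennreal ?s0) \<omega>" unfolding lt by simp
    then show "ennreal ?s0 \<le> s" using local_time_mono[of s "ennreal ?s0"] by (meson linear)
  qed
qed

lemma trace_process_eq: "trace_process \<xi> Y R t \<omega> = Y n \<omega>"
  unfolding trace_process_def inv_local_time_eq
  using t arrival_nonneg[of n] by (subst enn2real_ennreal) (auto simp: arrival_Suc intro!: process_eq)

text \<open>The local time outside R stands still during step n. If it does not exceed \<sigma>, the
  inverse local time lies at or after the end of the step, where the local time in R is beyond t;
  otherwise it lies at or before the start, where that local time is at most t. Equality means
  survival because the inverse is taken with a strict inequality.\<close>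

lemma soft_exit_time_iff:
  "ennreal t < soft_exit_time \<xi> Y \<sigma> R \<omega> \<longleftrightarrow> ennreal (occupation \<xi> Y (- R) n \<omega>) \<le> \<sigma> \<omega>"
proof
  have t0: "0 \<le> t" using t occupation_nonneg order_trans by blast
  assume \<sigma>: "ennreal (occupation \<xi> Y (- R) n \<omega>) \<le> \<sigma> \<omega>"
  have "local_time \<xi> Y (- R) (ennreal (arrival \<xi> (Suc n) \<omega>)) \<omega> \<le> \<sigma> \<omega>"
    using \<sigma> Yn by (simp add: local_time_arrival occupation_Suc)
  then have "ennreal (arrival \<xi> (Suc n) \<omega>) \<le> inv_local_time \<xi> Y (- R) (\<sigma> \<omega>) \<omega>"
    unfolding inv_local_time_def
    by (intro Inf_greatest) (metis (mono_tags, lifting) linear local_time_mono mem_Collect_eq not_le order_trans)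
  from local_time_mono[OF this, of \<xi> Y R \<omega>]
  have "ennreal (occupation \<xi> Y R (Suc n) \<omega>) \<le> soft_exit_time \<xi> Y \<sigma> R \<omega>"
    by (simp add: local_time_arrival soft_exit_time_def)
  moreover have "ennreal t < ennreal (occupation \<xi> Y R (Suc n) \<omega>)"
    using t t0 Yn by (simp add: occupation_Suc ennreal_less_iff)
  ultimately show "ennreal t < soft_exit_time \<xi> Y \<sigma> R \<omega>" by simp
next
  assume *: "ennreal t < soft_exit_time \<xi> Y \<sigma> R \<omega>"
  show "ennreal (occupation \<xi> Y (- R) n \<omega>) \<le> \<sigma> \<omega>"
  proof (rule ccontr)
    assume "\<not> ?thesis"
    then have "\<sigma> \<omega> < local_time \<xi> Y (- R) (ennreal (arrival \<xi> n \<omega>)) \<omega>" by (simp add: local_time_arrival)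
    then have "inv_local_time \<xi> Y (- R) (\<sigma> \<omega>) \<omega> \<le> ennreal (arrival \<xi> n \<omega>)"
      unfolding inv_local_time_def by (intro Inf_lower) simp
    from local_time_mono[OF this, of \<xi> Y R \<omega>]
    have "soft_exit_time \<xi> Y \<sigma> R \<omega> \<le> ennreal (occupation \<xi> Y R n \<omega>)"
      by (simp add: local_time_arrival soft_exit_time_def)
    also have "\<dots> \<le> ennreal t" using t by (simp add: ennreal_leI)
    finally show False using * by simp
  qed
qed

end

text \<open>Were the local time in R bounded by t, so would be the soft exit time. The first step
  that pushes the occupation beyond t must be a step in R.\<close>

lemma soft_exit_time_visit:
  assumes t: "0 \<le> t" and *: "ennreal t < soft_exit_time \<xi> Y \<sigma> R \<omega>"
  shows "\<exists>n. Y n \<omega> \<in> R \<and> occupation \<xi> Y R n \<omega> \<le> t \<and> t < occupation \<xi> Y R n \<omega> + \<xi> n \<omega>"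
proof -
  have ex: "\<exists>n. t < occupation \<xi> Y R n \<omega>"
  proof (rule ccontr)
    assume "\<not> ?thesis"
    then have "soft_exit_time \<xi> Y \<sigma> R \<omega> \<le> ennreal t"
      unfolding soft_exit_time_def by (intro local_time_bounded) (simp add: not_less)
    then show False using * by simp
  qed
  define n where "n = (LEAST n. t < occupation \<xi> Y R n \<omega>)"
  have n: "t < occupation \<xi> Y R n \<omega>" unfolding n_def using ex by (rule LeastI_ex)
  then obtain m where m: "n = Suc m" using t by (cases n) (auto simp: occupation_def)
  have "\<not> t < occupation \<xi> Y R m \<omega>" using not_less_Least[of m "\<lambda>n. t < occupation \<xi> Y R n \<omega>"] m n_def by auto
  then show ?thesis using n m by (intro exI[of _ m]) (auto simp: occupation_Suc split: if_splits)
qed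

lemma visit_unique:
  assumes "occupation \<xi> Y R m \<omega> \<le> t" "t < occupation \<xi> Y R m \<omega> + \<xi> m \<omega>" "Y m \<omega> \<in> R"
    and "occupation \<xi> Y R n \<omega> \<le> t" "t < occupation \<xi> Y R n \<omega> + \<xi> n \<omega>" "Y n \<omega> \<in> R"
  shows "m = n"
proof -
  have "\<not> m < n" if "occupation \<xi> Y R m \<omega> \<le> t" "t < occupation \<xi> Y R m \<omega> + \<xi> m \<omega>" "Y m \<omega> \<in> R"
    "occupation \<xi> Y R n \<omega> \<le> t" for m n
  proof
    assume "m < n"
    then have "occupation \<xi> Y R (Suc m) \<omega> \<le> occupation \<xi> Y R n \<omega>" by (intro occupation_mono) simp
    then show False using that by (simp add: occupation_Suc)
  qed
  from this[of m n] this[of n m] assms show ?thesis by simp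
qed

section \<open>The first return to R\<close>

context
  fixes R :: "'a set" and n :: nat
  assumes n: "1 \<le> n" and Yn: "Y n \<omega> \<in> R" and before: "\<And>i. 1 \<le> i \<Longrightarrow> i < n \<Longrightarrow> Y i \<omega> \<notin> R"
begin

lemma return_time_eq: "return_time \<xi> Y R \<omega> = ennreal (arrival \<xi> n \<omega>)"
proof (rule antisym)
  have a1: "\<xi> 0 \<omega> = arrival \<xi> 1 \<omega>" by (simp add: arrival_def)
  have "process \<xi> Y (arrival \<xi> n \<omega>) \<omega> = Y n \<omega>" using gap_pos[of n] by (intro process_eq) (auto simp: arrival_Suc)
  then show "return_time \<xi> Y R \<omega> \<le> ennreal (arrival \<xi> n \<omega>)"
    unfolding return_time_def a1 using n Yn
    by (intro Inf_lower) (auto simp: arrival_le_iff intro!: exI[of _ "arrival \<xi> n \<omega>"])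
  show "ennreal (arrival \<xi> n \<omega>) \<le> return_time \<xi> Y R \<omega>"
    unfolding return_time_def
  proof (rule Inf_greatest, clarify)
    fix t assume t: "\<xi> 0 \<omega> \<le> t" "process \<xi> Y t \<omega> \<in> R"
    then have "0 \<le> t" using gap_pos[of 0] by linarith
    then obtain m where m: "arrival \<xi> m \<omega> \<le> t" "t < arrival \<xi> (Suc m) \<omega>" using ex_interval by blast
    have "arrival \<xi> 1 \<omega> < arrival \<xi> (Suc m) \<omega>" using t(1) m(2) a1 by linarith
    then have "1 \<le> m" using strict_mono_less[OF arrival_strict_mono] by simp
    moreover have "Y m \<omega> \<in> R" using t(2) process_eq[OF m] by simp
    ultimately have "n \<le> m" using before by (meson not_less)
    then have "arrival \<xi> n \<omega> \<le> t" using m(1) arrival_le_iff order_trans by blast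
    then show "ennreal (arrival \<xi> n \<omega>) \<le> ennreal t" by (rule ennreal_leI)
  qed
qed

lemma process_return_time: "process \<xi> Y (enn2real (return_time \<xi> Y R \<omega>)) \<omega> = Y n \<omega>"
  unfolding return_time_eq using gap_pos[of n]
  by (simp add: arrival_nonneg process_eq arrival_Suc)

lemma local_time_return_time:
  "local_time \<xi> Y (- R) (return_time \<xi> Y R \<omega>) \<omega> = ennreal (occupation \<xi> Y (- R) n \<omega>)"
  unfolding return_time_eq by (rule local_time_arrival)

end

end

section \<open>Sums over paths\<close>

text \<open>As a weight for \<open>weighted_paths\<close> it selects the paths with exactly k steps
  that start in R.\<close>

definition kronecker :: "nat \<Rightarrow> nat \<Rightarrow> real" where
  "kronecker k a = (if a = k then 1 else 0)"

text \<open>The sum over all paths of \<open>n\<close> steps from \<open>x\<close> to \<open>y\<close> of the path probability, times \<open>q\<close> for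
  every step that starts outside \<open>R\<close>, times \<open>g\<close> of the number of steps that start in \<open>R\<close>.\<close>

primrec weighted_paths ::
    "('a::finite \<Rightarrow> 'a \<Rightarrow> real) \<Rightarrow> 'a set \<Rightarrow> real \<Rightarrow> 'a \<Rightarrow> nat \<Rightarrow> 'a \<Rightarrow> (nat \<Rightarrow> real) \<Rightarrow> real" where
  "weighted_paths p R q y 0 x g = (if x = y then g 0 else 0)"
| "weighted_paths p R q y (Suc n) x g =
     (if x \<in> R then \<Sum>z\<in>UNIV. p x z * weighted_paths p R q y n z (\<lambda>a. g (Suc a))
      else q * (\<Sum>z\<in>UNIV. p x z * weighted_paths p R q y n z g))"

lemma card_less_Suc_shift:
  "card {i. i < Suc n \<and> Q i} = (if Q 0 then 1 else 0) + card {i. i < n \<and> Q (Suc i)}"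
proof -
  have "{i. i < Suc n \<and> Q i} = {i. i = 0 \<and> Q 0} \<union> Suc ` {i. i < n \<and> Q (Suc i)}"
    by (auto simp: less_Suc_eq_0_disj)
  also have "card \<dots> = card {i. i = (0::nat) \<and> Q 0} + card (Suc ` {i. i < n \<and> Q (Suc i)})"
    by (rule card_Un_disjoint) auto
  also have "card (Suc ` {i. i < n \<and> Q (Suc i)}) = card {i. i < n \<and> Q (Suc i)}"
    by (rule card_image) simp
  finally show ?thesis by (cases "Q 0") auto
qed

text \<open>The recursion serves the algebra of path sums; the explicit sum over lists is the form
  in which the law of the chain delivers them.\<close>

lemma weighted_paths_eq_sum:
  "weighted_paths p R q y n x g =
    (\<Sum>xs\<in>{xs. length xs = Suc n \<and> hd xs = x \<and> last xs = y}.
       (\<Prod>i<n. p (xs ! i) (xs ! Suc i)) * q ^ card {i. i < n \<and> xs ! i \<notin> R} * g (card {i. i < n \<and> xs ! i \<in> R}))"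
proof (induction n arbitrary: x g)
  case 0
  have "{xs. length xs = Suc 0 \<and> hd xs = x \<and> last xs = y} = (if x = y then {[x]} else {})"
    by (auto simp: length_Suc_conv)
  then show ?case by simp
next
  case (Suc n)
  let ?L = "\<lambda>n x. {xs. length xs = Suc n \<and> hd xs = x \<and> last xs = y}"
  let ?F = "\<lambda>n g xs. (\<Prod>i<n. p (xs ! i) (xs ! Suc i)) * q ^ card {i. i < n \<and> xs ! i \<notin> R} * g (card {i. i < n \<and> xs ! i \<in> R})"
  have L: "?L (Suc n) x = (\<Union>z. (#) x ` ?L n z)"
  proof (rule subset_antisym; rule subsetI)
    fix xs assume "xs \<in> ?L (Suc n) x"
    then obtain zs where zs: "xs = x # zs" "length zs = Suc n" "last xs = y" by (cases xs) auto
    then have "zs \<noteq> []" by auto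
    then have "zs \<in> ?L n (hd zs)" using zs by auto
    then show "xs \<in> (\<Union>z. (#) x ` ?L n z)" using zs by auto
  next
    fix xs assume "xs \<in> (\<Union>z. (#) x ` ?L n z)"
    then obtain zs where zs: "xs = x # zs" "length zs = Suc n" "last zs = y" by auto
    then have "zs \<noteq> []" by auto
    then show "xs \<in> ?L (Suc n) x" using zs by auto
  qed
  have fin: "finite (?L n z)" for n z
    by (rule finite_subset[OF _ finite_lists_length_eq[of UNIV "Suc n"]]) auto
  have "(\<Sum>xs\<in>?L (Suc n) x. ?F (Suc n) g xs) = (\<Sum>z\<in>UNIV. \<Sum>xs\<in>(#) x ` ?L n z. ?F (Suc n) g xs)"
    unfolding L by (rule sum.UNION_disjoint) (auto simp: fin)
  also have "\<dots> = (\<Sum>z\<in>UNIV. \<Sum>zs\<in>?L n z. ?F (Suc n) g (x # zs))"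
    by (intro sum.cong refl sum.reindex_cong[OF _ refl]) auto
  also have "\<dots> = (\<Sum>z\<in>UNIV. \<Sum>zs\<in>?L n z. p x z * (if x \<in> R then ?F n (\<lambda>a. g (Suc a)) zs else q * ?F n g zs))"
  proof (intro sum.cong refl)
    fix z zs assume "zs \<in> ?L n z"
    then have "zs ! 0 = z" by (cases zs) auto
    then have "(\<Prod>i<Suc n. p ((x # zs) ! i) ((x # zs) ! Suc i)) = p x z * (\<Prod>i<n. p (zs ! i) (zs ! Suc i))"
      by (subst prod.lessThan_Suc_shift) simp
    then show "?F (Suc n) g (x # zs) = p x z * (if x \<in> R then ?F n (\<lambda>a. g (Suc a)) zs else q * ?F n g zs)"
      by (simp add: card_less_Suc_shift)
  qed
  also have "\<dots> = weighted_paths p R q y (Suc n) x g"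
    by (simp add: Suc sum_distrib_left mult_ac)
  finally show ?case by simp
qed

lemma weighted_paths_zero: "weighted_paths p R q y n x (\<lambda>_. 0) = 0"
  by (induction n arbitrary: x) auto

lemma kronecker_Suc_Suc: "(\<lambda>a. kronecker (Suc k) (Suc a)) = kronecker k"
  by (auto simp: kronecker_def)

lemma kronecker_0_Suc: "(\<lambda>a. kronecker 0 (Suc a)) = (\<lambda>_. 0)"
  by (auto simp: kronecker_def)

text \<open>Linearity in the weight. The bound N is free because the induction lowers it at a step
  from R and keeps it at a step from outside.\<close>

lemma weighted_paths_expand:
  "n \<le> N \<Longrightarrow> weighted_paths p R q y n x g = (\<Sum>k\<le>N. g k * weighted_paths p R q y n x (kronecker k))"
proof (induction n arbitrary: N x g)
  case 0
  show ?case by (simp add: kronecker_def if_distrib[of "\<lambda>w. _ * w"] cong: if_cong)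
next
  case (Suc n)
  show ?case
  proof (cases "x \<in> R")
    case True
    obtain N' where N': "N = Suc N'" "n \<le> N'" using Suc.prems by (cases N) auto
    have "weighted_paths p R q y (Suc n) x g
        = (\<Sum>z\<in>UNIV. \<Sum>k\<le>N'. p x z * (g (Suc k) * weighted_paths p R q y n z (kronecker k)))"
      using True by (simp add: Suc.IH[OF N'(2), of _ "\<lambda>a. g (Suc a)"] sum_distrib_left)
    also have "\<dots> = (\<Sum>k\<le>N'. \<Sum>z\<in>UNIV. p x z * (g (Suc k) * weighted_paths p R q y n z (kronecker k)))"
      by (rule sum.swap)
    also have "\<dots> = (\<Sum>k\<le>N. g k * weighted_paths p R q y (Suc n) x (kronecker k))"
      using True unfolding N'(1)
      by (subst sum.atMost_Suc_shift)
        (simp add: kronecker_Suc_Suc kronecker_0_Suc weighted_paths_zero sum_distrib_left mult_ac)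
    finally show ?thesis .
  next
    case False
    have "n \<le> N" using Suc.prems by simp
    have "weighted_paths p R q y (Suc n) x g
        = (\<Sum>z\<in>UNIV. \<Sum>k\<le>N. q * (p x z * (g k * weighted_paths p R q y n z (kronecker k))))"
      using False by (simp add: Suc.IH[OF \<open>n \<le> N\<close>, of _ g] sum_distrib_left)
    also have "\<dots> = (\<Sum>k\<le>N. \<Sum>z\<in>UNIV. q * (p x z * (g k * weighted_paths p R q y n z (kronecker k))))"
      by (rule sum.swap)
    also have "\<dots> = (\<Sum>k\<le>N. g k * weighted_paths p R q y (Suc n) x (kronecker k))"
      using False by (simp add: sum_distrib_left mult_ac)
    finally show ?thesis .
  qed
qed

lemma weighted_paths_kronecker_gt: "n < k \<Longrightarrow> weighted_paths p R q y n x (kronecker k) = 0"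
  by (subst weighted_paths_expand[OF order_refl]) (auto simp: kronecker_def)

lemma weighted_paths_nonneg:
  assumes "\<And>x z. 0 \<le> p x z" "0 \<le> q" "\<And>a. 0 \<le> g a"
  shows "0 \<le> weighted_paths p R q y n x g"
  using assms(3) by (induction n arbitrary: x g) (auto intro!: sum_nonneg mult_nonneg_nonneg simp: assms(1,2))

lemma kronecker_nonneg: "0 \<le> kronecker k a"
  by (simp add: kronecker_def)

lemma weighted_paths_in_0: "x \<in> R \<Longrightarrow> weighted_paths p R q y n x (kronecker 0) = (if n = 0 \<and> x = y then 1 else 0)"
  by (cases n) (auto simp: kronecker_0_Suc weighted_paths_zero, auto simp: kronecker_def)

text \<open>The path is cut at its first visit to R, at time m in state w; it exists because the
  endpoint y is in R. Up to the cut no step starts in R, so the whole count falls on the second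
  piece.\<close>

lemma weighted_paths_first_visit:
  assumes y: "y \<in> R"
  shows "weighted_paths p R q y n z g
    = (\<Sum>m\<le>n. \<Sum>w\<in>R. weighted_paths p R q w m z (kronecker 0) * weighted_paths p R q y (n - m) w g)"
proof (induction n arbitrary: z)
  case 0
  show ?case using y by (simp add: kronecker_def if_distrib[of "\<lambda>w. w * _"] cong: if_cong)
next
  case (Suc n)
  show ?case
  proof (cases "z \<in> R")
    case True
    then show ?thesis
      by (simp add: weighted_paths_in_0 if_distrib[of "\<lambda>w. w * _"] sum.atMost_Suc_shift
          del: weighted_paths.simps(2) sum.atMost_Suc cong: if_cong)
  next
    case False
    let ?W = "weighted_paths p R q"
    have "?W y (Suc n) z g
      = (\<Sum>u\<in>UNIV. \<Sum>m\<le>n. \<Sum>w\<in>R. q * (p z u * (?W w m u (kronecker 0) * ?W y (n - m) w g)))"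
      using False by (simp add: Suc[of _] sum_distrib_left)
    also have "\<dots> = (\<Sum>m\<le>n. \<Sum>w\<in>R. \<Sum>u\<in>UNIV. q * (p z u * (?W w m u (kronecker 0) * ?W y (n - m) w g)))"
      by (subst sum.swap) (intro sum.cong refl sum.swap)
    also have "\<dots> = (\<Sum>m\<le>n. \<Sum>w\<in>R. ?W w (Suc m) z (kronecker 0) * ?W y (Suc n - Suc m) w g)"
      using False by (simp add: sum_distrib_left sum_distrib_right mult_ac)
    also have "\<dots> = (\<Sum>m\<le>Suc n. \<Sum>w\<in>R. ?W w m z (kronecker 0) * ?W y (Suc n - m) w g)"
    proof -
      have "(\<Sum>w\<in>R. ?W w 0 z (kronecker 0) * ?W y (Suc n - 0) w g) = 0"
        using False by (intro sum.neutral) auto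
      then show ?thesis by (subst sum.atMost_Suc_shift) simp
    qed
    finally show ?thesis .
  qed
qed

lemma suminf_swap_ennreal:
  fixes f :: "nat \<Rightarrow> nat \<Rightarrow> ennreal"
  shows "(\<Sum>i. \<Sum>j. f i j) = (\<Sum>j. \<Sum>i. f i j)"
proof -
  have "(\<Sum>i. \<Sum>j. f i j) = (\<integral>\<^sup>+ j. (\<Sum>i. f i j) \<partial>count_space UNIV)"
    by (subst nn_integral_suminf) (auto simp: nn_integral_count_space_nat)
  then show ?thesis by (simp add: nn_integral_count_space_nat)
qed

text \<open>Sums in [0,\<infinity>] may be rearranged freely, which is why path series are
  extended-valued until they are recognized as probabilities.\<close>

lemma Cauchy_product_ennreal:
  fixes f :: "nat \<Rightarrow> nat \<Rightarrow> ennreal"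
  shows "(\<Sum>n. \<Sum>m\<le>n. f m (n - m)) = (\<Sum>m. \<Sum>j. f m j)"
proof -
  have "(\<Sum>n. \<Sum>m\<le>n. f m (n - m)) = (\<Sum>n. \<Sum>m. if m \<le> n then f m (n - m) else 0)"
    by (intro suminf_cong, subst suminf_finite[of "{.._}"]) auto
  also have "\<dots> = (\<Sum>m. \<Sum>n. if m \<le> n then f m (n - m) else 0)" by (rule suminf_swap_ennreal)
  also have "\<dots> = (\<Sum>m. \<Sum>j. f m j)"
  proof (rule suminf_cong)
    fix m
    have "(\<Sum>n. if m \<le> n then f m (n - m) else 0)
       = (\<Sum>n. if m \<le> n + m then f m (n + m - m) else 0) + (\<Sum>n<m. if m \<le> n then f m (n - m) else 0)"
      by (rule suminf_offset) (rule summableI)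
    then show "(\<Sum>n. if m \<le> n then f m (n - m) else 0) = (\<Sum>j. f m j)" by simp
  qed
  finally show ?thesis .
qed

locale taboo_paths =
  fixes p :: "'a::finite \<Rightarrow> 'a \<Rightarrow> real" and R :: "'a set" and q :: real
  assumes p_nonneg: "0 \<le> p x z" and q_nonneg: "0 \<le> q"
begin

text \<open>On R, with q = 1/(1 + l), this is the soft kernel for k = 1 and its k-th power in
  general.\<close>

definition path_series :: "nat \<Rightarrow> 'a \<Rightarrow> 'a \<Rightarrow> ennreal" where
  "path_series k x y = (\<Sum>n. ennreal (weighted_paths p R q y n x (kronecker k)))"

lemma weighted_paths_kronecker_nonneg: "0 \<le> weighted_paths p R q y n x (kronecker k)"
  by (intro weighted_paths_nonneg p_nonneg q_nonneg kronecker_nonneg)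

lemma path_series_0: "x \<in> R \<Longrightarrow> path_series 0 x y = (if x = y then 1 else 0)"
  unfolding path_series_def
  by (subst suminf_finite[of "{0}"]) (auto simp: weighted_paths_in_0 kronecker_def)

lemma path_series_first_visit:
  assumes "y \<in> R"
  shows "path_series k z y = (\<Sum>w\<in>R. path_series 0 z w * path_series k w y)"
proof -
  let ?W = "weighted_paths p R q"
  have "path_series k z y = (\<Sum>n. \<Sum>m\<le>n. \<Sum>w\<in>R. ennreal (?W w m z (kronecker 0)) * ennreal (?W y (n - m) w (kronecker k)))"
    unfolding path_series_def
    by (subst weighted_paths_first_visit[OF assms])
      (simp add: sum_ennreal[symmetric] sum_nonneg weighted_paths_kronecker_nonneg ennreal_mult)
  also have "\<dots> = (\<Sum>m. \<Sum>j. \<Sum>w\<in>R. ennreal (?W w m z (kronecker 0)) * ennreal (?W y j w (kronecker k)))"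
    by (rule Cauchy_product_ennreal)
  also have "\<dots> = (\<Sum>w\<in>R. \<Sum>m. \<Sum>j. ennreal (?W w m z (kronecker 0)) * ennreal (?W y j w (kronecker k)))"
    by (simp add: suminf_sum[OF summableI])
  also have "\<dots> = (\<Sum>w\<in>R. path_series 0 z w * path_series k w y)"
    by (simp add: path_series_def ennreal_suminf_cmult ennreal_suminf_multc)
  finally show ?thesis .
qed

lemma path_series_Suc_eq:
  assumes x: "x \<in> R"
  shows "path_series (Suc k) x y = (\<Sum>z\<in>UNIV. ennreal (p x z) * path_series k z y)"
proof -
  let ?W = "weighted_paths p R q"
  have "path_series (Suc k) x y = (\<Sum>n. ennreal (?W y (Suc n) x (kronecker (Suc k))))"
    unfolding path_series_def
    using suminf_offset[of "\<lambda>n. ennreal (?W y n x (kronecker (Suc k)))" 1, OF summableI]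
    by (simp add: kronecker_def)
  also have "\<dots> = (\<Sum>n. \<Sum>z\<in>UNIV. ennreal (p x z) * ennreal (?W y n z (kronecker k)))"
    using x by (simp add: kronecker_Suc_Suc sum_ennreal[symmetric] weighted_paths_kronecker_nonneg p_nonneg ennreal_mult)
  also have "\<dots> = (\<Sum>z\<in>UNIV. ennreal (p x z) * path_series k z y)"
    by (simp add: suminf_sum[OF summableI] path_series_def ennreal_suminf_cmult)
  finally show ?thesis .
qed

text \<open>Cutting at the first return to R leaves one step from R in the first piece and k in the
  second; this is the composition rule that produces powers of the soft kernel.\<close>

lemma path_series_Suc:
  assumes x: "x \<in> R" and y: "y \<in> R"
  shows "path_series (Suc k) x y = (\<Sum>w\<in>R. path_series 1 x w * path_series k w y)"
proof -
  have "path_series (Suc k) x y = (\<Sum>z\<in>UNIV. \<Sum>w\<in>R. ennreal (p x z) * (path_series 0 z w * path_series k w y))"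
    unfolding path_series_Suc_eq[OF x] by (subst path_series_first_visit[OF y]) (simp add: sum_distrib_left)
  also have "\<dots> = (\<Sum>w\<in>R. \<Sum>z\<in>UNIV. ennreal (p x z) * (path_series 0 z w * path_series k w y))"
    by (rule sum.swap)
  also have "\<dots> = (\<Sum>w\<in>R. path_series 1 x w * path_series k w y)"
    unfolding One_nat_def path_series_Suc_eq[OF x, of 0] sum_distrib_right mult.assoc ..
  finally show ?thesis .
qed

lemma path_series_power:
  assumes K: "\<And>x y. x \<in> R \<Longrightarrow> y \<in> R \<Longrightarrow> path_series 1 x y = ennreal (K x y) \<and> 0 \<le> K x y"
    and x: "x \<in> R" and y: "y \<in> R"
  shows "path_series k x y = ennreal ((kernel_op R K ^^ k) (indicator {y}) x) \<and> 0 \<le> (kernel_op R K ^^ k) (indicator {y}) x"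
  using x
proof (induction k arbitrary: x)
  case 0
  then show ?case by (simp add: path_series_0 indicator_def)
next
  case (Suc k)
  have "path_series (Suc k) x y = (\<Sum>w\<in>R. ennreal (K x w) * ennreal ((kernel_op R K ^^ k) (indicator {y}) w))"
    unfolding path_series_Suc[OF Suc.prems y]
    using K[OF Suc.prems] Suc.IH by (intro sum.cong refl) simp
  also have "\<dots> = (\<Sum>w\<in>R. ennreal (K x w * (kernel_op R K ^^ k) (indicator {y}) w))"
    by (intro sum.cong refl ennreal_mult[symmetric]) (simp_all add: K[OF Suc.prems] Suc.IH)
  also have "\<dots> = ennreal (kernel_op R K ((kernel_op R K ^^ k) (indicator {y})) x)"
    unfolding kernel_op_def[of R K "(kernel_op R K ^^ k) (indicator {y})"]
    by (rule sum_ennreal) (simp add: K[OF Suc.prems] Suc.IH)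
  finally have 1: "path_series (Suc k) x y = ennreal (kernel_op R K ((kernel_op R K ^^ k) (indicator {y})) x)" .
  have "0 \<le> kernel_op R K ((kernel_op R K ^^ k) (indicator {y})) x"
    unfolding kernel_op_def[of R K "(kernel_op R K ^^ k) (indicator {y})"]
    by (rule sum_nonneg) (simp add: K[OF Suc.prems] Suc.IH)
  then show ?case using 1 by simp
qed

text \<open>Keeping only the one-step path. This gives p \<le> K on R, the source of the comparisons
  with the restricted process.\<close>

lemma path_series_1_ge: "x \<in> R \<Longrightarrow> ennreal (p x y) \<le> path_series 1 x y"
proof -
  assume x: "x \<in> R"
  have "ennreal (p x y) = ennreal (weighted_paths p R q y 1 x (kronecker 1))"
    using x by (simp add: kronecker_def if_distrib[of "\<lambda>w. _ * w"] cong: if_cong)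
  also have "\<dots> \<le> path_series 1 x y"
    unfolding path_series_def using sum_le_suminf[of "\<lambda>n. ennreal (weighted_paths p R q y n x (kronecker 1))" "{1}"] by (simp add: summableI)
  finally show ?thesis .
qed

lemma weighted_paths_expansion_series:
  assumes "\<And>a. 0 \<le> g a"
  shows "(\<Sum>n. ennreal (weighted_paths p R q y n x g)) = (\<Sum>k. ennreal (g k) * path_series k x y)"
proof -
  let ?W = "weighted_paths p R q"
  have "ennreal (?W y n x g) = (\<Sum>k. ennreal (g k) * ennreal (?W y n x (kronecker k)))" for n
  proof -
    have "ennreal (?W y n x g) = (\<Sum>k\<le>n. ennreal (g k) * ennreal (?W y n x (kronecker k)))"
      by (subst weighted_paths_expand[OF order_refl])
        (simp add: sum_ennreal[symmetric] assms weighted_paths_kronecker_nonneg ennreal_mult)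
    then show ?thesis
      by (subst suminf_finite[of "{..n}"]) (auto simp: weighted_paths_kronecker_gt not_le)
  qed
  then have "(\<Sum>n. ennreal (?W y n x g)) = (\<Sum>n. \<Sum>k. ennreal (g k) * ennreal (?W y n x (kronecker k)))" by simp
  also have "\<dots> = (\<Sum>k. \<Sum>n. ennreal (g k) * ennreal (?W y n x (kronecker k)))" by (rule suminf_swap_ennreal)
  finally show ?thesis by (simp add: path_series_def ennreal_suminf_cmult)
qed

text \<open>A path counted here leaves R at once, walks outside and enters R at its end; lengths 0
  and 1 have no walk outside. The walk is a power of q p restricted to the complement, which is
  self-adjoint for \<mu>, so the excursion can be reversed.\<close>

lemma weighted_paths_reversible:
  assumes \<mu>: "\<And>x. 0 < \<mu> x" and rev: "\<And>x y. \<mu> x * p x y = \<mu> y * p y x"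
    and q: "0 < q" and x: "x \<in> R" and y: "y \<in> R"
  shows "\<mu> x * weighted_paths p R q y n x (kronecker 1) = \<mu> y * weighted_paths p R q x n y (kronecker 1)"
proof -
  let ?W = "weighted_paths p R q"
  let ?B = "kernel_op (- R) (\<lambda>u v. q * p u v)"
  interpret B: reversible_kernel "- R" \<mu> "\<lambda>u v. q * p u v"
    by unfold_locales (simp_all add: \<mu> rev mult.left_commute)
  have adj: "inner_on (- R) \<mu> f ((?B ^^ n) g) = inner_on (- R) \<mu> ((?B ^^ n) f) g" for n f g
  proof (induction n arbitrary: f)
    case (Suc n)
    have "inner_on (- R) \<mu> f ((?B ^^ Suc n) g) = inner_on (- R) \<mu> (?B f) ((?B ^^ n) g)"
      by (simp add: B.kernel_op_symmetric)
    also have "\<dots> = inner_on (- R) \<mu> ((?B ^^ Suc n) f) g"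
      unfolding Suc.IH by (simp add: funpow_swap1)
    finally show ?case .
  qed simp
  \<comment> \<open>n steps within the complement followed by one step into w.\<close>
  have hit: "?W w (Suc n) z (kronecker 0) = (?B ^^ n) (\<lambda>z. q * p z w) z" if "w \<in> R" "z \<notin> R" for n w z
    using that(2)
  proof (induction n arbitrary: z)
    case 0
    then show ?case by (simp add: kronecker_def if_distrib[of "\<lambda>u. _ * u"] cong: if_cong)
  next
    case (Suc n)
    have "?W w (Suc (Suc n)) z (kronecker 0) = q * (\<Sum>u\<in>UNIV. p z u * ?W w (Suc n) u (kronecker 0))"
      using Suc.prems by simp
    also have "(\<Sum>u\<in>UNIV. p z u * ?W w (Suc n) u (kronecker 0)) = (\<Sum>u\<in>-R. p z u * ?W w (Suc n) u (kronecker 0))"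
      by (rule sum.mono_neutral_right) (auto simp: weighted_paths_in_0 simp del: weighted_paths.simps)
    also have "q * \<dots> = (\<Sum>u\<in>-R. q * p z u * (?B ^^ n) (\<lambda>z. q * p z w) u)"
      unfolding sum_distrib_left mult.assoc[symmetric] by (intro sum.cong refl) (simp add: Suc.IH del: weighted_paths.simps)
    finally show ?case by (simp add: kernel_op_def[of _ _ "(?B ^^ n) (\<lambda>z. q * p z w)"] del: weighted_paths.simps)
  qed
  have first: "\<mu> a * ?W b (Suc (Suc n)) a (kronecker 1)
      = inner_on (- R) \<mu> (\<lambda>z. p z a) ((?B ^^ n) (\<lambda>z. q * p z b))" if "a \<in> R" "b \<in> R" for a b n
  proof -
    have "?W b (Suc (Suc n)) a (kronecker 1) = (\<Sum>z\<in>UNIV. p a z * ?W b (Suc n) z (kronecker 0))"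
      using that by (simp add: kronecker_Suc_Suc[of 0, simplified] del: weighted_paths.simps(1)) 
    also have "\<dots> = (\<Sum>z\<in>-R. p a z * ?W b (Suc n) z (kronecker 0))"
      by (rule sum.mono_neutral_right) (auto simp: weighted_paths_in_0 simp del: weighted_paths.simps)
    also have "\<dots> = (\<Sum>z\<in>-R. p a z * (?B ^^ n) (\<lambda>z. q * p z b) z)"
      by (intro sum.cong refl) (simp add: hit that del: weighted_paths.simps)
    finally show ?thesis
      by (simp add: inner_on_def sum_distrib_left mult.assoc[symmetric] rev[of a])
  qed
  consider "n = 0" | "n = 1" | m where "n = Suc (Suc m)" by (metis One_nat_def not0_implies_Suc)
  then show ?thesis
  proof cases
    case 1 then show ?thesis by (simp add: kronecker_def)
  next
    case 2 then show ?thesis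
      using x y rev[of x y] by (simp add: kronecker_def if_distrib[of "\<lambda>u. _ * u"] cong: if_cong)
  next
    case 3
    \<comment> \<open>The step into R carries a factor q and the step out of R does not; multiplying
      by q makes both ends alike, and q is cancelled afterwards.\<close>
    have "q * inner_on (- R) \<mu> (\<lambda>z. p z x) ((?B ^^ m) (\<lambda>z. q * p z y))
        = inner_on (- R) \<mu> (\<lambda>z. q * p z x) ((?B ^^ m) (\<lambda>z. q * p z y))"
      by (simp add: inner_on_scale_left)
    also have "\<dots> = inner_on (- R) \<mu> (\<lambda>z. q * p z y) ((?B ^^ m) (\<lambda>z. q * p z x))"
      unfolding adj[of "\<lambda>z. q * p z x"] by (rule inner_on_commute)
    also have "\<dots> = q * inner_on (- R) \<mu> (\<lambda>z. p z y) ((?B ^^ m) (\<lambda>z. q * p z x))"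
      by (simp add: inner_on_scale_left)
    finally show ?thesis using q unfolding 3 by (simp only: first[OF x y] first[OF y x]) simp
  qed
qed

end

section \<open>Law of the killed process\<close>

lemma independent_rv_distr:
  assumes "prob_space M" and ind: "independent_rv M N1 X1 N2 X2"
  shows "distr M (N1 \<Otimes>\<^sub>M N2) (\<lambda>\<omega>. (X1 \<omega>, X2 \<omega>)) = distr M N1 X1 \<Otimes>\<^sub>M distr M N2 X2"
proof -
  interpret prob_space M by fact
  have [measurable]: "X1 \<in> measurable M N1" "X2 \<in> measurable M N2"
    using ind by (auto simp: independent_rv_def)
  interpret D1: prob_space "distr M N1 X1" by (rule prob_space_distr) measurable
  interpret D2: prob_space "distr M N2 X2" by (rule prob_space_distr) measurable
  have "distr M N1 X1 \<Otimes>\<^sub>M distr M N2 X2 = distr M (N1 \<Otimes>\<^sub>M N2) (\<lambda>\<omega>. (X1 \<omega>, X2 \<omega>))"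
  proof (rule pair_measure_eqI)
    fix A B assume "A \<in> sets (distr M N1 X1)" "B \<in> sets (distr M N2 X2)"
    then have AB[measurable]: "A \<in> sets N1" "B \<in> sets N2" by auto
    have "prob ((X1 -` A \<inter> space M) \<inter> (X2 -` B \<inter> space M)) = prob (X1 -` A \<inter> space M) * prob (X2 -` B \<inter> space M)"
      using ind AB by (intro indep_setD) (auto simp: independent_rv_def)
    moreover have "(\<lambda>\<omega>. (X1 \<omega>, X2 \<omega>)) -` (A \<times> B) \<inter> space M = (X1 -` A \<inter> space M) \<inter> (X2 -` B \<inter> space M)"
      by auto
    ultimately show "emeasure (distr M N1 X1) A * emeasure (distr M N2 X2) B
        = emeasure (distr M (N1 \<Otimes>\<^sub>M N2) (\<lambda>\<omega>. (X1 \<omega>, X2 \<omega>))) (A \<times> B)"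
      by (simp add: emeasure_distr emeasure_eq_measure ennreal_mult)
  qed (auto intro: D1.sigma_finite_measure_axioms D2.sigma_finite_measure_axioms)
  then show ?thesis ..
qed

lemma independent_rv_nn_integral:
  assumes M: "prob_space M" and ind: "independent_rv M N1 X1 N2 X2"
    and f[measurable]: "f \<in> borel_measurable (N1 \<Otimes>\<^sub>M N2)"
  shows "(\<integral>\<^sup>+\<omega>. f (X1 \<omega>, X2 \<omega>) \<partial>M) = (\<integral>\<^sup>+\<omega>. \<integral>\<^sup>+\<omega>'. f (X1 \<omega>, X2 \<omega>') \<partial>M \<partial>M)"
proof -
  interpret prob_space M by fact
  have [measurable]: "X1 \<in> measurable M N1" "X2 \<in> measurable M N2"
    using ind by (auto simp: independent_rv_def)
  interpret D2: prob_space "distr M N2 X2" by (rule prob_space_distr) measurable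
  have f1: "f \<in> borel_measurable (distr M N1 X1 \<Otimes>\<^sub>M distr M N2 X2)"
    unfolding measurable_cong_sets[OF sets_pair_measure_cong[OF sets_distr sets_distr] refl] by (rule f)
  have "(\<integral>\<^sup>+\<omega>. f (X1 \<omega>, X2 \<omega>) \<partial>M) = (\<integral>\<^sup>+ z. f z \<partial>distr M (N1 \<Otimes>\<^sub>M N2) (\<lambda>\<omega>. (X1 \<omega>, X2 \<omega>)))"
    by (rule nn_integral_distr[symmetric]) measurable
  also have "\<dots> = (\<integral>\<^sup>+ x. \<integral>\<^sup>+ y. f (x, y) \<partial>distr M N2 X2 \<partial>distr M N1 X1)"
    unfolding independent_rv_distr[OF M ind] by (rule D2.nn_integral_fst[OF f1, symmetric])
  also have "\<dots> = (\<integral>\<^sup>+\<omega>. \<integral>\<^sup>+ y. f (X1 \<omega>, y) \<partial>distr M N2 X2 \<partial>M)"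
    by (rule nn_integral_distr[OF _ D2.borel_measurable_nn_integral_fst[OF f1]]) measurable
  also have "\<dots> = (\<integral>\<^sup>+\<omega>. \<integral>\<^sup>+\<omega>'. f (X1 \<omega>, X2 \<omega>') \<partial>M \<partial>M)"
  proof (rule nn_integral_cong)
    fix \<omega> assume "\<omega> \<in> space M"
    then have "X1 \<omega> \<in> space N1" by (rule measurable_space[OF \<open>X1 \<in> measurable M N1\<close>])
    then show "(\<integral>\<^sup>+ y. f (X1 \<omega>, y) \<partial>distr M N2 X2) = (\<integral>\<^sup>+\<omega>'. f (X1 \<omega>, X2 \<omega>') \<partial>M)"
      by (intro nn_integral_distr measurable_compose[OF measurable_Pair1' f]) measurable
  qed
  finally show ?thesis .
qed

text \<open>Stated almost surely because the pathwise descriptions of events hold only outside a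
  null set.\<close>

lemma emeasure_countable_partition:
  assumes E: "E \<in> sets M" and F: "\<And>n::nat. F n \<in> sets M"
    and eq: "AE \<omega> in M. \<omega> \<in> E \<longleftrightarrow> (\<exists>n. \<omega> \<in> F n)"
    and disj: "AE \<omega> in M. \<forall>m n. \<omega> \<in> F m \<longrightarrow> \<omega> \<in> F n \<longrightarrow> m = n"
  shows "emeasure M E = (\<Sum>n. emeasure M (F n))"
proof -
  have "emeasure M E = (\<integral>\<^sup>+\<omega>. indicator E \<omega> \<partial>M)" using E by simp
  also have "\<dots> = (\<integral>\<^sup>+\<omega>. (\<Sum>n. indicator (F n) \<omega>) \<partial>M)"
  proof (rule nn_integral_cong_AE)
    show "AE \<omega> in M. indicator E \<omega> = (\<Sum>n. indicator (F n) \<omega> :: ennreal)"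
      using eq disj
    proof eventually_elim
      case (elim \<omega>)
      show ?case
      proof (cases "\<exists>n. \<omega> \<in> F n")
        case True
        then obtain n where n: "\<omega> \<in> F n" by blast
        then have "(\<Sum>n. indicator (F n) \<omega> :: ennreal) = (\<Sum>n\<in>{n}. indicator (F n) \<omega>)"
          using elim(2) by (intro suminf_finite) (auto simp: indicator_def)
        then show ?thesis using n elim(1) by auto
      next
        case False
        then show ?thesis using elim(1) by (auto simp: indicator_def)
      qed
    qed
  qed
  also have "\<dots> = (\<Sum>n. emeasure M (F n))" using F by (subst nn_integral_suminf) auto
  finally show ?thesis .
qed

section \<open>The clock, the killing time and the law of a single path\<close>

locale clocked_chain =
  fixes p :: "'a::finite \<Rightarrow> 'a \<Rightarrow> real" and l :: real and x0 :: 'a and M :: "'w measure"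
    and \<xi> :: "nat \<Rightarrow> 'w \<Rightarrow> real" and Y :: "nat \<Rightarrow> 'w \<Rightarrow> 'a" and \<sigma> :: "'w \<Rightarrow> ennreal"
  assumes model: "clock_model p l x0 M \<xi> Y \<sigma>" and l_nonneg: "0 \<le> l"
begin

sublocale prob_space M using model by (simp add: clock_model_def)

lemma xi_distributed: "distributed M lborel (\<xi> n) (exponential_density 1)"
  using model by (simp add: clock_model_def rate_one_clock_def)

lemma xi_indep: "indep_vars (\<lambda>_. borel) \<xi> UNIV"
  using model by (simp add: clock_model_def rate_one_clock_def)

lemma xi_measurable[measurable]: "\<xi> n \<in> borel_measurable M"
  using distributed_measurable[OF xi_distributed] by simp

lemma Y_measurable[measurable]: "Y n \<in> measurable M (count_space UNIV)"
  using model by (simp add: clock_model_def markov_chain_from_def)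

lemma sigma_measurable[measurable]: "\<sigma> \<in> borel_measurable M"
  using model by (simp add: clock_model_def independent_rv_def)

text \<open>The Erlang distribution function in Poisson form; the sum over i < \<open>card I\<close>
  includes the case of an empty I.\<close>

lemma prob_sum_le:
  assumes "finite I" "0 \<le> t"
  shows "prob {\<omega> \<in> space M. (\<Sum>i\<in>I. \<xi> i \<omega>) \<le> t} = 1 - (\<Sum>i<card I. t ^ i * exp (- t) / fact i)"
proof (cases "I = {}")
  case True
  then show ?thesis using assms by (simp add: prob_space)
next
  case False
  then obtain k where k: "card I = Suc k" using assms by (metis card_eq_0_iff not0_implies_Suc)
  have "distributed M lborel (\<lambda>\<omega>. \<Sum>i\<in>I. \<xi> i \<omega>) (erlang_density (card I - 1) 1)"
    by (rule exponential_distributed_sum) (use assms False xi_distributed indep_vars_subset[OF xi_indep] in auto)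
  from erlang_distributed_le[OF this _ assms(2)] show ?thesis
    using assms by (simp add: k erlang_CDF_def lessThan_Suc_atMost)
qed

lemma AE_xi_pos: "AE \<omega> in M. \<forall>n. 0 < \<xi> n \<omega>"
proof (subst AE_all_countable, rule allI)
  fix n
  have "prob {\<omega> \<in> space M. \<xi> n \<omega> \<le> 0} = 0" using prob_sum_le[of "{n}" 0] by simp
  then have "AE \<omega> in M. \<not> \<xi> n \<omega> \<le> 0" by (subst (asm) prob_eq_0) auto
  then show "AE \<omega> in M. 0 < \<xi> n \<omega>" by eventually_elim simp
qed

text \<open>For every n the probability is at most a Poisson tail from n on, which tends to 0 by the
  exponential series.\<close>

lemma AE_diverges: "AE \<omega> in M. \<forall>k::nat. \<exists>n. real k < arrival \<xi> n \<omega>"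
proof (subst AE_all_countable, rule allI)
  fix k :: nat
  let ?E = "{\<omega> \<in> space M. \<forall>n. arrival \<xi> n \<omega> \<le> real k}"
  have [measurable]: "(\<lambda>\<omega>. arrival \<xi> n \<omega>) \<in> borel_measurable M" for n unfolding arrival_def by measurable
  have "prob ?E \<le> 1 - (\<Sum>i<n. real k ^ i * exp (- real k) / fact i)" for n
  proof -
    have "prob ?E \<le> prob {\<omega> \<in> space M. (\<Sum>i\<in>{..<n}. \<xi> i \<omega>) \<le> real k}"
      by (intro finite_measure_mono) (auto simp: arrival_def)
    then show ?thesis using prob_sum_le[of "{..<n}" "real k"] by simp
  qed
  moreover have "(\<lambda>n. 1 - (\<Sum>i<n. real k ^ i * exp (- real k) / fact i)) \<longlonglongrightarrow> 1 - exp (real k) * exp (- real k)"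
  proof -
    have "(\<lambda>i. real k ^ i /\<^sub>R fact i * exp (- real k)) sums (exp (real k) * exp (- real k))"
      by (intro sums_mult2 exp_converges)
    then have "(\<lambda>i. real k ^ i * exp (- real k) / fact i) sums (exp (real k) * exp (- real k))"
      by (simp add: divide_inverse mult_ac)
    then show ?thesis unfolding sums_def by (intro tendsto_diff tendsto_const)
  qed
  ultimately have "prob ?E \<le> 1 - exp (real k) * exp (- real k)"
    by (intro LIMSEQ_le_const) auto
  then have "prob ?E = 0" by (simp add: measure_le_0_iff flip: exp_add)
  then have "AE \<omega> in M. \<not> (\<forall>n. arrival \<xi> n \<omega> \<le> real k)" by (subst (asm) prob_eq_0) auto
  then show "AE \<omega> in M. \<exists>n. real k < arrival \<xi> n \<omega>" by eventually_elim (simp add: not_le)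
qed

lemma AE_regular: "AE \<omega> in M. regular_clock \<xi> \<omega>"
  using AE_xi_pos AE_diverges
proof eventually_elim
  case (elim \<omega>)
  show ?case
  proof unfold_locales
    fix t :: real
    obtain k :: nat where "t \<le> real k" using real_arch_simple by blast
    then show "\<exists>n. t < arrival \<xi> n \<omega>" using elim(2) by (meson order_le_less_trans)
  qed (use elim in auto)
qed

text \<open>Two Erlang distribution functions differ by a single Poisson term. The indices in I need
  not be consecutive: they will be the steps spent in R.\<close>

lemma emeasure_sum_window:
  assumes I: "finite I" "n \<notin> I" and t: "0 \<le> t"
  shows "emeasure M {\<omega> \<in> space M. (\<Sum>i\<in>I. \<xi> i \<omega>) \<le> t \<and> t < (\<Sum>i\<in>I. \<xi> i \<omega>) + \<xi> n \<omega>}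
    = ennreal (exp (- t) * t ^ card I / fact (card I))"
proof -
  let ?A = "{\<omega> \<in> space M. (\<Sum>i\<in>I. \<xi> i \<omega>) \<le> t}" and ?B = "{\<omega> \<in> space M. (\<Sum>i\<in>insert n I. \<xi> i \<omega>) \<le> t}"
  have "prob {\<omega> \<in> space M. (\<Sum>i\<in>I. \<xi> i \<omega>) \<le> t \<and> t < (\<Sum>i\<in>I. \<xi> i \<omega>) + \<xi> n \<omega>} = prob (?A - ?B)"
    using I by (intro arg_cong[where f=prob]) auto
  also have "\<dots> = prob ?A - prob (?A \<inter> ?B)"
    using I by (intro finite_measure_Diff') auto
  also have "prob (?A \<inter> ?B) = prob ?B"
  proof (rule finite_measure_eq_AE)
    show "AE \<omega> in M. \<omega> \<in> ?A \<inter> ?B \<longleftrightarrow> \<omega> \<in> ?B"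
      using AE_xi_pos
    proof eventually_elim
      case (elim \<omega>)
      then have "0 < \<xi> n \<omega>" by simp
      then show ?case using I by auto
    qed
  qed (use I in auto)
  also have "prob ?A - prob ?B = exp (- t) * t ^ card I / fact (card I)"
    unfolding prob_sum_le[OF I(1) t] prob_sum_le[OF finite.insertI[OF I(1)] t] card_insert_disjoint[OF I] by simp
  finally show ?thesis by (simp add: emeasure_eq_measure)
qed

text \<open>The Laplace transform of the unit exponential law: the chance to survive killing at rate
  l during one step outside R.\<close>

lemma nn_integral_exp_xi: "(\<integral>\<^sup>+\<omega>. ennreal (exp (- l * \<xi> n \<omega>)) \<partial>M) = ennreal (1 / (1 + l))"
proof -
  have "(\<integral>\<^sup>+\<omega>. ennreal (exp (- l * \<xi> n \<omega>)) \<partial>M) = (\<integral>\<^sup>+u. ennreal (exponential_density 1 u) * ennreal (exp (- l * u)) \<partial>lborel)"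
    by (rule distributed_nn_integral[OF xi_distributed, symmetric]) measurable
  also have "\<dots> = (\<integral>\<^sup>+u. ennreal (1 / (1 + l)) * ennreal (exponential_density (1 + l) u) \<partial>lborel)"
  proof (intro nn_integral_cong)
    fix u :: real
    have "exp (- u) * exp (- l * u) = exp (- u * (1 + l))"
      by (simp add: algebra_simps flip: exp_add)
    then have "exponential_density 1 u * exp (- l * u) = 1 / (1 + l) * exponential_density (1 + l) u"
      using l_nonneg by (simp add: exponential_density_def)
    then show "ennreal (exponential_density 1 u) * ennreal (exp (- l * u)) = ennreal (1 / (1 + l)) * ennreal (exponential_density (1 + l) u)"
      using l_nonneg by (simp add: ennreal_mult[symmetric] exponential_density_nonneg)
  qed
  also have "\<dots> = ennreal (1 / (1 + l)) * (\<integral>\<^sup>+u. ennreal (exponential_density (1 + l) u) \<partial>lborel)"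
    by (rule nn_integral_cmult) measurable
  also have "(\<integral>\<^sup>+u. ennreal (exponential_density (1 + l) u) \<partial>lborel) = 1"
    using nn_integral_erlang_ith_moment[of "1 + l" 0 0] l_nonneg by simp
  finally show ?thesis by simp
qed

lemma emeasure_sigma_ge:
  assumes c: "0 \<le> c"
  shows "emeasure M {\<omega> \<in> space M. ennreal c \<le> \<sigma> \<omega>} = ennreal (exp (- l * c))"
proof -
  have "emeasure M {\<omega> \<in> space M. ennreal c \<le> \<sigma> \<omega>} = emeasure (distr M borel \<sigma>) {s. ennreal c \<le> s}"
    by (subst emeasure_distr) (auto intro!: arg_cong[where f="emeasure M"])
  also have "distr M borel \<sigma> = killing_law l" using model by (simp add: clock_model_def)
  also have "emeasure (killing_law l) {s. ennreal c \<le> s} = ennreal (exp (- l * c))"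
  proof (cases "l = 0")
    case True
    then show ?thesis by (simp add: killing_law_def)
  next
    case False
    then have l: "0 < l" using l_nonneg by simp
    let ?D = "density lborel (exponential_density l)"
    have dm: "(\<lambda>u. ennreal (exponential_density l u)) \<in> borel_measurable lborel" by measurable
    interpret D: prob_space ?D by (rule prob_space_exponential_density[OF l])
    have "emeasure (killing_law l) {s. ennreal c \<le> s} = emeasure ?D {u. ennreal c \<le> ennreal u}"
      using False by (simp add: killing_law_def emeasure_distr vimage_def)
    also have "\<dots> = emeasure ?D (space ?D - {..c})"
    \<comment> \<open>The two sets differ only at u = c and on negative u, where the density
      vanishes.\<close>
    proof (rule emeasure_eq_AE)
      have "AE u in lborel. u \<noteq> c" by (rule AE_lborel_singleton)
      then show "AE u in ?D. u \<in> {u. ennreal c \<le> ennreal u} \<longleftrightarrow> u \<in> space ?D - {..c}"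
        unfolding AE_density[OF dm]
      proof eventually_elim
        case (elim u)
        show ?case
        proof
          assume "0 < ennreal (exponential_density l u)"
          then have "0 \<le> u" by (auto simp: exponential_density_def split: if_splits)
          then show "u \<in> {u. ennreal c \<le> ennreal u} \<longleftrightarrow> u \<in> space ?D - {..c}"
            using elim c by auto
        qed
      qed
    qed auto
    also have "\<dots> = ennreal (1 - D.prob {..c})"
      by (simp add: D.emeasure_eq_measure D.prob_compl[of "{..c}", simplified])
    also have "D.prob {..c} = 1 - exp (- l * c)"
    proof -
      have "ennreal (D.prob {..c}) = ennreal (erlang_CDF 0 l c)"
        using emeasure_erlang_density[OF l, of 0 c] by (simp add: D.emeasure_eq_measure)
      then have "D.prob {..c} = erlang_CDF 0 l c" using l by (subst (asm) ennreal_inj) auto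
      then show ?thesis using c by (simp add: erlang_CDF_def)
    qed
    finally show ?thesis by simp
  qed
  finally show ?thesis .
qed

text \<open>The event reads the clock only through I, so it is independent of the gaps in J, each of
  which contributes one Laplace factor.\<close>

lemma nn_integral_killing_factor:
  assumes J: "finite J" "I \<inter> J = {}"
    and Q[measurable]: "{f \<in> space (PiM I (\<lambda>_. borel)). Q f} \<in> sets (PiM I (\<lambda>_. borel :: real measure))"
  shows "(\<integral>\<^sup>+\<omega>. indicator {\<omega> \<in> space M. Q (restrict (\<lambda>i. \<xi> i \<omega>) I)} \<omega> * ennreal (exp (- l * (\<Sum>i\<in>J. \<xi> i \<omega>))) \<partial>M)
    = emeasure M {\<omega> \<in> space M. Q (restrict (\<lambda>i. \<xi> i \<omega>) I)} * ennreal (1 / (1 + l)) ^ card J"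
proof -
  \<comment> \<open>\<open>None\<close> stands for the whole block I and \<open>Some j\<close> for a
    single gap, which makes one disjoint family of blocks.\<close>
  define L where "L = insert None (Some ` J)"
  define B where "B r = (case r of None \<Rightarrow> I | Some j \<Rightarrow> {j})" for r
  define V where "V r = (case r of None \<Rightarrow> (\<lambda>f. indicator {f \<in> space (PiM I (\<lambda>_. borel)). Q f} f)
    | Some j \<Rightarrow> (\<lambda>f :: nat \<Rightarrow> real. ennreal (exp (- l * f j))))" for r
  have disj: "disjoint_family_on B L"
    using J(2) unfolding disjoint_family_on_def by (auto simp: B_def L_def)
  have ind: "indep_vars (\<lambda>_. borel) (\<lambda>r \<omega>. V r (restrict (\<lambda>i. \<xi> i \<omega>) (B r))) L"
  proof (rule indep_vars_compose2[OF indep_vars_restrict[OF xi_indep _ disj]])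
    fix r assume "r \<in> L"
    show "V r \<in> borel_measurable (PiM (B r) (\<lambda>_. borel))"
      by (cases r) (auto simp: V_def B_def)
  qed auto
  have "(\<integral>\<^sup>+\<omega>. indicator {\<omega> \<in> space M. Q (restrict (\<lambda>i. \<xi> i \<omega>) I)} \<omega> * ennreal (exp (- l * (\<Sum>i\<in>J. \<xi> i \<omega>))) \<partial>M)
     = (\<integral>\<^sup>+\<omega>. (\<Prod>r\<in>L. V r (restrict (\<lambda>i. \<xi> i \<omega>) (B r))) \<partial>M)"
  proof (intro nn_integral_cong)
    fix \<omega> assume w: "\<omega> \<in> space M"
    have "(\<Prod>r\<in>L. V r (restrict (\<lambda>i. \<xi> i \<omega>) (B r)))
      = V None (restrict (\<lambda>i. \<xi> i \<omega>) I) * (\<Prod>j\<in>J. ennreal (exp (- l * \<xi> j \<omega>)))"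
      unfolding L_def using J(1) by (subst prod.insert) (auto simp: prod.reindex V_def B_def)
    also have "(\<Prod>j\<in>J. ennreal (exp (- l * \<xi> j \<omega>))) = ennreal (exp (- l * (\<Sum>i\<in>J. \<xi> i \<omega>)))"
      using J(1) by (subst prod_ennreal) (auto simp: exp_sum sum_distrib_left sum_negf[symmetric])
    also have "V None (restrict (\<lambda>i. \<xi> i \<omega>) I) = indicator {\<omega> \<in> space M. Q (restrict (\<lambda>i. \<xi> i \<omega>) I)} \<omega>"
      using w by (auto simp: V_def indicator_def space_PiM)
    finally show "indicator {\<omega> \<in> space M. Q (restrict (\<lambda>i. \<xi> i \<omega>) I)} \<omega> * ennreal (exp (- l * (\<Sum>i\<in>J. \<xi> i \<omega>)))
      = (\<Prod>r\<in>L. V r (restrict (\<lambda>i. \<xi> i \<omega>) (B r)))" ..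
  qed
  also have "\<dots> = (\<Prod>r\<in>L. \<integral>\<^sup>+\<omega>. V r (restrict (\<lambda>i. \<xi> i \<omega>) (B r)) \<partial>M)"
    by (rule indep_vars_nn_integral[OF _ ind]) (auto simp: L_def J)
  also have "\<dots> = (\<integral>\<^sup>+\<omega>. V None (restrict (\<lambda>i. \<xi> i \<omega>) I) \<partial>M) * (\<Prod>j\<in>J. \<integral>\<^sup>+\<omega>. ennreal (exp (- l * \<xi> j \<omega>)) \<partial>M)"
    unfolding L_def using J(1) by (subst prod.insert) (auto simp: prod.reindex V_def B_def)
  also have "(\<integral>\<^sup>+\<omega>. V None (restrict (\<lambda>i. \<xi> i \<omega>) I) \<partial>M) = (\<integral>\<^sup>+\<omega>. indicator {\<omega> \<in> space M. Q (restrict (\<lambda>i. \<xi> i \<omega>) I)} \<omega> \<partial>M)"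
    by (intro nn_integral_cong) (auto simp: V_def indicator_def space_PiM)
  also have "\<dots> = emeasure M {\<omega> \<in> space M. Q (restrict (\<lambda>i. \<xi> i \<omega>) I)}"
  proof (rule nn_integral_indicator)
    have "(\<lambda>\<omega>. restrict (\<lambda>i. \<xi> i \<omega>) I) \<in> measurable M (PiM I (\<lambda>_. borel))" by measurable
    from measurable_sets[OF this Q]
    show "{\<omega> \<in> space M. Q (restrict (\<lambda>i. \<xi> i \<omega>) I)} \<in> sets M"
      by (rule back_subst[of "\<lambda>A. A \<in> sets M"]) (auto simp: space_PiM)
  qed
  finally show ?thesis unfolding nn_integral_exp_xi prod_constant .
qed


lemma path_event_measurable[measurable]: "{\<omega> \<in> space M. \<forall>i\<le>n. Y i \<omega> = f i} \<in> sets M"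
  by measurable

text \<open>\<sigma> is integrated out first and leaves exp(-l times the sum over J); then the chain
  separates from the clock, and the clock factor is
  \<open>nn_integral_killing_factor\<close>.\<close>

lemma path_law:
  assumes J: "finite J" "I \<inter> J = {}"
    and Q: "{f \<in> space (PiM I (\<lambda>_. borel)). Q f} \<in> sets (PiM I (\<lambda>_. borel :: real measure))"
  shows "emeasure M {\<omega> \<in> space M. (\<forall>i\<le>n. Y i \<omega> = f i) \<and> Q (restrict (\<lambda>i. \<xi> i \<omega>) I) \<and> ennreal (\<Sum>i\<in>J. \<xi> i \<omega>) \<le> \<sigma> \<omega>}
    = emeasure M {\<omega> \<in> space M. \<forall>i\<le>n. Y i \<omega> = f i}
      * (emeasure M {\<omega> \<in> space M. Q (restrict (\<lambda>i. \<xi> i \<omega>) I)} * ennreal (1 / (1 + l)) ^ card J)"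
proof -
  define N1 where "N1 = PiM (UNIV :: nat set) (\<lambda>_. borel :: real measure)"
  define N2 where "N2 = PiM (UNIV :: nat set) (\<lambda>_. count_space (UNIV :: 'a set))"
  have ind1: "independent_rv M N1 (\<lambda>\<omega> n. \<xi> n \<omega>) N2 (\<lambda>\<omega> n. Y n \<omega>)"
    using model by (simp add: clock_model_def N1_def N2_def)
  have ind2: "independent_rv M (N1 \<Otimes>\<^sub>M N2) (\<lambda>\<omega>. (\<lambda>n. \<xi> n \<omega>, \<lambda>n. Y n \<omega>)) borel \<sigma>"
    using model by (simp add: clock_model_def N1_def N2_def)
  define A where "A = {b \<in> space N2. \<forall>i\<le>n. b i = f i}"
  define B where "B = {a \<in> space N1. Q (restrict a I)}"
  have cY[measurable]: "(\<lambda>b. b i) \<in> measurable N2 (count_space UNIV)" for i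
    unfolding N2_def by (rule measurable_component_singleton) simp
  have cX[measurable]: "(\<lambda>a. a i) \<in> borel_measurable N1" for i
    unfolding N1_def by (rule measurable_component_singleton) simp
  have A[measurable]: "A \<in> sets N2" unfolding A_def by measurable
  have B[measurable]: "B \<in> sets N1"
  proof -
    have "(\<lambda>a. restrict a I) \<in> measurable N1 (PiM I (\<lambda>_. borel))"
      unfolding N1_def by (rule measurable_restrict_subset) simp
    from measurable_sets[OF this Q] show ?thesis
      by (rule back_subst[of "\<lambda>A. A \<in> sets N1"]) (auto simp: B_def space_PiM)
  qed
  have sp: "(\<lambda>n. \<xi> n \<omega>) \<in> space N1" "(\<lambda>n. Y n \<omega>) \<in> space N2" for \<omega>
    by (simp_all add: N1_def N2_def space_PiM)
  have cs: "(\<lambda>z. \<Sum>i\<in>J. fst (fst z) i) \<in> borel_measurable ((N1 \<Otimes>\<^sub>M N2) \<Otimes>\<^sub>M (borel :: ennreal measure))"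
    by (intro borel_measurable_sum measurable_compose[OF measurable_compose[OF measurable_fst measurable_fst] cX])
  define F :: "((nat \<Rightarrow> real) \<times> (nat \<Rightarrow> 'a)) \<times> ennreal \<Rightarrow> ennreal" where
    "F z = indicator A (snd (fst z)) * (indicator B (fst (fst z)) * (if ennreal (\<Sum>i\<in>J. fst (fst z) i) \<le> snd z then 1 else 0))" for z
  have F: "F \<in> borel_measurable ((N1 \<Otimes>\<^sub>M N2) \<Otimes>\<^sub>M borel)"
  proof -
    note cs[measurable]
    show ?thesis unfolding F_def by measurable
  qed
  define G :: "(nat \<Rightarrow> real) \<times> (nat \<Rightarrow> 'a) \<Rightarrow> ennreal" where
    "G z = indicator A (snd z) * (indicator B (fst z) * ennreal (exp (- l * (\<Sum>i\<in>J. fst z i))))" for z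
  have G: "G \<in> borel_measurable (N1 \<Otimes>\<^sub>M N2)"
  proof -
    have [measurable]: "(\<lambda>z. \<Sum>i\<in>J. fst z i) \<in> borel_measurable (N1 \<Otimes>\<^sub>M N2)"
      by (intro borel_measurable_sum measurable_compose[OF measurable_fst cX])
    show ?thesis unfolding G_def by measurable
  qed
  let ?S = "{\<omega> \<in> space M. (\<forall>i\<le>n. Y i \<omega> = f i) \<and> Q (restrict (\<lambda>i. \<xi> i \<omega>) I) \<and> ennreal (\<Sum>i\<in>J. \<xi> i \<omega>) \<le> \<sigma> \<omega>}"
  let ?P = "{\<omega> \<in> space M. \<forall>i\<le>n. Y i \<omega> = f i}"
  let ?Q = "{\<omega> \<in> space M. Q (restrict (\<lambda>i. \<xi> i \<omega>) I)}"
  have Qs: "?Q \<in> sets M"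
  proof -
    have "(\<lambda>\<omega>. restrict (\<lambda>i. \<xi> i \<omega>) I) \<in> measurable M (PiM I (\<lambda>_. borel))" by measurable
    from measurable_sets[OF this Q] show ?thesis
      by (rule back_subst[of "\<lambda>A. A \<in> sets M"]) (auto simp: space_PiM)
  qed
  have "?S = ?P \<inter> ?Q \<inter> {\<omega> \<in> space M. ennreal (\<Sum>i\<in>J. \<xi> i \<omega>) \<le> \<sigma> \<omega>}" by auto
  then have "?S \<in> sets M" using Qs by simp
  then have "emeasure M ?S = (\<integral>\<^sup>+\<omega>. indicator ?S \<omega> \<partial>M)" by (rule nn_integral_indicator[symmetric])
  also have "\<dots> = (\<integral>\<^sup>+\<omega>. F ((\<lambda>n. \<xi> n \<omega>, \<lambda>n. Y n \<omega>), \<sigma> \<omega>) \<partial>M)"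
    by (intro nn_integral_cong) (auto simp: F_def A_def B_def sp indicator_def)
  also have "\<dots> = (\<integral>\<^sup>+\<omega>. \<integral>\<^sup>+\<omega>'. F ((\<lambda>n. \<xi> n \<omega>, \<lambda>n. Y n \<omega>), \<sigma> \<omega>') \<partial>M \<partial>M)"
    by (rule independent_rv_nn_integral[OF prob_space_axioms ind2 F])
  also have "\<dots> = (\<integral>\<^sup>+\<omega>. G (\<lambda>n. \<xi> n \<omega>, \<lambda>n. Y n \<omega>) \<partial>M)"
  proof (rule nn_integral_cong_AE)
    show "AE \<omega> in M. (\<integral>\<^sup>+\<omega>'. F ((\<lambda>n. \<xi> n \<omega>, \<lambda>n. Y n \<omega>), \<sigma> \<omega>') \<partial>M) = G (\<lambda>n. \<xi> n \<omega>, \<lambda>n. Y n \<omega>)"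
      \<comment> \<open>Positive gaps make the sum over J nonnegative, where the tail of \<sigma> is
        exponential.\<close>
      using AE_xi_pos
    proof eventually_elim
      case (elim \<omega>)
      define c where "c = (\<Sum>i\<in>J. \<xi> i \<omega>)"
      have c: "0 \<le> c" unfolding c_def using elim by (intro sum_nonneg) (auto intro: less_imp_le)
      have "(\<integral>\<^sup>+\<omega>'. F ((\<lambda>n. \<xi> n \<omega>, \<lambda>n. Y n \<omega>), \<sigma> \<omega>') \<partial>M)
        = (\<integral>\<^sup>+\<omega>'. indicator A (\<lambda>n. Y n \<omega>) * indicator B (\<lambda>n. \<xi> n \<omega>) * indicator {\<omega> \<in> space M. ennreal c \<le> \<sigma> \<omega>} \<omega>' \<partial>M)"
        by (intro nn_integral_cong) (simp add: F_def c_def indicator_def)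
      also have "\<dots> = indicator A (\<lambda>n. Y n \<omega>) * indicator B (\<lambda>n. \<xi> n \<omega>) * ennreal (exp (- l * c))"
        by (subst nn_integral_cmult_indicator) (simp_all add: emeasure_sigma_ge[OF c] del: mult_minus_left)
      finally show ?case by (simp add: G_def c_def mult.assoc)
    qed
  qed
  also have "\<dots> = (\<integral>\<^sup>+\<omega>. \<integral>\<^sup>+\<omega>'. G (\<lambda>n. \<xi> n \<omega>, \<lambda>n. Y n \<omega>') \<partial>M \<partial>M)"
    by (rule independent_rv_nn_integral[OF prob_space_axioms ind1 G])
  also have "\<dots> = (\<integral>\<^sup>+\<omega>. emeasure M ?P * (indicator ?Q \<omega> * ennreal (exp (- l * (\<Sum>i\<in>J. \<xi> i \<omega>)))) \<partial>M)"
  proof (rule nn_integral_cong)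
    fix \<omega> assume w: "\<omega> \<in> space M"
    have "(\<integral>\<^sup>+\<omega>'. G (\<lambda>n. \<xi> n \<omega>, \<lambda>n. Y n \<omega>') \<partial>M)
       = (\<integral>\<^sup>+\<omega>'. (indicator B (\<lambda>n. \<xi> n \<omega>) * ennreal (exp (- l * (\<Sum>i\<in>J. \<xi> i \<omega>)))) * indicator ?P \<omega>' \<partial>M)"
      by (intro nn_integral_cong) (auto simp: G_def A_def sp indicator_def)
    also have "\<dots> = (indicator B (\<lambda>n. \<xi> n \<omega>) * ennreal (exp (- l * (\<Sum>i\<in>J. \<xi> i \<omega>)))) * emeasure M ?P"
      by (rule nn_integral_cmult_indicator) measurable
    finally show "(\<integral>\<^sup>+\<omega>'. G (\<lambda>n. \<xi> n \<omega>, \<lambda>n. Y n \<omega>') \<partial>M)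
       = emeasure M ?P * (indicator ?Q \<omega> * ennreal (exp (- l * (\<Sum>i\<in>J. \<xi> i \<omega>))))"
      using w by (simp add: B_def sp indicator_def mult_ac)
  qed
  also have "\<dots> = emeasure M ?P * (\<integral>\<^sup>+\<omega>. indicator ?Q \<omega> * ennreal (exp (- l * (\<Sum>i\<in>J. \<xi> i \<omega>))) \<partial>M)"
    by (intro nn_integral_cmult borel_measurable_times_ennreal borel_measurable_indicator Qs) measurable
  also have "(\<integral>\<^sup>+\<omega>. indicator ?Q \<omega> * ennreal (exp (- l * (\<Sum>i\<in>J. \<xi> i \<omega>))) \<partial>M)
      = emeasure M ?Q * ennreal (1 / (1 + l)) ^ card J"
    by (rule nn_integral_killing_factor[OF J Q])
  finally show ?thesis .
qed

lemma path_prob: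
  "emeasure M {\<omega> \<in> space M. \<forall>i\<le>n. Y i \<omega> = f i} = (if f 0 = x0 then ennreal (\<Prod>i<n. p (f i) (f (Suc i))) else 0)"
  using model by (simp add: clock_model_def markov_chain_from_def emeasure_eq_measure)

lemma path_decomposition:
  assumes A: "{\<omega> \<in> space M. A \<omega>} \<in> sets M"
  shows "emeasure M {\<omega> \<in> space M. Y n \<omega> = y \<and> A \<omega>}
    = (\<Sum>xs\<in>{xs. length xs = Suc n \<and> hd xs = x0 \<and> last xs = y}.
         emeasure M {\<omega> \<in> space M. (\<forall>i\<le>n. Y i \<omega> = xs ! i) \<and> A \<omega>})"
proof -
  let ?L = "{xs :: 'a list. length xs = Suc n}"
  let ?F = "\<lambda>xs. {\<omega> \<in> space M. (\<forall>i\<le>n. Y i \<omega> = xs ! i) \<and> (last xs = y \<and> A \<omega>)}"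
  have fin: "finite ?L" using finite_lists_length_eq[of "UNIV :: 'a set" "Suc n"] by simp
  have S: "?F xs \<in> sets M" for xs
  proof (cases "last xs = y")
    case True
    then have "?F xs = {\<omega> \<in> space M. \<forall>i\<le>n. Y i \<omega> = xs ! i} \<inter> {\<omega> \<in> space M. A \<omega>}" by auto
    then show ?thesis using A by simp
  next
    case False
    then have "?F xs = {}" by auto
    then show ?thesis by (metis sets.empty_sets)
  qed
  have "{\<omega> \<in> space M. Y n \<omega> = y \<and> A \<omega>} = (\<Union>xs\<in>?L. ?F xs)"
  proof (rule subset_antisym; rule subsetI)
    fix \<omega> assume w: "\<omega> \<in> {\<omega> \<in> space M. Y n \<omega> = y \<and> A \<omega>}"
    define xs where "xs = map (\<lambda>i. Y i \<omega>) [0..<Suc n]"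
    have "length xs = Suc n" "\<forall>i\<le>n. Y i \<omega> = xs ! i" "last xs = Y n \<omega>"
      by (auto simp: xs_def last_map nth_append simp del: upt_Suc)
    then show "\<omega> \<in> (\<Union>xs\<in>?L. ?F xs)" using w by auto
  next
    fix \<omega> assume "\<omega> \<in> (\<Union>xs\<in>?L. ?F xs)"
    then obtain xs where xs: "length xs = Suc n" "\<omega> \<in> ?F xs" by auto
    then have "xs \<noteq> []" by auto
    then have "last xs = xs ! n" using xs by (simp add: last_conv_nth)
    then show "\<omega> \<in> {\<omega> \<in> space M. Y n \<omega> = y \<and> A \<omega>}" using xs by auto
  qed
  then have "emeasure M {\<omega> \<in> space M. Y n \<omega> = y \<and> A \<omega>} = (\<Sum>xs\<in>?L. emeasure M (?F xs))"
  proof (simp only:, intro sum_emeasure[symmetric])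
    show "disjoint_family_on ?F ?L"
      unfolding disjoint_family_on_def
    proof (intro ballI impI equals0I)
      fix xs ys \<omega> assume xy: "xs \<in> ?L" "ys \<in> ?L" "xs \<noteq> ys" "\<omega> \<in> ?F xs \<inter> ?F ys"
      then have "xs = ys" by (intro nth_equalityI) auto
      then show False using xy by simp
    qed
    show "?F ` ?L \<subseteq> sets M" using S by blast
  qed (rule fin)
  also have "\<dots> = (\<Sum>xs\<in>{xs. length xs = Suc n \<and> hd xs = x0 \<and> last xs = y}. emeasure M (?F xs))"
  proof (rule sum.mono_neutral_right[OF fin], blast, rule ballI)
    fix xs assume "xs \<in> ?L - {xs. length xs = Suc n \<and> hd xs = x0 \<and> last xs = y}"
    then have xs: "length xs = Suc n" "\<not> (length xs = Suc n \<and> hd xs = x0 \<and> last xs = y)" by blast+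
    show "emeasure M (?F xs) = 0"
    proof (cases "last xs = y")
      case False
      then have "?F xs = {}" by auto
      then show ?thesis by (metis emeasure_empty)
    next
      case True
      then have "xs ! 0 \<noteq> x0" using xs by (cases xs) auto
      then have "emeasure M {\<omega> \<in> space M. \<forall>i\<le>n. Y i \<omega> = xs ! i} = 0" by (subst path_prob) simp
      moreover have "emeasure M (?F xs) \<le> emeasure M {\<omega> \<in> space M. \<forall>i\<le>n. Y i \<omega> = xs ! i}"
        by (intro emeasure_mono) auto
      ultimately show ?thesis by simp
    qed
  qed
  also have "\<dots> = (\<Sum>xs\<in>{xs. length xs = Suc n \<and> hd xs = x0 \<and> last xs = y}.
         emeasure M {\<omega> \<in> space M. (\<forall>i\<le>n. Y i \<omega> = xs ! i) \<and> A \<omega>})"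
    by (intro sum.cong refl arg_cong[where f="emeasure M"]) auto
  finally show ?thesis .
qed

lemma occupation_on_path:
  assumes "\<forall>i\<le>n. Y i \<omega> = xs ! i"
  shows "occupation \<xi> Y A n \<omega> = (\<Sum>i\<in>{i. i < n \<and> xs ! i \<in> A}. \<xi> i \<omega>)"
proof -
  have "occupation \<xi> Y A n \<omega> = (\<Sum>i\<in>{..<n}. if xs ! i \<in> A then \<xi> i \<omega> else 0)"
    unfolding occupation_def using assms by (intro sum.cong refl) auto
  also have "\<dots> = (\<Sum>i\<in>{..<n} \<inter> {i. xs ! i \<in> A}. \<xi> i \<omega>)" by (simp add: sum.inter_restrict)
  also have "{..<n} \<inter> {i. xs ! i \<in> A} = {i. i < n \<and> xs ! i \<in> A}" by auto
  finally show ?thesis .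
qed

lemma occupation_measurable[measurable]: "(\<lambda>\<omega>. occupation \<xi> Y A n \<omega>) \<in> borel_measurable M"
  unfolding occupation_def by measurable

text \<open>Common scheme for the trace and return events: along a fixed path xs the event A becomes
  a condition Q on the gaps in I, none of them a step outside R, whose probability depends on xs
  only through its number of steps from R.\<close>

lemma killed_path_prob:
  assumes p: "\<And>x y. 0 \<le> p x y" and g: "\<And>k. 0 \<le> g k"
    and A: "{\<omega> \<in> space M. A \<omega>} \<in> sets M"
    and I: "\<And>xs. I xs \<inter> {i. i < n \<and> xs ! i \<notin> R} = {}"
    and Q: "\<And>xs. {f \<in> space (PiM (I xs) (\<lambda>_. borel)). Q xs f} \<in> sets (PiM (I xs) (\<lambda>_. borel :: real measure))"
    and AQ: "\<And>xs \<omega>. (\<forall>i\<le>n. Y i \<omega> = xs ! i) \<Longrightarrow> last xs = y \<Longrightarrow> A \<omega> \<longleftrightarrow> Q xs (restrict (\<lambda>i. \<xi> i \<omega>) (I xs))"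
    and Qg: "\<And>xs. last xs = y \<Longrightarrow> emeasure M {\<omega> \<in> space M. Q xs (restrict (\<lambda>i. \<xi> i \<omega>) (I xs))}
        = ennreal (g (card {i. i < n \<and> xs ! i \<in> R}))"
  shows "emeasure M {\<omega> \<in> space M. Y n \<omega> = y \<and> (A \<omega> \<and> ennreal (occupation \<xi> Y (- R) n \<omega>) \<le> \<sigma> \<omega>)}
    = ennreal (weighted_paths p R (1 / (1 + l)) y n x0 g)"
proof -
  let ?L = "{xs. length xs = Suc n \<and> hd xs = x0 \<and> last xs = y}"
  have "{\<omega> \<in> space M. A \<omega> \<and> ennreal (occupation \<xi> Y (- R) n \<omega>) \<le> \<sigma> \<omega>}
      = {\<omega> \<in> space M. A \<omega>} \<inter> {\<omega> \<in> space M. ennreal (occupation \<xi> Y (- R) n \<omega>) \<le> \<sigma> \<omega>}" by auto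
  then have "{\<omega> \<in> space M. A \<omega> \<and> ennreal (occupation \<xi> Y (- R) n \<omega>) \<le> \<sigma> \<omega>} \<in> sets M"
    using A by simp
  then have "emeasure M {\<omega> \<in> space M. Y n \<omega> = y \<and> (A \<omega> \<and> ennreal (occupation \<xi> Y (- R) n \<omega>) \<le> \<sigma> \<omega>)}
    = (\<Sum>xs\<in>?L. emeasure M {\<omega> \<in> space M. (\<forall>i\<le>n. Y i \<omega> = xs ! i) \<and> (A \<omega> \<and> ennreal (occupation \<xi> Y (- R) n \<omega>) \<le> \<sigma> \<omega>)})"
    by (rule path_decomposition)
  also have "\<dots> = (\<Sum>xs\<in>?L. ennreal ((\<Prod>i<n. p (xs ! i) (xs ! Suc i)) * (1 / (1 + l)) ^ card {i. i < n \<and> xs ! i \<notin> R}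
      * g (card {i. i < n \<and> xs ! i \<in> R})))"
  proof (intro sum.cong refl)
    fix xs assume "xs \<in> ?L"
    then have xs: "xs ! 0 = x0" "last xs = y" by (cases xs; auto)+
    let ?J = "{i. i < n \<and> xs ! i \<notin> R}"
    have "{\<omega> \<in> space M. (\<forall>i\<le>n. Y i \<omega> = xs ! i) \<and> (A \<omega> \<and> ennreal (occupation \<xi> Y (- R) n \<omega>) \<le> \<sigma> \<omega>)}
        = {\<omega> \<in> space M. (\<forall>i\<le>n. Y i \<omega> = xs ! i) \<and> Q xs (restrict (\<lambda>i. \<xi> i \<omega>) (I xs)) \<and> ennreal (\<Sum>i\<in>?J. \<xi> i \<omega>) \<le> \<sigma> \<omega>}"
      using AQ[OF _ xs(2)] occupation_on_path[of n _ xs "- R"] by (intro Collect_cong) auto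
    then have "emeasure M {\<omega> \<in> space M. (\<forall>i\<le>n. Y i \<omega> = xs ! i) \<and> (A \<omega> \<and> ennreal (occupation \<xi> Y (- R) n \<omega>) \<le> \<sigma> \<omega>)}
      = emeasure M {\<omega> \<in> space M. \<forall>i\<le>n. Y i \<omega> = xs ! i} * (ennreal (g (card {i. i < n \<and> xs ! i \<in> R})) * ennreal (1 / (1 + l)) ^ card ?J)"
      using path_law[OF _ I Q, where n = n and f = "\<lambda>i. xs ! i"] Qg[OF xs(2)] by simp
    also have "\<dots> = ennreal ((\<Prod>i<n. p (xs ! i) (xs ! Suc i)) * (1 / (1 + l)) ^ card ?J * g (card {i. i < n \<and> xs ! i \<in> R}))"
      using l_nonneg by (simp add: path_prob xs ennreal_mult g p prod_nonneg ennreal_power mult_ac)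
    finally show "emeasure M {\<omega> \<in> space M. (\<forall>i\<le>n. Y i \<omega> = xs ! i) \<and> (A \<omega> \<and> ennreal (occupation \<xi> Y (- R) n \<omega>) \<le> \<sigma> \<omega>)}
      = ennreal ((\<Prod>i<n. p (xs ! i) (xs ! Suc i)) * (1 / (1 + l)) ^ card ?J * g (card {i. i < n \<and> xs ! i \<in> R}))" .
  qed
  also have "\<dots> = ennreal (weighted_paths p R (1 / (1 + l)) y n x0 g)"
    unfolding weighted_paths_eq_sum using l_nonneg
    by (intro sum_ennreal mult_nonneg_nonneg prod_nonneg) (auto simp: p g)
  finally show ?thesis .
qed

end

section \<open>Law of the trace process before the soft exit\<close>

context clocked_chain
begin

text \<open>Almost surely at most one step in R straddles local time t, and survival up to t forces
  one; the event is split according to its index n.\<close>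

lemma trace_event_prob:
  assumes p: "\<And>x y. 0 \<le> p x y" and y: "y \<in> R" and t: "0 \<le> t"
  shows "emeasure M {\<omega> \<in> space M. trace_process \<xi> Y R t \<omega> = y \<and> ennreal t < soft_exit_time \<xi> Y \<sigma> R \<omega>}
    = (\<Sum>n. ennreal (weighted_paths p R (1 / (1 + l)) y n x0 (\<lambda>a. exp (- t) * t ^ a / fact a)))"
proof -
  let ?A = "\<lambda>n \<omega>. occupation \<xi> Y R n \<omega> \<le> t \<and> t < occupation \<xi> Y R n \<omega> + \<xi> n \<omega>"
  let ?E = "{\<omega> \<in> space M. trace_process \<xi> Y R t \<omega> = y \<and> ennreal t < soft_exit_time \<xi> Y \<sigma> R \<omega>}"
  let ?F = "\<lambda>n. {\<omega> \<in> space M. Y n \<omega> = y \<and> (?A n \<omega> \<and> ennreal (occupation \<xi> Y (- R) n \<omega>) \<le> \<sigma> \<omega>)}"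
  have [measurable]: "(\<lambda>\<omega>. trace_process \<xi> Y R t \<omega>) \<in> measurable M (count_space UNIV)"
    by (rule trace_process_measurable) measurable
  have [measurable]: "(\<lambda>\<omega>. soft_exit_time \<xi> Y \<sigma> R \<omega>) \<in> borel_measurable M"
    by (rule soft_exit_time_measurable) measurable
  have "emeasure M ?E = (\<Sum>n. emeasure M (?F n))"
  proof (rule emeasure_countable_partition)
    show "?E \<in> sets M" "?F n \<in> sets M" for n by measurable
    show "AE \<omega> in M. \<omega> \<in> ?E \<longleftrightarrow> (\<exists>n. \<omega> \<in> ?F n)"
      using AE_regular AE_space
    proof eventually_elim
      case (elim \<omega>)
      interpret regular_clock \<xi> Y \<omega> by fact
      show ?case
      proof
        assume w: "\<omega> \<in> ?E"
        then obtain n where n: "Y n \<omega> \<in> R" "occupation \<xi> Y R n \<omega> \<le> t" "t < occupation \<xi> Y R n \<omega> + \<xi> n \<omega>"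
          using soft_exit_time_visit[OF t] by blast
        then show "\<exists>n. \<omega> \<in> ?F n"
          using w trace_process_eq[OF n] soft_exit_time_iff[OF n] by auto
      next
        assume "\<exists>n. \<omega> \<in> ?F n"
        then obtain n where n: "Y n \<omega> = y" "?A n \<omega>" "ennreal (occupation \<xi> Y (- R) n \<omega>) \<le> \<sigma> \<omega>" by auto
        then have n': "Y n \<omega> \<in> R" "occupation \<xi> Y R n \<omega> \<le> t" "t < occupation \<xi> Y R n \<omega> + \<xi> n \<omega>" using y by auto
        show "\<omega> \<in> ?E" using n elim(2) trace_process_eq[OF n'] soft_exit_time_iff[OF n', of \<sigma>] by simp
      qed
    qed
    show "AE \<omega> in M. \<forall>m n. \<omega> \<in> ?F m \<longrightarrow> \<omega> \<in> ?F n \<longrightarrow> m = n"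
      using AE_regular
    proof eventually_elim
      case (elim \<omega>)
      interpret regular_clock \<xi> Y \<omega> by fact
      show ?case using visit_unique[of R _ t] y by auto
    qed
  qed
  also have "\<dots> = (\<Sum>n. ennreal (weighted_paths p R (1 / (1 + l)) y n x0 (\<lambda>a. exp (- t) * t ^ a / fact a)))"
  proof (rule suminf_cong)
    fix n
    let ?V = "\<lambda>xs :: 'a list. {i. i < n \<and> xs ! i \<in> R}"
    show "emeasure M (?F n) = ennreal (weighted_paths p R (1 / (1 + l)) y n x0 (\<lambda>a. exp (- t) * t ^ a / fact a))"
    \<comment> \<open>The event reads the gaps of the earlier visits and that of the visit in
      progress, \<open>n\<close> itself, which is not below n and so stays clear of the killed
      steps.\<close>
    proof (rule killed_path_prob[where I = "\<lambda>xs. insert n (?V xs)"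
          and Q = "\<lambda>xs f. (\<Sum>i\<in>?V xs. f i) \<le> t \<and> t < (\<Sum>i\<in>?V xs. f i) + f n"])
      fix xs
      have [measurable]: "(\<lambda>f. f i) \<in> borel_measurable (PiM (insert n (?V xs)) (\<lambda>_. borel :: real measure))"
        if "i \<in> insert n (?V xs)" for i using that by (rule measurable_component_singleton)
      have [measurable]: "(\<lambda>f. \<Sum>i\<in>?V xs. f i) \<in> borel_measurable (PiM (insert n (?V xs)) (\<lambda>_. borel :: real measure))"
        by (rule borel_measurable_sum) (rule measurable_component_singleton, simp)
      have [measurable]: "(\<lambda>f. f n) \<in> borel_measurable (PiM (insert n (?V xs)) (\<lambda>_. borel :: real measure))"
        by (rule measurable_component_singleton) simp
      show "{f \<in> space (PiM (insert n (?V xs)) (\<lambda>_. borel)). (\<Sum>i\<in>?V xs. f i) \<le> t \<and> t < (\<Sum>i\<in>?V xs. f i) + f n}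
          \<in> sets (PiM (insert n (?V xs)) (\<lambda>_. borel :: real measure))" by measurable
      have r: "(\<Sum>i\<in>?V xs. restrict (\<lambda>i. \<xi> i \<omega>) (insert n (?V xs)) i) = (\<Sum>i\<in>?V xs. \<xi> i \<omega>)" for \<omega>
        by (intro sum.cong) auto
      show "?A n \<omega> \<longleftrightarrow> (\<Sum>i\<in>?V xs. restrict (\<lambda>i. \<xi> i \<omega>) (insert n (?V xs)) i) \<le> t
          \<and> t < (\<Sum>i\<in>?V xs. restrict (\<lambda>i. \<xi> i \<omega>) (insert n (?V xs)) i) + restrict (\<lambda>i. \<xi> i \<omega>) (insert n (?V xs)) n"
        if "\<forall>i\<le>n. Y i \<omega> = xs ! i" for \<omega>
        unfolding r occupation_on_path[OF that] by simp
      show "emeasure M {\<omega> \<in> space M. (\<Sum>i\<in>?V xs. restrict (\<lambda>i. \<xi> i \<omega>) (insert n (?V xs)) i) \<le> t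
          \<and> t < (\<Sum>i\<in>?V xs. restrict (\<lambda>i. \<xi> i \<omega>) (insert n (?V xs)) i) + restrict (\<lambda>i. \<xi> i \<omega>) (insert n (?V xs)) n}
        = ennreal (exp (- t) * t ^ card (?V xs) / fact (card (?V xs)))"
        unfolding r using emeasure_sum_window[of "?V xs" n t] t by simp
    qed (use p t in auto)
  qed
  finally show ?thesis .
qed

lemma soft_exit_prob:
  assumes t: "0 \<le> t"
  shows "prob {\<omega> \<in> space M. ennreal t < soft_exit_time \<xi> Y \<sigma> R \<omega>}
    = (\<Sum>y\<in>R. prob {\<omega> \<in> space M. trace_process \<xi> Y R t \<omega> = y \<and> ennreal t < soft_exit_time \<xi> Y \<sigma> R \<omega>})"
proof -
  let ?E = "\<lambda>y. {\<omega> \<in> space M. trace_process \<xi> Y R t \<omega> = y \<and> ennreal t < soft_exit_time \<xi> Y \<sigma> R \<omega>}"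
  have [measurable]: "(\<lambda>\<omega>. trace_process \<xi> Y R t \<omega>) \<in> measurable M (count_space UNIV)"
    by (rule trace_process_measurable) measurable
  have [measurable]: "(\<lambda>\<omega>. soft_exit_time \<xi> Y \<sigma> R \<omega>) \<in> borel_measurable M"
    by (rule soft_exit_time_measurable) measurable
  have "prob {\<omega> \<in> space M. ennreal t < soft_exit_time \<xi> Y \<sigma> R \<omega>} = prob (\<Union>y\<in>R. ?E y)"
  proof (rule finite_measure_eq_AE)
    show "AE \<omega> in M. \<omega> \<in> {\<omega> \<in> space M. ennreal t < soft_exit_time \<xi> Y \<sigma> R \<omega>} \<longleftrightarrow> \<omega> \<in> (\<Union>y\<in>R. ?E y)"
      using AE_regular
    proof eventually_elim
      case (elim \<omega>)
      interpret regular_clock \<xi> Y \<omega> by fact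
      have "trace_process \<xi> Y R t \<omega> \<in> R" if "ennreal t < soft_exit_time \<xi> Y \<sigma> R \<omega>"
        using soft_exit_time_visit[OF t that] trace_process_eq by metis
      then show ?case by auto
    qed
  qed measurable
  also have "\<dots> = (\<Sum>y\<in>R. prob (?E y))"
    by (rule finite_measure_finite_Union) (auto simp: disjoint_family_on_def)
  finally show ?thesis .
qed

lemma visit_count_measurable[measurable]: "(\<lambda>\<omega>. card {i. i < n \<and> Y i \<omega> \<in> R}) \<in> measurable M (count_space UNIV)"
  by (rule measurable_card) measurable

lemma AE_start: "AE \<omega> in M. Y 0 \<omega> = x0"
proof -
  have "emeasure M {\<omega> \<in> space M. \<forall>i\<le>0. Y i \<omega> = x0} = 1" by (subst path_prob) simp
  then have "prob {\<omega> \<in> space M. Y 0 \<omega> = x0} = 1" by (simp add: emeasure_eq_measure)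
  from prob_Collect_eq_1[THEN iffD1, OF _ this] show ?thesis by simp
qed

text \<open>For a start in \<open>R\<close>, one visit before step \<open>n\<close> means no return to \<open>R\<close> strictly before step \<open>n\<close>.\<close>

lemma one_visit_prob:
  assumes p: "\<And>x y. 0 \<le> p x y"
  shows "emeasure M {\<omega> \<in> space M. Y n \<omega> = y \<and> card {i. i < n \<and> Y i \<omega> \<in> R} = 1}
    = ennreal (weighted_paths p R 1 y n x0 (kronecker 1))"
proof -
  let ?L = "{xs. length xs = Suc n \<and> hd xs = x0 \<and> last xs = y}"
  have "emeasure M {\<omega> \<in> space M. Y n \<omega> = y \<and> card {i. i < n \<and> Y i \<omega> \<in> R} = 1}
    = (\<Sum>xs\<in>?L. emeasure M {\<omega> \<in> space M. (\<forall>i\<le>n. Y i \<omega> = xs ! i) \<and> card {i. i < n \<and> Y i \<omega> \<in> R} = 1})"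
    by (rule path_decomposition) measurable
  also have "\<dots> = (\<Sum>xs\<in>?L. ennreal ((\<Prod>i<n. p (xs ! i) (xs ! Suc i)) * 1 ^ card {i. i < n \<and> xs ! i \<notin> R}
      * kronecker 1 (card {i. i < n \<and> xs ! i \<in> R})))"
  proof (intro sum.cong refl)
    fix xs assume "xs \<in> ?L"
    then have xs: "xs ! 0 = x0" by (cases xs) auto
    have c: "card {i. i < n \<and> Y i \<omega> \<in> R} = card {i. i < n \<and> xs ! i \<in> R}" if "\<forall>i\<le>n. Y i \<omega> = xs ! i" for \<omega>
      using that by (intro arg_cong[where f=card]) auto
    then have "{\<omega> \<in> space M. (\<forall>i\<le>n. Y i \<omega> = xs ! i) \<and> card {i. i < n \<and> Y i \<omega> \<in> R} = 1}
      = (if card {i. i < n \<and> xs ! i \<in> R} = 1 then {\<omega> \<in> space M. \<forall>i\<le>n. Y i \<omega> = xs ! i} else {})"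
      by auto
    then show "emeasure M {\<omega> \<in> space M. (\<forall>i\<le>n. Y i \<omega> = xs ! i) \<and> card {i. i < n \<and> Y i \<omega> \<in> R} = 1}
       = ennreal ((\<Prod>i<n. p (xs ! i) (xs ! Suc i)) * 1 ^ card {i. i < n \<and> xs ! i \<notin> R}
      * kronecker 1 (card {i. i < n \<and> xs ! i \<in> R}))"
      by (auto simp: path_prob xs kronecker_def)
  qed
  also have "\<dots> = ennreal (weighted_paths p R 1 y n x0 (kronecker 1))"
    unfolding weighted_paths_eq_sum
    by (intro sum_ennreal mult_nonneg_nonneg prod_nonneg) (auto simp: p kronecker_nonneg)
  finally show ?thesis .
qed

end

text \<open>The maximum principle: the limiting probability of never visiting \<open>R\<close> is harmonic off \<open>R\<close>.\<close>

lemma taboo_mass_tendsto_0: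
  fixes p :: "'a::finite \<Rightarrow> 'a \<Rightarrow> real"
  assumes st: "stochastic_kernel p" and irr: "irreducible_on UNIV p" and R: "R \<noteq> {}"
  shows "(\<lambda>n. \<Sum>y\<in>-R. weighted_paths p R 1 y n z (kronecker 0)) \<longlonglongrightarrow> 0"
proof -
  define S where "S n z = (\<Sum>y\<in>-R. weighted_paths p R 1 y n z (kronecker 0))" for n z
  have p: "0 \<le> p x y" "(\<Sum>y\<in>UNIV. p x y) = 1" for x y using st by (auto simp: stochastic_kernel_def)
  have S_in: "S n z = 0" if "z \<in> R" for n z
    unfolding S_def using that by (intro sum.neutral) (auto simp: weighted_paths_in_0 simp del: weighted_paths.simps)
  have S_0: "S 0 z = 1" if "z \<notin> R" for z
    using that by (simp add: S_def kronecker_def if_distrib[of "\<lambda>u. _ * u"] cong: if_cong)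
  have S_Suc: "S (Suc n) z = (\<Sum>u\<in>UNIV. p z u * S n u)" if "z \<notin> R" for n z
  proof -
    have "S (Suc n) z = (\<Sum>y\<in>-R. \<Sum>u\<in>UNIV. p z u * weighted_paths p R 1 y n u (kronecker 0))"
      using that by (simp add: S_def)
    also have "\<dots> = (\<Sum>u\<in>UNIV. \<Sum>y\<in>-R. p z u * weighted_paths p R 1 y n u (kronecker 0))" by (rule sum.swap)
    finally show ?thesis by (simp add: S_def sum_distrib_left)
  qed
  have S_nonneg: "0 \<le> S n z" for n z
    unfolding S_def by (intro sum_nonneg weighted_paths_nonneg p kronecker_nonneg) auto
  have S_dec: "S (Suc n) z \<le> S n z" for n z
  proof (induction n arbitrary: z)
    case 0
    show ?case
    proof (cases "z \<in> R")
      case False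
      have "S (Suc 0) z \<le> (\<Sum>u\<in>UNIV. p z u * 1)"
        unfolding S_Suc[OF False]
      proof (intro sum_mono mult_left_mono p)
        fix u show "S 0 u \<le> 1" using S_0 S_in by (cases "u \<in> R") auto
      qed
      then show ?thesis using p(2) S_0[OF False] by simp
    qed (simp add: S_in)
  next
    case (Suc n)
    show ?case
    proof (cases "z \<in> R")
      case False
      then show ?thesis unfolding S_Suc[OF False] by (intro sum_mono mult_left_mono p Suc)
    qed (simp add: S_in)
  qed
  have "\<exists>u. (\<lambda>n. S n z) \<longlonglongrightarrow> u" for z
    using decseq_convergent[of "\<lambda>n. S n z" 0] S_dec S_nonneg by (metis decseq_SucI)
  then obtain u where u: "\<And>z. (\<lambda>n. S n z) \<longlonglongrightarrow> u z" by metis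
  have u_in: "u z = 0" if "z \<in> R" for z
    using u[of z] S_in[OF that] by (simp add: LIMSEQ_const_iff)
  have u_nonneg: "0 \<le> u z" for z
    by (rule LIMSEQ_le_const[OF u]) (simp add: S_nonneg)
  have u_harm: "u z = (\<Sum>v\<in>UNIV. p z v * u v)" if "z \<notin> R" for z
  proof (rule LIMSEQ_unique)
    show "(\<lambda>n. S (Suc n) z) \<longlonglongrightarrow> u z" using u by (rule LIMSEQ_Suc)
    show "(\<lambda>n. S (Suc n) z) \<longlonglongrightarrow> (\<Sum>v\<in>UNIV. p z v * u v)"
      unfolding S_Suc[OF that] by (intro tendsto_sum tendsto_mult tendsto_const u)
  qed
  define m where "m = Max (range u)"
  have ule: "u z \<le> m" for z unfolding m_def by (intro Max_ge) auto
  have "m \<in> range u" unfolding m_def by (rule Max_in) auto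
  then obtain z0 where z0: "u z0 = m" by auto
  have "m = 0"
  proof (rule ccontr)
    assume "m \<noteq> 0"
    then have m: "0 < m" using u_nonneg[of z0] z0 by simp
    obtain r where r: "r \<in> R" using R by blast
    \<comment> \<open>At a maximum outside R, harmonicity makes every neighbor a maximum; followed
      to r in R, where u vanishes, this contradicts m > 0.\<close>
    have "(z0, r) \<in> {(u, v). u \<in> UNIV \<and> v \<in> UNIV \<and> 0 < p u v}\<^sup>*"
      using irr by (auto simp: irreducible_on_def)
    then have "u r = m"
    proof (induction rule: rtrancl_induct)
      case (step a b)
      have a: "a \<notin> R" using step.IH m u_in[of a] by auto
      have "(\<Sum>v\<in>UNIV. p a v * (m - u v)) = 0"
        using u_harm[OF a] step.IH p(2)[of a] by (simp add: right_diff_distrib sum_subtractf sum_distrib_right[symmetric])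
      then have "p a b * (m - u b) = 0"
        using p(1) ule by (subst (asm) sum_nonneg_eq_0_iff) auto
      then show ?case using step.hyps by simp
    qed (rule z0)
    then show False using u_in[OF r] m by simp
  qed
  then have "u z = 0" using ule[of z] u_nonneg[of z] by simp
  then show ?thesis using u[of z] by (simp add: S_def)
qed

context clocked_chain
begin

text \<open>Not returning means, for every n, exactly one visit before step n + 1 and a state
  outside R at that step. After the first step this is the taboo mass without killing (q = 1), which
  tends to 0.\<close>

lemma AE_return:
  assumes st: "stochastic_kernel p" and irr: "irreducible_on UNIV p" and R: "x0 \<in> R"
  shows "AE \<omega> in M. \<exists>n\<ge>1. Y n \<omega> \<in> R"
proof -
  have p: "0 \<le> p x y" for x y using st by (auto simp: stochastic_kernel_def)
  let ?N = "{\<omega> \<in> space M. Y 0 \<omega> = x0 \<and> (\<forall>n. Y (Suc n) \<omega> \<notin> R)}"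
  let ?W = "weighted_paths p R 1"
  have "prob ?N \<le> (\<Sum>z\<in>UNIV. p x0 z * (\<Sum>y\<in>-R. ?W y n z (kronecker 0)))" for n
  proof -
    let ?F = "\<lambda>y. {\<omega> \<in> space M. Y (Suc n) \<omega> = y \<and> card {i. i < Suc n \<and> Y i \<omega> \<in> R} = 1}"
    have "?N \<subseteq> (\<Union>y\<in>-R. ?F y)"
    proof
      fix \<omega> assume w: "\<omega> \<in> ?N"
      have "{i. i < Suc n \<and> Y i \<omega> \<in> R} = {0}"
      proof (rule subset_antisym; rule subsetI)
        fix i assume "i \<in> {i. i < Suc n \<and> Y i \<omega> \<in> R}"
        then show "i \<in> {0}" using w by (cases i) auto
      qed (use w R in auto)
      then show "\<omega> \<in> (\<Union>y\<in>-R. ?F y)" using w by auto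
    qed
    then have "prob ?N \<le> prob (\<Union>y\<in>-R. ?F y)" by (intro finite_measure_mono) measurable
    also have "\<dots> \<le> (\<Sum>y\<in>-R. prob (?F y))"
      by (rule finite_measure_subadditive_finite) auto
    also have "\<dots> = (\<Sum>y\<in>-R. ?W y (Suc n) x0 (kronecker 1))"
    proof (intro sum.cong refl)
      fix y
      show "prob (?F y) = ?W y (Suc n) x0 (kronecker 1)"
        using one_visit_prob[OF p, of "Suc n" y R] weighted_paths_nonneg[of p 1 "kronecker 1" R y "Suc n" x0]
        by (simp add: emeasure_eq_measure p kronecker_nonneg del: weighted_paths.simps)
    qed
    also have "\<dots> = (\<Sum>y\<in>-R. \<Sum>z\<in>UNIV. p x0 z * ?W y n z (kronecker 0))"
      using R kronecker_Suc_Suc[of 0] by simp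
    also have "\<dots> = (\<Sum>z\<in>UNIV. p x0 z * (\<Sum>y\<in>-R. ?W y n z (kronecker 0)))"
      by (subst sum.swap) (simp add: sum_distrib_left)
    finally show ?thesis .
  qed
  moreover have "(\<lambda>n. \<Sum>z\<in>UNIV. p x0 z * (\<Sum>y\<in>-R. ?W y n z (kronecker 0))) \<longlonglongrightarrow> (\<Sum>z\<in>UNIV. p x0 z * 0)"
    using R by (intro tendsto_sum tendsto_mult tendsto_const taboo_mass_tendsto_0 st irr) auto
  ultimately have "prob ?N \<le> (\<Sum>z\<in>UNIV. p x0 z * 0)" by (intro LIMSEQ_le_const) auto
  then have "prob ?N = 0" by (simp add: measure_le_0_iff)
  then have "AE \<omega> in M. \<not> (Y 0 \<omega> = x0 \<and> (\<forall>n. Y (Suc n) \<omega> \<notin> R))" by (subst (asm) prob_eq_0) auto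
  then show ?thesis using AE_start
  proof eventually_elim
    case (elim \<omega>)
    then obtain n where "Y (Suc n) \<omega> \<in> R" by auto
    then show ?case by (intro exI[of _ "Suc n"]) simp
  qed
qed

lemma return_event_measurable:
  "{\<omega> \<in> space M. process \<xi> Y (enn2real (return_time \<xi> Y R \<omega>)) \<omega> = y \<and>
      local_time \<xi> Y (- R) (return_time \<xi> Y R \<omega>) \<omega> \<le> \<sigma> \<omega>} \<in> sets M"
proof -
  have [measurable]: "(\<lambda>\<omega>. return_time \<xi> Y R \<omega>) \<in> borel_measurable M"
    by (rule return_time_measurable) measurable
  have [measurable]: "(\<lambda>\<omega>. process \<xi> Y (enn2real (return_time \<xi> Y R \<omega>)) \<omega>) \<in> measurable M (count_space UNIV)"
    by (rule process_measurable[OF xi_measurable Y_measurable]) measurable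
  have [measurable]: "(\<lambda>\<omega>. local_time \<xi> Y (- R) (return_time \<xi> Y R \<omega>) \<omega>) \<in> borel_measurable M"
    by (rule local_time_measurable[OF xi_measurable Y_measurable]) measurable
  show ?thesis by measurable
qed

text \<open>The event is split by the step n of the first return, which exists almost surely. From a
  start in R it is a step into R with exactly one visit before it, hence the weight
  \<open>kronecker 1\<close>.\<close>

lemma return_event_prob:
  assumes st: "stochastic_kernel p" and irr: "irreducible_on UNIV p" and x0: "x0 \<in> R" and y: "y \<in> R"
  shows "emeasure M {\<omega> \<in> space M. process \<xi> Y (enn2real (return_time \<xi> Y R \<omega>)) \<omega> = y \<and>
      local_time \<xi> Y (- R) (return_time \<xi> Y R \<omega>) \<omega> \<le> \<sigma> \<omega>}
    = (\<Sum>n. ennreal (weighted_paths p R (1 / (1 + l)) y n x0 (kronecker 1)))"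
proof -
  have p: "0 \<le> p x y" for x y using st by (auto simp: stochastic_kernel_def)
  let ?E = "{\<omega> \<in> space M. process \<xi> Y (enn2real (return_time \<xi> Y R \<omega>)) \<omega> = y \<and>
      local_time \<xi> Y (- R) (return_time \<xi> Y R \<omega>) \<omega> \<le> \<sigma> \<omega>}"
  let ?V = "\<lambda>n \<omega>. {i. i < n \<and> Y i \<omega> \<in> R}"
  let ?F = "\<lambda>n. {\<omega> \<in> space M. Y n \<omega> = y \<and> (card (?V n \<omega>) = 1 \<and> ennreal (occupation \<xi> Y (- R) n \<omega>) \<le> \<sigma> \<omega>)}"
  have one: "card (?V n \<omega>) = 1 \<longleftrightarrow> 1 \<le> n \<and> (\<forall>i. 1 \<le> i \<longrightarrow> i < n \<longrightarrow> Y i \<omega> \<notin> R)" if "Y 0 \<omega> = x0" for n \<omega>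
  proof
    assume c: "card (?V n \<omega>) = 1"
    then have n: "1 \<le> n" by (cases n) auto
    obtain a where a: "?V n \<omega> = {a}" using c by (rule card_1_singletonE)
    have "0 \<in> ?V n \<omega>" using that x0 n by auto
    then have "\<And>i. i \<in> ?V n \<omega> \<Longrightarrow> i = 0" unfolding a by blast
    then have "Y i \<omega> \<notin> R" if "1 \<le> i" "i < n" for i using that by force
    then show "1 \<le> n \<and> (\<forall>i. 1 \<le> i \<longrightarrow> i < n \<longrightarrow> Y i \<omega> \<notin> R)" using n by blast
  next
    assume "1 \<le> n \<and> (\<forall>i. 1 \<le> i \<longrightarrow> i < n \<longrightarrow> Y i \<omega> \<notin> R)"
    then have "i \<in> ?V n \<omega> \<longleftrightarrow> i = 0" for i using that x0 by (cases i) auto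
    then have "?V n \<omega> = {0}" by blast
    then show "card (?V n \<omega>) = 1" by simp
  qed
  have "emeasure M ?E = (\<Sum>n. emeasure M (?F n))"
  proof (rule emeasure_countable_partition)
    show "?E \<in> sets M" by (rule return_event_measurable)
    show "?F n \<in> sets M" for n by measurable
    show "AE \<omega> in M. \<omega> \<in> ?E \<longleftrightarrow> (\<exists>n. \<omega> \<in> ?F n)"
      using AE_regular AE_start AE_return[OF st irr x0] AE_space
    proof eventually_elim
      case (elim \<omega>)
      interpret regular_clock \<xi> Y \<omega> by fact
      show ?case
      proof
        assume w: "\<omega> \<in> ?E"
        define n where "n = (LEAST n. 1 \<le> n \<and> Y n \<omega> \<in> R)"
        have n: "1 \<le> n \<and> Y n \<omega> \<in> R" unfolding n_def using elim(3) by (rule LeastI_ex)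
        have before: "Y i \<omega> \<notin> R" if "1 \<le> i" "i < n" for i
          using not_less_Least[of i "\<lambda>n. 1 \<le> n \<and> Y n \<omega> \<in> R"] that n_def by auto
        note conj = n[THEN conjunct1] n[THEN conjunct2] before
        show "\<exists>n. \<omega> \<in> ?F n"
          using w process_return_time[of n R, OF conj] local_time_return_time[of n R, OF conj] one[OF elim(2), of n] n before
          by (intro exI[of _ n]) simp
      next
        assume "\<exists>n. \<omega> \<in> ?F n"
        then obtain n where n: "Y n \<omega> = y" "card (?V n \<omega>) = 1" "ennreal (occupation \<xi> Y (- R) n \<omega>) \<le> \<sigma> \<omega>" by auto
        have b: "1 \<le> n" "Y n \<omega> \<in> R" "\<And>i. 1 \<le> i \<Longrightarrow> i < n \<Longrightarrow> Y i \<omega> \<notin> R"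
          using one[OF elim(2), of n] n y by auto
        show "\<omega> \<in> ?E" using n elim(4) process_return_time[OF b] local_time_return_time[OF b] by simp
      qed
    qed
    show "AE \<omega> in M. \<forall>m n. \<omega> \<in> ?F m \<longrightarrow> \<omega> \<in> ?F n \<longrightarrow> m = n"
      using AE_start
    proof eventually_elim
      case (elim \<omega>)
      have "\<not> m < n" if "\<omega> \<in> ?F m" "\<omega> \<in> ?F n" for m n
        using that one[OF elim, of m] one[OF elim, of n] y by auto
      then show ?case by (meson linorder_neqE_nat)
    qed
  qed
  also have "\<dots> = (\<Sum>n. ennreal (weighted_paths p R (1 / (1 + l)) y n x0 (kronecker 1)))"
  proof (rule suminf_cong)
    fix n
    show "emeasure M (?F n) = ennreal (weighted_paths p R (1 / (1 + l)) y n x0 (kronecker 1))"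
    \<comment> \<open>The condition concerns the chain alone, so no gap is read and its probability
      along a path is 0 or 1.\<close>
    proof (rule killed_path_prob[where I = "\<lambda>_. {}" and Q = "\<lambda>xs _. card {i. i < n \<and> xs ! i \<in> R} = 1"])
      show "{\<omega> \<in> space M. card (?V n \<omega>) = 1} \<in> sets M" by measurable
      fix xs :: "'a list"
      show "card (?V n \<omega>) = 1 \<longleftrightarrow> card {i. i < n \<and> xs ! i \<in> R} = 1" if "\<forall>i\<le>n. Y i \<omega> = xs ! i" for \<omega>
      proof -
        have "?V n \<omega> = {i. i < n \<and> xs ! i \<in> R}" using that by auto
        then show ?thesis by simp
      qed
      show "{f \<in> space (Pi\<^sub>M {} (\<lambda>_. borel :: real measure)). card {i. i < n \<and> xs ! i \<in> R} = 1} \<in> sets (Pi\<^sub>M {} (\<lambda>_. borel))"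
        by measurable
      show "emeasure M {\<omega> \<in> space M. card {i. i < n \<and> xs ! i \<in> R} = 1} = ennreal (kronecker 1 (card {i. i < n \<and> xs ! i \<in> R}))"
        by (cases "card {i. i < n \<and> xs ! i \<in> R} = 1") (simp_all add: kronecker_def emeasure_space_1)
    qed (use p kronecker_nonneg in auto)
  qed
  finally show ?thesis .
qed

end

section \<open>The soft kernel\<close>

text \<open>Detailed balance carries positive mass along the edges of p from some point that has
  it.\<close>

lemma reversible_measure_pos:
  assumes "probability_vector UNIV \<mu>" "reversible \<mu> p" "irreducible_on UNIV p"
  shows "0 < \<mu> x"
proof -
  have nn: "0 \<le> \<mu> x" for x using assms(1) by (simp add: probability_vector_def)
  have "(\<Sum>x\<in>UNIV. \<mu> x) = 1" using assms(1) by (simp add: probability_vector_def)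
  then obtain a where "\<mu> a \<noteq> 0" by (metis sum.neutral zero_neq_one)
  then have a: "0 < \<mu> a" using nn[of a] by simp
  have "(a, x) \<in> {(u, v). u \<in> UNIV \<and> v \<in> UNIV \<and> 0 < p u v}\<^sup>*"
    using assms(3) by (auto simp: irreducible_on_def)
  then show ?thesis
  proof (induction rule: rtrancl_induct)
    case (step b c)
    have "\<mu> b * p b c = \<mu> c * p c b" using assms(2) by (simp add: reversible_def)
    moreover have "0 < \<mu> b * p b c" using step by simp
    ultimately have "\<mu> c \<noteq> 0" by auto
    then show ?case using nn[of c] by simp
  qed (rule a)
qed

locale soft_model =
  fixes p :: "'a::finite \<Rightarrow> 'a \<Rightarrow> real"
    and \<mu> :: "'a \<Rightarrow> real"
    and R :: "'a set"
    and l :: real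
    and M :: "'a \<Rightarrow> 'w measure"
    and \<xi> :: "nat \<Rightarrow> 'w \<Rightarrow> real"
    and Y :: "nat \<Rightarrow> 'w \<Rightarrow> 'a"
    and \<sigma> :: "'w \<Rightarrow> ennreal"
  assumes stochastic: "stochastic_kernel p"
    and prob_mu: "probability_vector UNIV \<mu>"
    and rev_mu: "reversible \<mu> p"
    and irr_p: "irreducible_on UNIV p"
    and R_nonempty: "R \<noteq> {}"
    and irr_R: "irreducible_on R (restricted_kernel p R)"
    and l_nonneg: "0 \<le> l"
    and models: "clock_model p l x (M x) \<xi> Y \<sigma>"
begin

abbreviation "\<nu> \<equiv> cond_vector \<mu> R"
abbreviation "K \<equiv> soft_kernel M \<xi> Y \<sigma> R"

lemma chain: "clocked_chain p l x (M x) \<xi> Y \<sigma>"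
  by unfold_locales (rule models, rule l_nonneg)

lemma p_nonneg: "0 \<le> p x y"
  using stochastic by (simp add: stochastic_kernel_def)

sublocale taboo_paths p R "1 / (1 + l)"
  by unfold_locales (use p_nonneg l_nonneg in auto)

lemma mu_pos: "0 < \<mu> x"
  by (rule reversible_measure_pos[OF prob_mu rev_mu irr_p])

lemma mu_R_pos: "0 < (\<Sum>z\<in>R. \<mu> z)"
  using R_nonempty mu_pos by (intro sum_pos) auto

lemma nu_pos: "x \<in> R \<Longrightarrow> 0 < \<nu> x"
  using mu_pos mu_R_pos by (simp add: cond_vector_def)

lemma nu_mass: "(\<Sum>x\<in>R. \<nu> x) = 1"
  using mu_R_pos by (simp add: cond_vector_def sum_divide_distrib[symmetric])

lemma soft_kernel_series:
  assumes "x \<in> R" "y \<in> R"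
  shows "path_series 1 x y = ennreal (K x y) \<and> 0 \<le> K x y"
proof -
  interpret clocked_chain p l x "M x" \<xi> Y \<sigma> by (rule chain)
  show ?thesis
    using return_event_prob[OF stochastic irr_p assms]
    by (simp add: soft_kernel_def path_series_def emeasure_eq_measure)
qed

lemma soft_kernel_reversible:
  assumes "x \<in> R" "y \<in> R"
  shows "\<nu> x * K x y = \<nu> y * K y x"
proof -
  let ?W = "weighted_paths p R (1 / (1 + l))"
  have "ennreal (\<mu> u * K u v) = (\<Sum>n. ennreal (\<mu> u * ?W v n u (kronecker 1)))" if "u \<in> R" "v \<in> R" for u v
  proof -
    have "ennreal (\<mu> u * K u v) = ennreal (\<mu> u) * path_series 1 u v"
      using soft_kernel_series[OF that] mu_pos[of u] by (simp add: ennreal_mult)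
    also have "\<dots> = (\<Sum>n. ennreal (\<mu> u) * ennreal (?W v n u (kronecker 1)))"
      by (simp add: path_series_def)
    also have "\<dots> = (\<Sum>n. ennreal (\<mu> u * ?W v n u (kronecker 1)))"
      using mu_pos[of u] weighted_paths_kronecker_nonneg by (simp add: ennreal_mult)
    finally show ?thesis .
  qed
  moreover have "\<mu> x * ?W y n x (kronecker 1) = \<mu> y * ?W x n y (kronecker 1)" for n
    using rev_mu l_nonneg by (intro weighted_paths_reversible mu_pos assms) (auto simp: reversible_def)
  ultimately have "ennreal (\<mu> x * K x y) = ennreal (\<mu> y * K y x)" using assms by simp
  then have "\<mu> x * K x y = \<mu> y * K y x"
    using soft_kernel_series[OF assms] soft_kernel_series[OF assms(2,1)] mu_pos
    by (subst (asm) ennreal_inj) (auto intro: mult_nonneg_nonneg less_imp_le)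
  then show ?thesis using assms by (simp add: cond_vector_def)
qed

lemma soft_kernel_sub: 
  assumes "x \<in> R"
  shows "(\<Sum>y\<in>R. K x y) \<le> 1"
proof -
  interpret clocked_chain p l x "M x" \<xi> Y \<sigma> by (rule chain)
  let ?E = "\<lambda>y. {\<omega> \<in> space (M x). process \<xi> Y (enn2real (return_time \<xi> Y R \<omega>)) \<omega> = y \<and>
      local_time \<xi> Y (- R) (return_time \<xi> Y R \<omega>) \<omega> \<le> \<sigma> \<omega>}"
  have "(\<Sum>y\<in>R. prob (?E y)) = prob (\<Union>y\<in>R. ?E y)"
    using return_event_measurable
    by (intro finite_measure_finite_Union[symmetric]) (auto simp: disjoint_family_on_def)
  also have "\<dots> \<le> 1" by (rule prob_le_1)
  finally show ?thesis by (simp add: soft_kernel_def)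
qed

lemma soft_kernel_ge: "x \<in> R \<Longrightarrow> y \<in> R \<Longrightarrow> p x y \<le> K x y"
  using path_series_1_ge[of x y] soft_kernel_series[of x y] by simp

lemma restricted_irreducible: "irreducible_kernel R \<nu> (restricted_kernel p R)"
proof unfold_locales
  show "x \<in> R \<Longrightarrow> y \<in> R \<Longrightarrow> \<nu> x * restricted_kernel p R x y = \<nu> y * restricted_kernel p R y x" for x y
    using rev_mu by (simp add: restricted_kernel_def cond_vector_def reversible_def)
  show "0 \<le> restricted_kernel p R x y" for x y
    by (simp add: restricted_kernel_def p_nonneg add_nonneg_nonneg sum_nonneg)
qed (use nu_pos R_nonempty irr_R in auto)

lemma soft_kernel_irreducible: "irreducible_kernel R \<nu> K"
proof unfold_locales
  let ?A = "{(u, v). u \<in> R \<and> v \<in> R \<and> 0 < restricted_kernel p R u v}"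
  let ?B = "{(u, v). u \<in> R \<and> v \<in> R \<and> 0 < K u v}"
  \<comment> \<open>Only the diagonal of the restricted kernel can escape the bound p \<le> K, and
    loops do not affect reachability.\<close>
  have "?A \<subseteq> ?B \<union> Id"
    using soft_kernel_ge by (force simp: restricted_kernel_def)
  then have "?A\<^sup>* \<subseteq> ?B\<^sup>*" using rtrancl_mono[of ?A "?B \<union> Id"] by (simp add: rtrancl_Un_subset)
  then show "irreducible_on R K" using irr_R by (auto simp: irreducible_on_def)
qed (use nu_pos R_nonempty soft_kernel_reversible soft_kernel_series in auto)

lemma ex_killed_kernel: "\<exists>h k. killed_kernel R \<nu> K h k"
proof -
  interpret irreducible_kernel R \<nu> K by (rule soft_kernel_irreducible)
  obtain h k where "\<And>x. x \<in> R \<Longrightarrow> 0 < h x" "(\<Sum>x\<in>R. \<nu> x * h x) = 1"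
    "\<And>x. x \<in> R \<Longrightarrow> kernel_op R K h x = k * h x" using perron_frobenius by blast
  then have "killed_kernel R \<nu> K h k" by unfold_locales (auto simp: soft_kernel_sub nu_mass)
  then show ?thesis by blast
qed

text \<open>Expanding the Poisson weight over the number of visits turns the path sum into the
  exponential series of K; the factor exp t removes the Poisson normalization.\<close>

lemma trace_flow_sums:
  assumes x: "x \<in> R" and y: "y \<in> R" and t: "0 \<le> t"
  shows "(\<lambda>k. t ^ k / fact k * (kernel_op R K ^^ k) (indicator {y}) x) sums
    (exp t * \<P>(\<omega> in M x. trace_process \<xi> Y R t \<omega> = y \<and> ennreal t < soft_exit_time \<xi> Y \<sigma> R \<omega>))"
proof -
  interpret clocked_chain p l x "M x" \<xi> Y \<sigma> by (rule chain)
  let ?P = "prob {\<omega> \<in> space (M x). trace_process \<xi> Y R t \<omega> = y \<and> ennreal t < soft_exit_time \<xi> Y \<sigma> R \<omega>}"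
  let ?k = "\<lambda>k. (kernel_op R K ^^ k) (indicator {y}) x"
  note power = path_series_power[of K, OF soft_kernel_series x y]
  have "ennreal ?P = (\<Sum>k. ennreal (exp (- t) * t ^ k / fact k) * path_series k x y)"
    using trace_event_prob[OF p_nonneg y t] weighted_paths_expansion_series[of "\<lambda>a. exp (- t) * t ^ a / fact a" y x] t
    by (simp add: emeasure_eq_measure)
  also have "\<dots> = (\<Sum>k. ennreal (exp (- t) * t ^ k / fact k * ?k k))"
  proof (rule suminf_cong)
    fix k
    show "ennreal (exp (- t) * t ^ k / fact k) * path_series k x y = ennreal (exp (- t) * t ^ k / fact k * ?k k)"
      by (subst ennreal_mult) (use t power in auto)
  qed
  finally have "(\<lambda>k. ennreal (exp (- t) * t ^ k / fact k * ?k k)) sums ennreal ?P"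
    by (simp add: sums_iff summableI)
  then have "(\<lambda>k. exp (- t) * t ^ k / fact k * ?k k) sums ?P"
    by (subst (asm) sums_ennreal) (use t power in auto)
  then have "(\<lambda>k. exp t * (exp (- t) * t ^ k / fact k * ?k k)) sums (exp t * ?P)" by (rule sums_mult)
  moreover have "exp t * (exp (- t) * t ^ k / fact k * ?k k) = t ^ k / fact k * ?k k" for k
    by (simp add: exp_minus)
  ultimately show ?thesis by (simp only:)
qed

text \<open>Both sides of the quotient are multiplied by exp t to match the series in
  \<open>flow_ratio_close\<close>.\<close>

lemma cond_trace_eq:
  assumes t: "0 \<le> t"
  shows "cond_prob (M x) (\<lambda>\<omega>. trace_process \<xi> Y R t \<omega> = y) (\<lambda>\<omega>. soft_exit_time \<xi> Y \<sigma> R \<omega> > ennreal t)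
    = exp t * \<P>(\<omega> in M x. trace_process \<xi> Y R t \<omega> = y \<and> ennreal t < soft_exit_time \<xi> Y \<sigma> R \<omega>)
     / (\<Sum>z\<in>R. exp t * \<P>(\<omega> in M x. trace_process \<xi> Y R t \<omega> = z \<and> ennreal t < soft_exit_time \<xi> Y \<sigma> R \<omega>))"
proof -
  interpret clocked_chain p l x "M x" \<xi> Y \<sigma> by (rule chain)
  show ?thesis
    unfolding cond_prob_def soft_exit_prob[OF t, of R] sum_distrib_left[symmetric] by simp
qed

end

theorem theorem2p15:
  fixes p :: "'a::finite \<Rightarrow> 'a \<Rightarrow> real"
    and \<mu> :: "'a \<Rightarrow> real"
    and R :: "'a set"
    and l :: real
    and M :: "'a \<Rightarrow> 'w measure"
    and \<xi> :: "nat \<Rightarrow> 'w \<Rightarrow> real"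
    and Y :: "nat \<Rightarrow> 'w \<Rightarrow> 'a"
    and \<sigma> :: "'w \<Rightarrow> ennreal"
  assumes "stochastic_kernel p"
    and "probability_vector UNIV \<mu>"
    and "reversible \<mu> p"
    and "irreducible_on UNIV p"
    and "R \<noteq> {}" and "R \<noteq> UNIV"
    and "irreducible_on R (restricted_kernel p R)"
    and "irreducible_on (-R) (restricted_kernel p (-R))"
    and "0 \<le> l"
    and "\<And>x. clock_model p l x (M x) \<xi> Y \<sigma>"
  shows
   "let \<nu> = cond_vector \<mu> R;
        \<phi>R = escape_rate R p;
        \<gamma>R = spectral_gap R \<nu> (restricted_kernel p R);
        \<epsilon>R = eps_ratio \<phi>R \<gamma>R;
        K = soft_kernel M \<xi> Y \<sigma> R;
        e = escape_prob K R;
        P = completed_kernel K R;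
        \<phi> = escape_rate R K;
        \<gamma> = spectral_gap R \<nu> P;
        \<gamma>s = eigenvalue_gap R K;
        \<epsilon> = eps_ratio \<phi> \<gamma>;
        \<mu>s = quasi_stationary R K;
        h = (\<lambda>x. \<mu>s x / \<nu> x);
        \<zeta>s = Min ((\<lambda>x. \<nu> x * (h x)\<^sup>2) ` R);
        \<zeta> = Min (\<nu> ` R);
        \<alpha> = Max (e ` R)
    in
      (\<phi> \<le> \<phi>R \<and> \<gamma>R \<le> \<gamma> \<and> \<epsilon> \<le> \<epsilon>R) \<and>
      (\<epsilon> < 1 \<longrightarrow>
         var_on R \<nu> h = norm2_on R \<nu> (\<lambda>x. h x - 1) \<and>
         norm2_on R \<nu> (\<lambda>x. h x - 1) \<le> \<epsilon> / (1 - \<epsilon>)) \<and>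
      (\<epsilon> < 1/3 \<longrightarrow> 1 / \<gamma>s \<le> (1 / \<gamma>) * ereal ((1 - \<epsilon>) / (1 - 3 * \<epsilon>))) \<and>
      (\<epsilon> < 1/3 \<longrightarrow>
         (\<forall>x\<in>R. \<forall>y\<in>R. \<forall>\<delta>. 0 < \<delta> \<and> \<delta> < 1 \<longrightarrow>
           (\<forall>t. ereal t > mixing_bound \<gamma> \<epsilon> \<zeta>s \<delta> \<longrightarrow>
              \<bar>cond_prob (M x)
                  (\<lambda>\<omega>. trace_process \<xi> Y R t \<omega> = y)
                  (\<lambda>\<omega>. soft_exit_time \<xi> Y \<sigma> R \<omega> > ennreal t)
                / \<mu>s y - 1\<bar> < \<delta>))) \<and>
      (\<epsilon> < 1 \<longrightarrow>
         ereal (ln (1 / \<zeta>s)) \<le>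
           ereal (ln (4 / \<zeta>))
           + (ereal \<alpha> / \<gamma>) * ereal (max 0 (ln (4 * \<epsilon> / ((1 - \<epsilon>) * \<zeta>))))) \<and>
      ((\<forall>x\<in>R. 0 < p x x) \<longrightarrow>
         ln (1 / \<zeta>s) \<le> ln (1 / Min ((\<lambda>x. (\<mu>s x)\<^sup>2) ` R)) \<and>
         ln (1 / Min ((\<lambda>x. (\<mu>s x)\<^sup>2) ` R))
           \<le> 2 * max_neg_ln R K * real (positivity_exponent R P))"
proof -
  interpret soft_model p \<mu> R l M \<xi> Y \<sigma> by (rule soft_model.intro) (fact assms)+
  obtain h k0 where "killed_kernel R \<nu> K h k0" using ex_killed_kernel by blast
  then interpret killed_kernel R \<nu> K h k0 .
  interpret P: irreducible_kernel R \<nu> "completed_kernel K R" by (rule completed_irreducible)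
  interpret PR: irreducible_kernel R \<nu> "restricted_kernel p R" by (rule restricted_irreducible)
  define \<phi> where "\<phi> = escape_rate R K"
  define \<phi>R where "\<phi>R = escape_rate R p"
  define \<gamma> where "\<gamma> = spectral_gap R \<nu> (completed_kernel K R)"
  define \<gamma>R where "\<gamma>R = spectral_gap R \<nu> (restricted_kernel p R)"
  define \<epsilon> where "\<epsilon> = eps_ratio \<phi> \<gamma>"
  define \<epsilon>R where "\<epsilon>R = eps_ratio \<phi>R \<gamma>R"
  define \<alpha> where "\<alpha> = Max (escape_prob K R ` R)"
  define \<zeta> where "\<zeta> = Min (\<nu> ` R)"
  define ms where "ms = quasi_stationary R K"
  have \<phi>: "\<phi> = 1 - k0" by (simp add: \<phi>_def escape_rate_eq)
  have \<phi>0: "0 \<le> \<phi>" using k0_le_1 by (simp add: \<phi>)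
  have \<phi>R: "\<phi> \<le> \<phi>R"
    unfolding \<phi> \<phi>R_def by (rule escape_rate_dominated) (use p_nonneg soft_kernel_ge in auto)
  have \<gamma>R: "\<gamma>R \<le> \<gamma>"
    unfolding \<gamma>_def \<gamma>R_def
  proof (rule spectral_gap_mono)
    fix f
    \<comment> \<open>The entrywise bound p \<le> K suffices, because completing or restricting
      changes only the diagonal.\<close>
    have "dirichlet_on R \<nu> p f \<le> dirichlet_on R \<nu> K f"
      unfolding dirichlet_on_def using nu_pos soft_kernel_ge
      by (intro mult_left_mono sum_mono mult_right_mono) (auto intro: less_imp_le)
    then show "dirichlet_on R \<nu> (restricted_kernel p R) f \<le> dirichlet_on R \<nu> (completed_kernel K R) f"
      by (simp add: dirichlet_on_completed_kernel dirichlet_on_restricted_kernel)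
  qed
  have ms: "x \<in> R \<Longrightarrow> ms x = \<nu> x * h x" for x by (simp add: ms_def quasi_stationary_eq)
  have hs: "x \<in> R \<Longrightarrow> ms x / \<nu> x = h x" for x using nu_pos[of x] by (simp add: ms)
  have var_h: "var_on R \<nu> (\<lambda>x. ms x / \<nu> x) = var_on R \<nu> h"
    unfolding var_on_def mean_on_def by (simp add: hs)
  have norm_h: "norm2_on R \<nu> (\<lambda>x. ms x / \<nu> x - 1) = norm2_on R \<nu> (\<lambda>x. h x - 1)"
    unfolding norm2_on_def by (simp add: hs)
  have zs: "Min ((\<lambda>x. \<nu> x * (ms x / \<nu> x)\<^sup>2) ` R) = zeta_soft"
    unfolding zeta_soft_def by (intro arg_cong[where f=Min] image_cong) (auto simp: hs)
  have min_ms: "Min ((\<lambda>x. (ms x)\<^sup>2) ` R) = Min ((\<lambda>x. (\<nu> x * h x)\<^sup>2) ` R)"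
    by (intro arg_cong[where f=Min] image_cong) (auto simp: ms)
  have \<alpha>: "escape_prob K R x \<le> \<alpha>" if "x \<in> R" for x unfolding \<alpha>_def using that by (intro Max_ge) auto
  have \<alpha>0: "0 \<le> \<alpha>"
  proof -
    obtain x where "x \<in> R" using R_nonempty by blast
    then show ?thesis using \<alpha>[of x] escape_prob_nonneg[of x] by simp
  qed
  have part6: "ln (1 / zeta_soft) \<le> ln (1 / Min ((\<lambda>x. (ms x)\<^sup>2) ` R)) \<and>
       ln (1 / Min ((\<lambda>x. (ms x)\<^sup>2) ` R))
         \<le> 2 * max_neg_ln R K * real (positivity_exponent R (completed_kernel K R))"
    if "\<forall>x\<in>R. 0 < p x x"
  proof -
    have "0 < K x x" if "x \<in> R" for x using soft_kernel_ge[OF that that] \<open>\<forall>x\<in>R. 0 < p x x\<close> that by force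
    then show ?thesis unfolding min_ms using ln_soft_measure_le by blast
  qed
  have main: "\<epsilon> \<le> \<epsilon>R \<and>
      (\<epsilon> < 1 \<longrightarrow> norm2_on R \<nu> (\<lambda>x. h x - 1) \<le> \<epsilon> / (1 - \<epsilon>)) \<and>
      (\<epsilon> < 1/3 \<longrightarrow> 1 / eigenvalue_gap R K \<le> (1 / \<gamma>) * ereal ((1 - \<epsilon>) / (1 - 3 * \<epsilon>))) \<and>
      (\<epsilon> < 1/3 \<longrightarrow>
         (\<forall>x\<in>R. \<forall>y\<in>R. \<forall>\<delta>. 0 < \<delta> \<and> \<delta> < 1 \<longrightarrow>
           (\<forall>t. ereal t > mixing_bound \<gamma> \<epsilon> zeta_soft \<delta> \<longrightarrow>
              \<bar>cond_prob (M x) (\<lambda>\<omega>. trace_process \<xi> Y R t \<omega> = y)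
                  (\<lambda>\<omega>. soft_exit_time \<xi> Y \<sigma> R \<omega> > ennreal t) / ms y - 1\<bar> < \<delta>))) \<and>
      (\<epsilon> < 1 \<longrightarrow> ereal (ln (1 / zeta_soft)) \<le> ereal (ln (4 / \<zeta>))
           + (ereal \<alpha> / \<gamma>) * ereal (max 0 (ln (4 * \<epsilon> / ((1 - \<epsilon>) * \<zeta>)))))"
  \<comment> \<open>With two points all gaps are real and the estimates apply. On a singleton the
    gaps are \<infinity>, \<epsilon> is 0 and h is 1, so the bounds hold by extended
    arithmetic.\<close>
  proof (cases "card R = 1")
    case False
    obtain g where g: "0 < g" "\<gamma> = ereal g" "\<And>f. g * var_on R \<nu> f \<le> dirichlet_on R \<nu> K f"
      using P.spectral_gap_real[OF nu_mass False] by (auto simp: \<gamma>_def dirichlet_on_completed_kernel)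
    obtain gR where gR: "0 < gR" "\<gamma>R = ereal gR"
      using PR.spectral_gap_real[OF nu_mass False] by (auto simp: \<gamma>R_def)
    have \<epsilon>: "\<epsilon> = (1 - k0) / g" using g by (simp add: \<epsilon>_def eps_ratio_def \<phi>)
    have "\<epsilon>R = \<phi>R / gR" using gR by (simp add: \<epsilon>R_def eps_ratio_def)
    then have part1: "\<epsilon> \<le> \<epsilon>R"
      using \<phi>0 \<phi>R \<gamma>R g gR unfolding \<epsilon> \<phi>[symmetric] by (auto intro!: frac_le)
    have part3: "1 / eigenvalue_gap R K \<le> (1 / \<gamma>) * ereal ((1 - \<epsilon>) / (1 - 3 * \<epsilon>))" if "\<epsilon> < 1/3"
    proof -
      define c where "c = g * ((1 - 3 * \<epsilon>) / (1 - \<epsilon>))"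
      have c: "0 < c" using g that by (simp add: c_def)
      have "ereal c \<le> eigenvalue_gap R K"
        using eigenvalue_gap_soft[OF g(1,3)] that by (simp add: \<epsilon> c_def)
      then have "1 / eigenvalue_gap R K \<le> ereal (1 / c)"
        using c by (cases "eigenvalue_gap R K") (auto simp: one_ereal_def frac_le)
      also have "1 / c = 1 / g * ((1 - \<epsilon>) / (1 - 3 * \<epsilon>))" by (simp add: c_def)
      also have "ereal \<dots> = (1 / \<gamma>) * ereal ((1 - \<epsilon>) / (1 - 3 * \<epsilon>))"
        using g by (simp add: one_ereal_def)
      finally show ?thesis .
    qed
    have part4: "\<bar>cond_prob (M x) (\<lambda>\<omega>. trace_process \<xi> Y R t \<omega> = y)
          (\<lambda>\<omega>. soft_exit_time \<xi> Y \<sigma> R \<omega> > ennreal t) / ms y - 1\<bar> < \<delta>"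
      if e3: "\<epsilon> < 1/3" and xy: "x \<in> R" "y \<in> R" and \<delta>: "0 < \<delta>" "\<delta> < 1"
        and t: "ereal t > mixing_bound \<gamma> \<epsilon> zeta_soft \<delta>" for x y \<delta> t
    proof -
      have t': "1 / g * (ln (2 / (\<delta> * (1 - \<delta>) * zeta_soft)) * (1 + sqrt (\<epsilon> / (1 - \<epsilon>))) * ((1 - \<epsilon>) / (1 - 3 * \<epsilon>))) < t"
        using t g by (simp add: mixing_bound_def one_ereal_def)
      have t0: "0 \<le> t"
        using relative_error_bound(1)[OF g(1,3)] e3 \<delta> t' by (simp add: \<epsilon>)
      show ?thesis
        unfolding cond_trace_eq[OF t0] ms[OF xy(2)]
        by (rule flow_ratio_close[OF g(1,3), folded \<epsilon>, OF e3 xy \<delta> t']) (rule trace_flow_sums[OF xy(1) _ t0])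
    qed
    have part5: "ereal (ln (1 / zeta_soft)) \<le> ereal (ln (4 / \<zeta>))
           + (ereal \<alpha> / \<gamma>) * ereal (max 0 (ln (4 * \<epsilon> / ((1 - \<epsilon>) * \<zeta>))))" if "\<epsilon> < 1"
    proof -
      have "ln (1 / zeta_soft) \<le> ln (4 / \<zeta>) + \<alpha> / g * max 0 (ln (4 * \<epsilon> / ((1 - \<epsilon>) * \<zeta>)))"
        using zeta_soft_lower_bound[OF g(1,3), folded \<epsilon>, OF that \<alpha> \<alpha>0] by (simp add: \<zeta>_def)
      moreover have "ereal \<alpha> / \<gamma> = ereal (\<alpha> / g)" using g by simp
      ultimately show ?thesis by (simp only: times_ereal.simps plus_ereal.simps ereal_less_eq)
    qed
    show ?thesis
      using part1 part3 part4 part5 deviation_le[OF g(1,3), folded \<epsilon>] by blast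
  next
    case True
    then obtain a where R: "R = {a}" by (rule card_1_singletonE)
    have \<nu>a: "cond_vector \<mu> {a} a = 1" using nu_mass by (simp add: R)
    have ha: "h a = 1" using h_mean by (simp add: R \<nu>a)
    have \<gamma>: "\<gamma> = \<infinity>" "\<gamma>R = \<infinity>"
      unfolding \<gamma>_def \<gamma>R_def by (rule spectral_gap_singleton[OF True nu_mass])+
    have \<epsilon>0: "\<epsilon> = 0" "\<epsilon>R = 0" by (simp_all add: \<epsilon>_def \<epsilon>R_def eps_ratio_def \<gamma>)
    have z1: "zeta_soft = 1" unfolding zeta_soft_def by (simp add: R \<nu>a ha)
    have "ereal c \<le> eigenvalue_gap R K" for c
    proof -
      obtain \<psi> ev where "eigenbasis R \<nu> K \<psi> ev" using ex_eigenbasis by blast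
      then interpret eigenbasis R \<nu> K \<psi> ev .
      \<comment> \<open>A function orthogonal to h vanishes on a singleton, so any positive constant
        is a gap; the maximum with 1 ensures positivity.\<close>
      have "ereal (max 1 c) \<le> eigenvalue_gap R K"
        by (rule eigenvalue_gap_ge[of h k0]) (use h_eigen in \<open>auto simp: inner_on_def R \<nu>a ha\<close>)
      then show ?thesis by (rule order_trans[rotated]) simp
    qed
    then have eg: "eigenvalue_gap R K = \<infinity>" by (rule ereal_top)
    have part4: "\<bar>cond_prob (M x) (\<lambda>\<omega>. trace_process \<xi> Y R t \<omega> = y)
          (\<lambda>\<omega>. soft_exit_time \<xi> Y \<sigma> R \<omega> > ennreal t) / ms y - 1\<bar> < \<delta>"
      if xy: "x \<in> R" "y \<in> R" and \<delta>: "0 < \<delta>"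
        and t: "ereal t > mixing_bound \<gamma> \<epsilon> zeta_soft \<delta>" for x y \<delta> t
    proof -
      \<comment> \<open>1 / \<infinity> is 0, so the mixing bound itself is 0 here.\<close>
      have t0: "0 \<le> t" using t by (simp add: mixing_bound_def \<gamma>)
      define q where "q = exp t * \<P>(\<omega> in M a. trace_process \<xi> Y R t \<omega> = a \<and> ennreal t < soft_exit_time \<xi> Y \<sigma> R \<omega>)"
      have aR: "a \<in> R" by (simp add: R)
      have "0 \<le> (kernel_op R K ^^ n) (indicator {a}) a" for n
        using path_series_power[of K, OF soft_kernel_series aR aR] by blast
      \<comment> \<open>The term n = 0 of the nonnegative series is 1, so survival has positive
        probability and the quotient is 1.\<close>
      then have "(\<Sum>n\<in>{0}. t ^ n / fact n * (kernel_op R K ^^ n) (indicator {a}) a) \<le> q"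
        using sum_le_suminf[of "\<lambda>n. t ^ n / fact n * (kernel_op R K ^^ n) (indicator {a}) a" "{0}"]
          trace_flow_sums[OF aR aR t0] t0 by (simp add: sums_iff q_def)
      then have "q \<noteq> 0" by auto
      have "x = a" "y = a" using xy by (auto simp: R)
      then show ?thesis
        unfolding cond_trace_eq[OF t0] using \<open>q \<noteq> 0\<close> \<delta> ms[OF aR] by (simp add: R q_def \<nu>a ha)
    qed
    have "norm2_on R \<nu> (\<lambda>x. h x - 1) = 0" by (simp add: norm2_on_def R ha)
    moreover have "ln (1 / zeta_soft) \<le> ln (4 / \<zeta>)" unfolding z1 \<zeta>_def by (simp add: R \<nu>a)
    ultimately show ?thesis
      using part4 by (simp add: \<epsilon>0 \<gamma> eg)
  qed
  show ?thesis
    unfolding Let_def \<phi>_def[symmetric] \<phi>R_def[symmetric] \<gamma>_def[symmetric] \<gamma>R_def[symmetric]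
      \<epsilon>_def[symmetric] \<epsilon>R_def[symmetric] \<alpha>_def[symmetric] \<zeta>_def[symmetric] ms_def[symmetric]
      var_h norm_h zs
    using main \<phi>R \<gamma>R part6 var_on_h by blast
qed

end
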